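(* Let $\varphi$ be a positive linear functional on a $C^*$-algebra $\mathcal A$, and let $\underline x=(x_1,\dots,x_n)$ and $\underline y=(y_1,\dots,y_n)$ be abelian $n$-tuples of elements of the centralizer $\mathcal A^\varphi$. If $0\le x_i\le y_i$ for $i=1,\dots,n$, then $$\varphi(x_1^{p_1}\cdots x_n^{p_n})\le\varphi(y_1^{p_1}\cdots y_n^{p_n})$$ for arbitrary non-negative exponents $p_1,\dots,p_n$ (a factor with exponent $0$ is interpreted as the identity, i.e. omitted). In particular, for a trace $\tau$ on $\mathcal A$ and abelian $n$-tuples of positive elements with $x_i\le y_i$ for all $i$, $\tau(x_1\cdots x_n)\le\tau(y_1\cdots y_n)$.
   Context: The centralizer of $\varphi$ is $\mathcal A^\varphi=\{y\in\mathcal A:\varphi(xy)=\varphi(yx)\ \forall x\in\mathcal A\}$. An $n$-tuple is abelian if its entries mutually commute. Powers $x^p$ of positive elements are defined by continuous functional calculus. *)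

theory Defs
  imports "HOL-Analysis.Analysis" "HOL-Computational_Algebra.Polynomial" "HOL-Library.Complex_Order"
begin

locale cstar_algebra =
  fixes scaleC :: "complex \<Rightarrow> 'a::{real_normed_algebra,banach} \<Rightarrow> 'a"
    and star :: "'a \<Rightarrow> 'a"
  assumes scaleC_add_right: "scaleC c (x + y) = scaleC c x + scaleC c y"
    and scaleC_add_left: "scaleC (c + d) x = scaleC c x + scaleC d x"
    and scaleC_scaleC: "scaleC c (scaleC d x) = scaleC (c * d) x"
    and scaleC_one: "scaleC 1 x = x"
    and scaleC_of_real: "scaleC (complex_of_real r) x = scaleR r x"
    and norm_scaleC: "norm (scaleC c x) = norm c * norm x"
    and mult_scaleC_left: "scaleC c x * y = scaleC c (x * y)"
    and mult_scaleC_right: "x * scaleC c y = scaleC c (x * y)"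
    and star_add: "star (x + y) = star x + star y"
    and star_scaleC: "star (scaleC c x) = scaleC (cnj c) (star x)"
    and star_mult: "star (x * y) = star y * star x"
    and star_star: "star (star x) = x"
    and cstar_identity: "norm (star x * x) = norm x ^ 2"

definition cpos :: "('a::ring \<Rightarrow> 'a) \<Rightarrow> 'a \<Rightarrow> bool" where
  "cpos star x \<longleftrightarrow> (\<exists>a. x = star a * a)"

definition cle :: "('a::ring \<Rightarrow> 'a) \<Rightarrow> 'a \<Rightarrow> 'a \<Rightarrow> bool" where
  "cle star x y \<longleftrightarrow> cpos star (y - x)"

definition positive_functional ::
  "(complex \<Rightarrow> 'a::ring \<Rightarrow> 'a) \<Rightarrow> ('a \<Rightarrow> 'a) \<Rightarrow> ('a \<Rightarrow> complex) \<Rightarrow> bool" where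
  "positive_functional scaleC star \<phi> \<longleftrightarrow>
     (\<forall>x y. \<phi> (x + y) = \<phi> x + \<phi> y) \<and>
     (\<forall>c x. \<phi> (scaleC c x) = c * \<phi> x) \<and>
     (\<forall>x. 0 \<le> \<phi> (star x * x))"

definition centralizer :: "('a::times \<Rightarrow> complex) \<Rightarrow> 'a set" where
  "centralizer \<phi> = {y. \<forall>x. \<phi> (x * y) = \<phi> (y * x)}"

fun npow :: "'a::times \<Rightarrow> nat \<Rightarrow> 'a" where
  "npow x 0 = x"  \<comment> \<open>never used, only n \<ge> 1 matters\<close>
| "npow x (Suc 0) = x"
| "npow x (Suc (Suc n)) = x * npow x (Suc n)"

definition polyev :: "real poly \<Rightarrow> 'a::real_algebra \<Rightarrow> 'a" where
  "polyev q x = (\<Sum>i\<in>{1..degree q}. scaleR (coeff q i) (npow x i))"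

text \<open>Continuous functional calculus for t \<mapsto> t^p (p > 0) on a positive element x,
  realised as the limit of q_k(x) for polynomials q_k converging uniformly to t^p on
  [0, norm x] (which contains the spectrum of x).  Exponent 0 gives the identity, which
  in a product means the factor is omitted.\<close>
definition cfc_pow :: "'a::{real_normed_algebra} \<Rightarrow> real \<Rightarrow> 'a" where
  "cfc_pow x p = (THE z. \<forall>q :: nat \<Rightarrow> real poly.
      uniform_limit {0..norm x} (\<lambda>k t. poly (q k) t) (\<lambda>t. t powr p) sequentially
      \<longrightarrow> (\<lambda>k. polyev (q k) x) \<longlonglongrightarrow> z)"

text \<open>Ordered product of a list; empty product only arises when all exponents vanish
  (then both sides are the same term, so the claim is trivial there).\<close>
fun lprod :: "'a::times list \<Rightarrow> 'a" where
  "lprod [] = undefined"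
| "lprod [a] = a"
| "lprod (a # b # as) = a * lprod (b # as)"

definition pow_prod :: "nat \<Rightarrow> (nat \<Rightarrow> 'a::real_normed_algebra) \<Rightarrow> (nat \<Rightarrow> real) \<Rightarrow> 'a" where
  "pow_prod n x p = lprod (map (\<lambda>i. cfc_pow (x i) (p i)) (filter (\<lambda>i. p i \<noteq> 0) [0..<n]))"

end

theory Submission
  imports Defs "HOL-Complex_Analysis.Complex_Analysis"
begin

text \<open>
  On the centralizer \<open>\<phi>\<close> is a trace. Put \<open>P = p\<^sub>1 + \<dots> + p\<^sub>n\<close> and, for small \<open>r\<close>,
  \<open>A\<^sub>r = \<Sum> (p\<^sub>i / P) x\<^sub>i\<^sup>r\<close>, \<open>B\<^sub>r = \<Sum> (p\<^sub>i / P) y\<^sub>i\<^sup>r\<close>. For \<open>r = 2\<^sup>-\<^sup>k\<close> operator monotonicity of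
  the square root gives \<open>A\<^sub>r \<le> B\<^sub>r\<close>, and since \<open>\<phi>\<close> is tracial this implies
  \<open>\<phi> (A\<^sub>r\<^sup>N) \<le> \<phi> (B\<^sub>r\<^sup>N)\<close>. As \<open>r \<rightarrow> 0\<close> and \<open>r N \<rightarrow> P\<close>, power means converge to geometric means:
  \<open>A\<^sub>r\<^sup>N\<close> tends in norm to \<open>x\<^sub>1\<^bsup>p\<^sub>1\<^esup> \<dots> x\<^sub>n\<^bsup>p\<^sub>n\<^esup>\<close>, and likewise for \<open>y\<close>.

  The functional calculus rests on the bound \<open>\<parallel>q(T)\<parallel> \<le> sup |q|\<close> over \<open>[-\<parallel>T\<parallel>, \<parallel>T\<parallel>]\<close> for self-adjoint
  multipliers \<open>T\<close>, obtained without spectral theory: \<open>T\<close> is the real part of a unitary, which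
  yields the bound up to a factor linear in the degree of \<open>q\<close>; applying it to \<open>q\<^sup>m\<close> and using
  \<open>\<parallel>S\<^sup>2\<parallel> = \<parallel>S\<parallel>\<^sup>2\<close> removes the factor. Multipliers, i.e. operators on the algebra, replace the unitization.
\<close>

subsection \<open>Polynomials in an operator\<close>

text \<open>Products and powers with exponent above 1 do not respect the operator order, and no
  \<open>x i\<close> is assumed to commute with any \<open>y j\<close>: exchanging one factor at a
  time leaves a product of non-commuting factors once there are three. Passing to power means leaves
  on each side a high power of a single element, and of the individual factors only roots are taken,
  where monotonicity survives. These roots are dyadic because only the square root is treated
  directly. The order that is propagated is not the operator order but the weaker relation
  \<open>zpos\<close>, positivity as \<phi> sees it through compressions by self-adjoint elements of
  the centralizer. It passes to square roots by an argument using only traciality, and it is what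
  the end point of the convexity argument asks for. Boundedness of \<phi> is derived, not assumed,
  and without a unit it is obtained only in the form of a bound for \<phi> on products of two
  elements. The final limit therefore works with exponents \<open>p i / 2\<close> and squares the
  resulting product.\<close>

definition pact :: "real poly \<Rightarrow> ('a::real_vector \<Rightarrow> 'a) \<Rightarrow> 'a \<Rightarrow> 'a" where
  "pact q T b = (\<Sum>i\<le>degree q. coeff q i *\<^sub>R (T ^^ i) b)"

lemma pact_atMost:
  assumes "degree q \<le> n"
  shows "pact q T b = (\<Sum>i\<le>n. coeff q i *\<^sub>R (T ^^ i) b)"
  unfolding pact_def
  by (rule sum.mono_neutral_left) (use assms in \<open>auto simp: coeff_eq_0\<close>)

lemma pact_0 [simp]: "pact 0 T b = 0"
  by (simp add: pact_def)

lemma pact_add: "pact (p + q) T b = pact p T b + pact q T b"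
proof -
  let ?n = "max (degree p) (degree q)"
  have "degree (p + q) \<le> ?n" by (rule degree_add_le_max)
  then show ?thesis
    by (simp add: pact_atMost[of _ ?n] scaleR_add_left sum.distrib)
qed

lemma pact_smult: "pact (smult c p) T b = c *\<^sub>R pact p T b"
  by (simp add: pact_atMost[OF degree_smult_le] pact_def[of p] scaleR_sum_right)

lemma pact_minus: "pact (- p) T b = - pact p T b"
  using pact_smult[of "-1" p T b] by simp

lemma pact_diff: "pact (p - q) T b = pact p T b - pact q T b"
  using pact_add[of p "- q" T b] by (simp add: pact_minus)

lemma linear_funpow:
  fixes T :: "'a::real_vector \<Rightarrow> 'a"
  shows "linear T \<Longrightarrow> linear (T ^^ n)"
proof (induction n)
  case 0
  then show ?case by (simp add: id_def module_hom_ident)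
next
  case (Suc n)
  then show ?case using linear_compose[of "T ^^ n" T] by (simp add: o_def)
qed

lemma linear_pact: "linear T \<Longrightarrow> linear (pact q T)"
  unfolding pact_def
  by (intro linear_compose_sum ballI linear_compose_scale_right linear_funpow)

lemma pact_pCons:
  assumes "linear T"
  shows "pact (pCons a q) T b = a *\<^sub>R b + T (pact q T b)"
proof -
  have "pact (pCons a q) T b = (\<Sum>i\<le>Suc (degree q). coeff (pCons a q) i *\<^sub>R (T ^^ i) b)"
    by (rule pact_atMost) (rule degree_pCons_le)
  also have "\<dots> = a *\<^sub>R b + (\<Sum>i\<le>degree q. coeff q i *\<^sub>R T ((T ^^ i) b))"
    by (simp add: sum.atMost_Suc_shift del: sum.atMost_Suc)
  also have "\<dots> = a *\<^sub>R b + T (pact q T b)"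
    using assms by (simp add: pact_def linear_sum linear_scale)
  finally show ?thesis .
qed

lemma pact_const [simp]: "pact [:a:] T b = a *\<^sub>R b"
  by (simp add: pact_def)

lemma pact_1 [simp]: "pact 1 T b = b"
  by (simp add: pact_def)

lemma pact_X [simp]: "linear T \<Longrightarrow> pact [:0, 1:] T b = T b"
  by (simp add: pact_pCons)

lemma pact_mult:
  assumes T: "linear T"
  shows "pact (p * q) T b = pact p T (pact q T b)"
  by (induction p) (simp_all add: pact_pCons[OF T] pact_add pact_smult)

lemma pact_power: "linear T \<Longrightarrow> pact (q ^ n) T b = (pact q T ^^ n) b"
  by (induction n) (simp_all add: pact_mult)

lemma pact_pcompose:
  assumes T: "linear T"
  shows "pact (pcompose p q) T b = pact p (pact q T) b"
  by (induction p)
    (simp_all add: pact_pCons[OF linear_pact[OF T]] pcompose_pCons pact_add pact_mult[OF T])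

lemma pact_intertwine:
  assumes "linear T" "linear S" "linear L" and "\<And>b. T (L b) = L (S b)"
  shows "pact q T (L b) = L (pact q S b)"
  by (induction q)
    (simp_all add: pact_pCons assms linear_0 linear_add linear_scale)

section \<open>Approximation and coefficient bounds for polynomials\<close>

lemma Weierstrass_poly_approx:
  fixes f :: "real \<Rightarrow> real"
  assumes "continuous_on {a..b} f" "e > 0"
  obtains q :: "real poly" where "\<And>t. t \<in> {a..b} \<Longrightarrow> \<bar>f t - poly q t\<bar> < e"
proof -
  obtain g where g: "real_polynomial_function g" "\<And>x. x \<in> {a..b} \<Longrightarrow> \<bar>f x - g x\<bar> < e"
    using Stone_Weierstrass_real_polynomial_function[OF compact_Icc assms] by blast
  then obtain c n where "g = (\<lambda>x. \<Sum>i\<le>n. c i * x^i)"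
    using real_polynomial_function_iff_sum by blast
  then have "g x = poly (\<Sum>i\<le>n. monom (c i) i) x" for x
    by (simp add: poly_sum poly_monom)
  with g that show ?thesis by metis
qed

text \<open>Cauchy's estimate on the unit circle: the n-th derivative at 0 is n! times the
  coefficient.\<close>

lemma coeff_norm_le_circle_bound:
  fixes P :: "complex poly"
  assumes "\<And>z. cmod z = 1 \<Longrightarrow> cmod (poly P z) \<le> M"
  shows "cmod (coeff P n) \<le> M"
proof -
  have hd: "(deriv ^^ n) (poly P) = poly ((pderiv ^^ n) P)" for n
  proof (induction n)
    case (Suc n)
    have "deriv (poly Q) = poly (pderiv Q)" for Q :: "complex poly"
      by (rule ext) (rule DERIV_imp_deriv, rule poly_DERIV)
    then show ?case using Suc by simp
  qed simp
  have "cmod ((deriv ^^ n) (poly P) 0) \<le> fact n * M / 1 ^ n"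
    by (rule Cauchy_inequality) (auto intro!: holomorphic_intros continuous_intros assms)
  moreover have "(deriv ^^ n) (poly P) 0 = fact n * coeff P n"
    by (simp add: hd poly_0_coeff_0 coeff_higher_pderiv pochhammer_fact)
  ultimately show ?thesis by (simp add: norm_mult)
qed

subsection \<open>Self-adjoint multipliers and spectral bounds\<close>

context cstar_algebra
begin

lemma scaleC_scaleR: "scaleC c (r *\<^sub>R x) = r *\<^sub>R scaleC c x"
  by (simp add: scaleC_of_real[symmetric] scaleC_scaleC mult.commute)

lemma scaleC_0_right [simp]: "scaleC c 0 = 0"
  using scaleC_add_right[of c 0 0] by simp

lemma scaleC_minus_right: "scaleC c (- x) = - scaleC c x"
  using scaleC_add_right[of c x "- x"] by (simp add: eq_neg_iff_add_eq_0 add.commute)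

lemma scaleC_diff_right: "scaleC c (x - y) = scaleC c x - scaleC c y"
  using scaleC_add_right[of c x "- y"] by (simp add: scaleC_minus_right)

lemma scaleC_minus_left: "scaleC (- c) x = - scaleC c x"
  using scaleC_scaleC[of c "-1" x] scaleC_of_real[of "-1" x]
  by (simp add: scaleC_minus_right)

lemma bounded_linear_scaleC: "bounded_linear (scaleC c)"
  by (rule bounded_linear_intro[where K = "cmod c"])
    (simp_all add: scaleC_add_right scaleC_scaleR norm_scaleC mult.commute)

lemma star_0 [simp]: "star 0 = 0"
  using star_add[of 0 0] by simp

lemma star_scaleR: "star (r *\<^sub>R x) = r *\<^sub>R star x"
  using star_scaleC[of "complex_of_real r" x] by (simp add: scaleC_of_real)

lemma star_minus: "star (- x) = - star x"
  using star_scaleR[of "-1" x] by simp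

lemma star_diff: "star (x - y) = star x - star y"
  using star_add[of x "- y"] by (simp add: star_minus)

lemma norm_star [simp]: "norm (star x) = norm x"
proof -
  have le: "norm x \<le> norm (star x)" for x
  proof (cases "norm x = 0")
    case False
    have "norm x * norm x \<le> norm (star x) * norm x"
      using cstar_identity[of x] norm_mult_ineq[of "star x" x] by (simp add: power2_eq_square)
    with False show ?thesis by (simp add: mult_le_cancel_right)
  qed simp
  from le[of x] le[of "star x"] show ?thesis by (simp add: star_star)
qed

lemma bounded_linear_star: "bounded_linear star"
  by (rule bounded_linear_intro[where K = 1]) (simp_all add: star_add star_scaleR)

text \<open>Testing on \<open>b = star z\<close> and using the C*-identity recovers the norm of an
  element from its left multiplication. Elements can thus be estimated as multipliers, which
  replaces testing on a unit.\<close>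

lemma norm_le_of_mult_bound:
  fixes z :: 'a
  assumes "\<And>b. norm (z * b) \<le> K * norm b" "0 \<le> K"
  shows "norm z \<le> K"
proof (cases "z = 0")
  case False
  have "norm z * norm z = norm (star (star z) * star z)"
    by (simp only: cstar_identity norm_star power2_eq_square)
  also have "\<dots> \<le> K * norm z"
    using assms(1)[of "star z"] by (simp add: star_star)
  finally show ?thesis using False by simp
qed (use assms in auto)

text \<open>Self-adjoint multipliers: operators on the algebra that are symmetric for the algebra-valued
  inner product \<open>b\<^sup>* c\<close>. They include \<open>c + x\<close> for real \<open>c\<close> and self-adjoint \<open>x\<close> even if there is no unit.\<close>

definition sa :: "('a \<Rightarrow> 'a) \<Rightarrow> bool" where
  "sa T \<longleftrightarrow> bounded_linear T \<and> (\<forall>b c. star (T b) * c = star b * T c) \<and>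
     (\<forall>z b. T (scaleC z b) = scaleC z (T b))"

lemma saD:
  assumes "sa T"
  shows "bounded_linear T" "linear T" "star (T b) * c = star b * T c" "T (scaleC z b) = scaleC z (T b)"
  using assms by (auto simp: sa_def bounded_linear.linear)

text \<open>Move one \<open>T\<close> across the algebra-valued inner product. Iterated, this
  controls \<open>T b\<close> by high powers of \<open>T\<close> at the same vector, with no mention
  of operator norms.\<close>

lemma sa_norm_sq:
  assumes "sa T"
  shows "(norm (T b))\<^sup>2 \<le> norm b * norm (T (T b))"
proof -
  have "(norm (T b))\<^sup>2 = norm (star b * T (T b))"
    using cstar_identity[of "T b"] saD(3)[OF assms, of b "T b"] by simp
  also have "\<dots> \<le> norm b * norm (T (T b))"
    using norm_mult_ineq[of "star b" "T (T b)"] by simp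
  finally show ?thesis .
qed

lemma sa_compose:
  assumes "sa S" "sa T" "\<And>b. S (T b) = T (S b)"
  shows "sa (\<lambda>b. S (T b))"
  unfolding sa_def
  using bounded_linear_compose[OF saD(1)[OF assms(1)] saD(1)[OF assms(2)]] assms
  by (auto simp: saD)

lemma sa_funpow: "sa T \<Longrightarrow> sa (T ^^ n)"
proof (induction n)
  case 0
  then show ?case by (simp add: sa_def id_def bounded_linear_ident)
next
  case (Suc n)
  then show ?case using sa_compose[of T "T ^^ n"] by (simp add: o_def funpow_swap1)
qed

lemma sa_add: "sa S \<Longrightarrow> sa T \<Longrightarrow> sa (\<lambda>b. S b + T b)"
  by (auto simp: sa_def bounded_linear_add star_add scaleC_add_right algebra_simps)

lemma sa_scaleR: "sa S \<Longrightarrow> sa (\<lambda>b. r *\<^sub>R S b)"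
  by (auto simp: sa_def bounded_linear_const_scaleR star_scaleR scaleC_scaleR algebra_simps)

lemma sa_zero: "sa (\<lambda>b. 0)"
  by (auto simp: sa_def bounded_linear_zero)

lemma sa_sum: "(\<And>i. i \<in> I \<Longrightarrow> sa (S i)) \<Longrightarrow> sa (\<lambda>b. \<Sum>i\<in>I. S i b)"
  by (induction I rule: infinite_finite_induct) (auto intro!: sa_zero sa_add)

lemma sa_pact:
  assumes "sa T"
  shows "sa (pact q T)"
  unfolding pact_def[abs_def] by (intro sa_sum sa_scaleR sa_funpow assms)

lemma sa_mult: "star x = x \<Longrightarrow> sa ((*) x)"
  by (auto simp: sa_def bounded_linear_mult_right star_mult mult.assoc mult_scaleC_right)

text \<open>For self-adjoint \<open>T\<close> this expresses that the spectrum of \<open>T\<close> lies in \<open>[\<alpha>, \<beta>]\<close>.\<close>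

definition spec_in :: "('a \<Rightarrow> 'a) \<Rightarrow> real \<Rightarrow> real \<Rightarrow> bool" where
  "spec_in T \<alpha> \<beta> \<longleftrightarrow> (\<forall>q M b. 0 \<le> M \<longrightarrow> (\<forall>t\<in>{\<alpha>..\<beta>}. \<bar>poly q t\<bar> \<le> M) \<longrightarrow>
     norm (pact q T b) \<le> M * norm b)"

lemma spec_inD:
  "spec_in T \<alpha> \<beta> \<Longrightarrow> 0 \<le> M \<Longrightarrow> (\<And>t. \<alpha> \<le> t \<Longrightarrow> t \<le> \<beta> \<Longrightarrow> \<bar>poly q t\<bar> \<le> M) \<Longrightarrow>
     norm (pact q T b) \<le> M * norm b"
  by (auto simp: spec_in_def)

lemma spec_in_mono: "spec_in T \<alpha> \<beta> \<Longrightarrow> \<gamma> \<le> \<alpha> \<Longrightarrow> \<beta> \<le> \<delta> \<Longrightarrow> spec_in T \<gamma> \<delta>"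
  unfolding spec_in_def by (meson atLeastatMost_subset_iff subsetD)

text \<open>Spectral mapping, one inclusion: \<open>q (p (T))\<close> is the composed polynomial
  evaluated at \<open>T\<close>.\<close>

lemma spec_in_pact:
  assumes "spec_in T \<alpha> \<beta>" "linear T"
    and "\<And>t. \<alpha> \<le> t \<Longrightarrow> t \<le> \<beta> \<Longrightarrow> poly p t \<in> {\<gamma>..\<delta>}"
  shows "spec_in (pact p T) \<gamma> \<delta>"
  unfolding spec_in_def
proof (intro allI impI)
  fix q M b
  assume "0 \<le> M" "\<forall>t\<in>{\<gamma>..\<delta>}. \<bar>poly q t\<bar> \<le> M"
  then have "norm (pact (pcompose q p) T b) \<le> M * norm b"
    by (intro spec_inD[OF assms(1)]) (use assms(3) in \<open>auto simp: poly_pcompose\<close>)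
  then show "norm (pact q (pact p T) b) \<le> M * norm b"
    by (simp add: pact_pcompose[OF assms(2)])
qed

end

text \<open>A factor growing linearly in the exponent disappears under high roots: if
  \<open>y < x\<close>, then \<open>n * (y / x) ^ n\<close> tends to 0, contradicting the bound
  along \<open>n = 2 ^ m\<close>.\<close>

lemma le_of_power_le_linear_growth:
  fixes x y :: real
  assumes "0 \<le> x" "0 \<le> y"
    and le: "\<And>m. x ^ (2 ^ m) \<le> C * (d * 2 ^ m + 1) * y ^ (2 ^ m)"
  shows "x \<le> y"
proof (rule ccontr)
  assume "\<not> x \<le> y"
  then have "y < x" "0 < x" using assms by auto
  define \<rho> where "\<rho> = y / x"
  have \<rho>: "norm \<rho> < 1" using \<open>y < x\<close> \<open>0 < x\<close> \<open>0 \<le> y\<close> by (simp add: \<rho>_def)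
  have "(\<lambda>n. C * (d * (real n * \<rho> ^ n) + \<rho> ^ n)) \<longlonglongrightarrow> C * (d * 0 + 0)"
    by (intro tendsto_intros powser_times_n_limit_0[OF \<rho>] LIMSEQ_power_zero[OF \<rho>])
  moreover have "strict_mono (\<lambda>m. 2 ^ m :: nat)"
    by (rule strict_monoI) simp
  ultimately have "((\<lambda>n. C * (d * (real n * \<rho> ^ n) + \<rho> ^ n)) \<circ> (\<lambda>m. 2 ^ m)) \<longlonglongrightarrow> C * (d * 0 + 0)"
    by (rule LIMSEQ_subseq_LIMSEQ)
  moreover have "1 \<le> ((\<lambda>n. C * (d * (real n * \<rho> ^ n) + \<rho> ^ n)) \<circ> (\<lambda>m. 2 ^ m)) m" for m
    using le[of m] \<open>0 < x\<close> by (simp add: \<rho>_def power_divide field_simps)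
  ultimately have "1 \<le> C * (d * 0 + 0)"
    by (intro LIMSEQ_le_const) auto
  then show False by simp
qed

context cstar_algebra
begin

text \<open>The degree of a power of \<open>q\<close> grows only linearly in the exponent, so the
  loss is harmless. Interval and constant are left general because the lemma serves twice: to
  sharpen the bound from the unitary dilation, and in \<open>spec_in_Int\<close> to remove a mere
  constant.\<close>

lemma power_trick:
  assumes T: "sa T"
    and bound: "\<And>q M b. 0 \<le> M \<Longrightarrow> \<forall>t\<in>{\<alpha>..\<beta>}. \<bar>poly q t\<bar> \<le> M \<Longrightarrow>
      norm (pact q T b) \<le> C * (real (degree q) + 1) * M * norm b"
    and "0 \<le> C"
  shows "spec_in T \<alpha> \<beta>"
  unfolding spec_in_def
proof (intro allI impI)
  fix q M b
  assume M: "0 \<le> M" "\<forall>t\<in>{\<alpha>..\<beta>}. \<bar>poly q t\<bar> \<le> M"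
  define S where "S = pact q T"
  have S: "sa S" unfolding S_def by (rule sa_pact[OF T])
  \<comment> \<open>The exponent \<open>2 ^ m - 1\<close> counts the copies of \<open>norm b\<close>
    left behind by repeated use of \<open>sa_norm_sq\<close>.\<close>
  have *: "norm (S b) ^ (2 ^ m) \<le> norm b ^ (2 ^ m - 1) * norm ((S ^^ (2 ^ m)) b)" for m
  proof (induction m)
    case (Suc m)
    let ?n = "2 ^ m :: nat"
    have n: "?n \<ge> 1" by simp
    have "norm (S b) ^ (2 ^ Suc m) = (norm (S b) ^ ?n)\<^sup>2"
      by (simp add: power_mult[symmetric] mult.commute)
    also have "\<dots> \<le> (norm b ^ (?n - 1) * norm ((S ^^ ?n) b))\<^sup>2"
      by (intro power_mono Suc) simp
    also have "\<dots> = (norm b ^ (?n - 1))\<^sup>2 * (norm ((S ^^ ?n) b))\<^sup>2"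
      by (simp add: power_mult_distrib)
    also have "\<dots> \<le> (norm b ^ (?n - 1))\<^sup>2 * (norm b * norm ((S ^^ ?n) ((S ^^ ?n) b)))"
      by (intro mult_left_mono sa_norm_sq sa_funpow S) simp
    also have "\<dots> = norm b ^ (2 ^ Suc m - 1) * norm ((S ^^ (2 ^ Suc m)) b)"
    proof -
      have "(S ^^ (2 ^ Suc m)) b = (S ^^ ?n) ((S ^^ ?n) b)"
        by (simp add: funpow_add[unfolded o_def, THEN fun_cong, symmetric] mult_2)
      moreover have "2 ^ Suc m - 1 = Suc ((?n - 1) * 2)" using n by (cases ?n) simp_all
      ultimately show ?thesis by (simp add: power_mult)
    qed
    finally show ?case .
  qed simp
  show "norm (pact q T b) \<le> M * norm b"
  proof (rule le_of_power_le_linear_growth[where C = C and d = "degree q"])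
    fix m
    let ?n = "2 ^ m :: nat"
    have "norm ((S ^^ ?n) b) = norm (pact (q ^ ?n) T b)"
      using pact_power[OF saD(2)[OF T], of q ?n b] by (simp add: S_def)
    also have "\<dots> \<le> C * (real (degree (q ^ ?n)) + 1) * M ^ ?n * norm b"
      by (rule bound) (use M in \<open>auto simp: power_abs power_mono\<close>)
    also have "\<dots> \<le> C * (real (degree q * ?n) + 1) * M ^ ?n * norm b"
      using degree_power_le[of q ?n] \<open>0 \<le> C\<close> M
      by (intro mult_right_mono mult_left_mono add_right_mono) (simp_all only: of_nat_le_iff, auto)
    finally have "norm b ^ (?n - 1) * norm ((S ^^ ?n) b) \<le>
        norm b ^ (?n - 1) * (C * (real (degree q * ?n) + 1) * M ^ ?n * norm b)"
      by (rule mult_left_mono) simp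
    also have "\<dots> = C * (real (degree q * ?n) + 1) * (M ^ ?n * (norm b ^ (?n - 1) * norm b))"
      by (simp add: ac_simps)
    also have "norm b ^ (?n - 1) * norm b = norm b ^ ?n"
      by (rule power_minus_mult) simp
    finally show "norm (pact q T b) ^ 2 ^ m \<le> C * (real (degree q) * 2 ^ m + 1) * (M * norm b) ^ 2 ^ m"
      using *[of m] by (simp add: S_def power_mult_distrib)
  qed (use M in auto)
qed

end

section \<open>Unitary dilation and the bound for polynomials in a self-adjoint multiplier\<close>

lemma map_poly_of_real_add:
  "map_poly (of_real :: real \<Rightarrow> complex) (p + q) = map_poly of_real p + map_poly of_real q"
  by (rule poly_eqI) (simp add: coeff_map_poly)

lemma map_poly_of_real_mult:
  "map_poly (of_real :: real \<Rightarrow> complex) (p * q) = map_poly of_real p * map_poly of_real q"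
  by (rule poly_eqI) (simp add: coeff_map_poly coeff_mult)

lemma map_poly_of_real_power:
  "map_poly (of_real :: real \<Rightarrow> complex) (p ^ n) = map_poly of_real p ^ n"
  by (induction n) (simp_all add: map_poly_of_real_mult)

context cstar_algebra
begin

text \<open>The solution is \<open>1 - sqrt (1 - T^2)\<close>, wanted before any functional calculus
  exists. It is the fixed point of \<open>f \<mapsto> (T^2 + f^2) / 2\<close>, which on the ball of
  radius \<open>\<rho> < 1\<close> is a contraction with constant \<rho>.\<close>

lemma sa_fixpoint:
  assumes T: "sa T" and le: "\<And>b. norm (T b) \<le> \<rho> * norm b" and \<rho>: "0 \<le> \<rho>" "\<rho> < 1"
  obtains r where "sa r" "\<And>b. 2 *\<^sub>R r b = T (T b) + r (r b)" "\<And>b. T (r b) = r (T b)"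
proof -
  define T' where "T' = Blinfun T"
  have T': "blinfun_apply T' = T"
    unfolding T'_def by (rule bounded_linear_Blinfun_apply[OF saD(1)[OF T]])
  \<comment> \<open>These conditions are closed and preserved by \<open>F\<close>, so the fixed
    point inherits symmetry and commutation with \<open>T\<close>. The radius is kept because
    \<open>(\<rho>^2 + \<rho>^2) / 2 \<le> \<rho>\<close>.\<close>
  define X where "X = {f :: 'a \<Rightarrow>\<^sub>L 'a. norm f \<le> \<rho> \<and> sa (blinfun_apply f) \<and> (\<forall>b. T (f b) = f (T b))}"
  define F where "F f = (1/2::real) *\<^sub>R ((T' o\<^sub>L T') + (f o\<^sub>L f))" for f :: "'a \<Rightarrow>\<^sub>L 'a"
  have cont: "continuous_on UNIV (\<lambda>f :: 'a \<Rightarrow>\<^sub>L 'a. L (f b))" if "bounded_linear L" for b and L :: "'a \<Rightarrow> 'a"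
    by (intro linear_continuous_on bounded_linear_compose[OF that blinfun.bounded_linear_left])
  have c0: "continuous_on UNIV (\<lambda>f :: 'a \<Rightarrow>\<^sub>L 'a. f b)" for b :: 'a
    using cont[OF bounded_linear_ident] .
  have "closed X"
    unfolding X_def sa_def
    by (intro closed_Collect_conj closed_Collect_all closed_Collect_le closed_Collect_eq
          continuous_intros cont bounded_linear_star c0 saD(1)[OF T] bounded_linear_scaleC)
      (auto simp: blinfun.bounded_linear_right)
  then have "complete X" by (simp add: complete_eq_closed)
  moreover have "X \<noteq> {}"
  proof -
    have "(0 :: 'a \<Rightarrow>\<^sub>L 'a) \<in> X"
      using \<rho> sa_zero linear_0[OF saD(2)[OF T]] by (simp add: X_def zero_blinfun.rep_eq)
    then show ?thesis by blast
  qed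
  moreover have "F ` X \<subseteq> X"
  proof (rule image_subsetI)
    fix f assume f: "f \<in> X"
    then have nf: "norm f \<le> \<rho>" and saf: "sa f" and comm: "\<And>b. T (f b) = f (T b)"
      by (auto simp: X_def)
    have Ff: "F f b = (1/2) *\<^sub>R (T (T b) + f (f b))" for b
      by (simp add: F_def T' blinfun.scaleR_left blinfun.add_left)
    have "norm T' \<le> \<rho>"
      by (rule norm_blinfun_bound) (use \<rho> le T' in auto)
    then have "norm (T' o\<^sub>L T') \<le> \<rho> * \<rho>"
      by (intro order_trans[OF norm_blinfun_compose] mult_mono) (use \<rho> in auto)
    moreover have "norm (f o\<^sub>L f) \<le> \<rho> * \<rho>"
      by (intro order_trans[OF norm_blinfun_compose] mult_mono) (use \<rho> nf in auto)
    ultimately have "norm (F f) \<le> (1/2) * (\<rho> * \<rho> + \<rho> * \<rho>)"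
      using norm_triangle_ineq[of "T' o\<^sub>L T'" "f o\<^sub>L f"] by (simp add: F_def)
    also have "\<dots> \<le> \<rho>" using \<rho> by (simp add: mult_left_le)
    finally have "norm (F f) \<le> \<rho>" .
    moreover have "sa (F f)"
      unfolding Ff[abs_def]
      by (rule sa_scaleR[OF sa_add[OF sa_compose[OF T T refl] sa_compose[OF saf saf refl]]])
    moreover have "T (F f b) = F f (T b)" for b
      using saD(2)[OF T] by (simp add: Ff linear_add linear_scale comm)
    ultimately show "F f \<in> X" by (simp add: X_def)
  qed
  moreover have "\<forall>f\<in>X. \<forall>g\<in>X. dist (F f) (F g) \<le> \<rho> * dist f g"
  proof (intro ballI)
    fix f g assume "f \<in> X" "g \<in> X"
    then have fg: "norm f \<le> \<rho>" "norm g \<le> \<rho>" by (auto simp: X_def)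
    have "F f - F g = (1/2::real) *\<^sub>R ((f o\<^sub>L (f - g)) + ((f - g) o\<^sub>L g))"
      by (rule blinfun_eqI)
        (simp add: F_def blinfun.scaleR_left blinfun.add_left blinfun.diff_left blinfun.diff_right algebra_simps)
    also have "norm \<dots> \<le> (1/2) * (\<rho> * norm (f - g) + norm (f - g) * \<rho>)"
    proof -
      have "norm (f o\<^sub>L (f - g)) \<le> \<rho> * norm (f - g)"
        by (intro order_trans[OF norm_blinfun_compose] mult_mono) (use \<rho> fg in auto)
      moreover have "norm ((f - g) o\<^sub>L g) \<le> norm (f - g) * \<rho>"
        by (intro order_trans[OF norm_blinfun_compose] mult_mono) (use \<rho> fg in auto)
      ultimately show ?thesis
        using norm_triangle_ineq[of "f o\<^sub>L (f - g)" "(f - g) o\<^sub>L g"] by (simp add: mult.commute)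
    qed
    finally show "dist (F f) (F g) \<le> \<rho> * dist f g" by (simp add: dist_norm mult.commute)
  qed
  ultimately have "\<exists>!f. f \<in> X \<and> F f = f"
    using \<rho> by (intro Banach_fix) auto
  then obtain f where f: "f \<in> X" "F f = f" by blast
  have "2 *\<^sub>R f b = T (T b) + f (f b)" for b
  proof -
    have "2 *\<^sub>R f b = 2 *\<^sub>R F f b" by (simp add: f)
    then show ?thesis by (simp add: F_def T' blinfun.scaleR_left blinfun.add_left)
  qed
  with f that[of "blinfun_apply f"] show ?thesis by (auto simp: X_def)
qed

text \<open>With \<open>r\<close> as above, \<open>(1 - r)\<^sup>2 = 1 - T\<^sup>2\<close>, so \<open>T\<close> is the real part \<open>cos \<theta>\<close> of the
  unitary \<open>U = T + i(1 - r)\<close>.\<close>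

lemma sa_unitary_dilation:
  assumes T: "sa T" and le: "\<And>b. norm (T b) \<le> \<rho> * norm b" and \<rho>: "0 \<le> \<rho>" "\<rho> < 1"
  obtains U where "linear U" "\<And>b. norm (U b) = norm b" "\<And>b. b + U (U b) = 2 *\<^sub>R U (T b)"
    "\<And>b. U (T b) = T (U b)"
proof -
  obtain r where r: "sa r" "\<And>b. 2 *\<^sub>R r b = T (T b) + r (r b)" "\<And>b. T (r b) = r (T b)"
    using sa_fixpoint[OF assms] by blast
  define W where "W b = b - r b" for b
  define U where "U b = T b + scaleC \<i> (W b)" for b
  \<comment> \<open>\<open>V\<close> is both the adjoint and the inverse of \<open>U\<close>, which
    makes \<open>U\<close> isometric.\<close>
  define V where "V b = T b - scaleC \<i> (W b)" for b
  note lr = linear_add[OF saD(2)[OF r(1)]] linear_diff[OF saD(2)[OF r(1)]] linear_scale[OF saD(2)[OF r(1)]]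
  note lT = linear_add[OF saD(2)[OF T]] linear_diff[OF saD(2)[OF T]] linear_scale[OF saD(2)[OF T]]
  have WW: "W (W b) = b - T (T b)" for b
    using r(2)[of b] by (simp add: W_def lr scaleR_2 algebra_simps)
  have TW: "T (W b) = W (T b)" for b by (simp add: W_def lT r(3))
  have Ws: "W (scaleC c b) = scaleC c (W b)" for c b
    by (simp add: W_def saD(4)[OF r(1)] scaleC_diff_right)
  have Wadd: "W (b + c) = W b + W c" "W (b - c) = W b - W c" for b c by (simp_all add: W_def lr)
  have linU: "linear U"
  proof (rule linearI)
    show "U (b + c) = U b + U c" for b c
      by (simp add: U_def lT Wadd scaleC_add_right)
    show "U (k *\<^sub>R b) = k *\<^sub>R U b" for k b
      by (simp add: U_def W_def lT lr scaleC_diff_right scaleC_scaleR algebra_simps)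
  qed
  have ii: "scaleC \<i> (scaleC \<i> b) = - b" for b
    by (simp add: scaleC_scaleC scaleC_minus_left scaleC_one)
  have UV: "U (V b) = b" "V (U b) = b" for b
    by (simp_all add: U_def V_def lT Wadd Ws TW saD(4)[OF T] scaleC_add_right scaleC_diff_right ii WW)
  have UT: "U (T b) = T (U b)" for b
    by (simp add: U_def lT TW saD(4)[OF T])
  have "star (U b) * c = star b * V c" for b c
  proof -
    have "star (W b) * c = star b * W c"
      by (simp add: W_def star_diff left_diff_distrib right_diff_distrib saD(3)[OF r(1)])
    then show ?thesis
      by (simp add: U_def V_def star_add star_scaleC distrib_right left_diff_distrib right_diff_distrib saD(3)[OF T]
          mult_scaleC_left mult_scaleC_right scaleC_minus_left)
  qed
  then have "norm (star (U b) * U b) = norm (star b * b)" for b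
    by (simp add: UV)
  then have nU: "norm (U b) = norm b" for b
    by (simp add: cstar_identity)
  \<comment> \<open>Applying \<open>U\<close> to \<open>V + U = 2 T\<close> states that
    \<open>T\<close> is the real part of \<open>U\<close> without an inverse, so that polynomials in
    \<open>U\<close> suffice later.\<close>
  have "b + U (U b) = 2 *\<^sub>R U (T b)" for b
  proof -
    have "V b + U b = 2 *\<^sub>R T b" by (simp add: U_def V_def scaleR_2)
    then have "U (V b + U b) = U (2 *\<^sub>R T b)" by simp
    then show ?thesis using linU by (simp add: linear_add linear_scale UV)
  qed
  with linU nU UT that show ?thesis by blast
qed

text \<open>The coefficients of the polynomial \<open>P\<close> with \<open>P (exp (i \<theta>)) = exp (i d \<theta>) q (cos \<theta>)\<close>
  are bounded by \<open>sup |q|\<close>, and \<open>P(U) = U\<^sup>d q(T)\<close>.\<close>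

lemma pact_crude_bound:
  assumes T: "sa T" and le: "\<And>b. norm (T b) \<le> \<rho> * norm b" and \<rho>: "0 \<le> \<rho>" "\<rho> < 1"
    and M: "\<forall>t\<in>{-1..1}. \<bar>poly q t\<bar> \<le> M" "0 \<le> M"
  shows "norm (pact q T b) \<le> 2 * (real (degree q) + 1) * M * norm b"
proof -
  obtain U where U: "linear U" "\<And>b. norm (U b) = norm b" "\<And>b. b + U (U b) = 2 *\<^sub>R U (T b)"
    "\<And>b. U (T b) = T (U b)"
    using sa_unitary_dilation[OF T le \<rho>] by blast
  define d where "d = degree q"
  \<comment> \<open>Insert \<open>cos \<theta> = (z + 1 / z) / 2\<close> into \<open>q\<close> and
    clear denominators with \<open>z ^ d\<close>. The degree is at most \<open>2 * d\<close>, so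
    \<open>2 * d + 1\<close> coefficients enter the final estimate.\<close>
  define P where "P = (\<Sum>i\<le>d. smult (coeff q i / 2 ^ i) (monom 1 (d - i) * [:1, 0, 1:] ^ i))"
  have nUk: "norm ((U ^^ k) b) = norm b" for k b
    by (induction k) (simp_all add: U(2))
  have X2: "(pact [:1, 0, 1:] U ^^ i) b = 2 ^ i *\<^sub>R (U ^^ i) ((T ^^ i) b)" for i b
  proof (induction i)
    case (Suc i)
    have T1: "(U ^^ i) (T c) = T ((U ^^ i) c)" for c
      by (induction i) (simp_all add: U(4))
    have "pact [:1, 0, 1:] U c = 2 *\<^sub>R U (T c)" for c
      by (simp add: pact_pCons[OF U(1)] U(3) linear_0[OF U(1)])
    then show ?case using Suc
      by (simp add: linear_scale[OF U(1)] linear_scale[OF saD(2)[OF T]] T1)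
  qed simp
  have mono: "pact (monom 1 k) U b = (U ^^ k) b" for k b
    by (induction k) (simp_all add: monom_0 monom_Suc pact_pCons[OF U(1)] linear_0[OF U(1)])
  have sum_pact: "pact (sum f I) U b = (\<Sum>i\<in>I. pact (f i) U b)" for f :: "nat \<Rightarrow> real poly" and I
    by (induction I rule: infinite_finite_induct) (simp_all add: pact_add)
  have "pact P U b = (\<Sum>i\<le>d. coeff q i *\<^sub>R (U ^^ d) ((T ^^ i) b))"
    unfolding P_def sum_pact
  proof (rule sum.cong)
    fix i assume "i \<in> {..d}"
    then have "(U ^^ (d - i)) ((U ^^ i) c) = (U ^^ d) c" for c
      by (simp add: funpow_add[unfolded o_def, THEN fun_cong, symmetric])
    then show "pact (smult (coeff q i / 2 ^ i) (monom 1 (d - i) * [:1, 0, 1:] ^ i)) U b =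
        coeff q i *\<^sub>R (U ^^ d) ((T ^^ i) b)"
      by (simp add: pact_smult pact_mult[OF U(1)] mono pact_power[OF U(1)] X2
          linear_scale[OF linear_funpow[OF U(1)]])
  qed simp
  also have "\<dots> = (U ^^ d) (pact q T b)"
    by (simp add: pact_def d_def linear_sum[OF linear_funpow[OF U(1)]] linear_scale[OF linear_funpow[OF U(1)]])
  finally have PU: "norm (pact q T b) = norm (pact P U b)" by (simp add: nUk)
  have degP: "degree P \<le> 2 * d"
    unfolding P_def
  proof (rule degree_sum_le)
    fix i assume "i \<in> {..d}"
    have "degree ([:1, 0, 1:] ^ i :: real poly) \<le> 2 * i"
      using degree_power_le[of "[:1, 0, 1:] :: real poly" i] by simp
    then have "degree (monom 1 (d - i) * [:1, 0, 1:] ^ i :: real poly) \<le> (d - i) + 2 * i"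
      using degree_mult_le[of "monom 1 (d - i)" "[:1, 0, 1:] ^ i :: real poly"] degree_monom_le[of "1::real" "d - i"]
      by linarith
    also have "\<dots> \<le> 2 * d" using \<open>i \<in> {..d}\<close> by simp
    finally show "degree (smult (coeff q i / 2 ^ i) (monom 1 (d - i) * [:1, 0, 1:] ^ i)) \<le> 2 * d"
      using degree_smult_le order_trans by blast
  qed simp
  have coeffP: "\<bar>coeff P j\<bar> \<le> M" for j
  proof -
    define Q where "Q = map_poly complex_of_real P"
    have "cmod (poly Q z) \<le> M" if "cmod z = 1" for z
    proof -
      have z: "z * cnj z = 1" using complex_norm_square[of z] that by simp
      have Re: "complex_of_real (Re z) = (z + cnj z) / 2"
        by (simp add: complex_add_cnj)
      have ev: "poly (map_poly complex_of_real (sum f I)) z = (\<Sum>i\<in>I. poly (map_poly complex_of_real (f i)) z)"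
        for f :: "nat \<Rightarrow> real poly" and I
        by (induction I rule: infinite_finite_induct) (simp_all add: map_poly_of_real_add)
      have "poly Q z = (\<Sum>i\<le>d. of_real (coeff q i / 2 ^ i) * (z ^ (d - i) * (1 + z * z) ^ i))"
        unfolding Q_def P_def ev
        by (intro sum.cong) (simp_all add: map_poly_smult map_poly_of_real_mult map_poly_of_real_power map_poly_monom poly_monom map_poly_pCons)
      also have "\<dots> = z ^ d * of_real (poly q (Re z))"
      proof -
        have "1 + z * z = z * (2 * of_real (Re z))"
          using z by (simp add: Re algebra_simps)
        then have "of_real (coeff q i / 2 ^ i) * (z ^ (d - i) * (1 + z * z) ^ i) =
            z ^ d * of_real (coeff q i * Re z ^ i)" if "i \<le> d" for i
          using power_add[of z "d - i" i] that by (simp add: power_mult_distrib)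
        then show ?thesis
          by (simp add: poly_altdef d_def[symmetric] sum_distrib_left)
      qed
      finally have "cmod (poly Q z) = \<bar>poly q (Re z)\<bar>"
        using that by (simp add: norm_mult norm_power)
      also have "\<dots> \<le> M"
        using M(1) abs_Re_le_cmod[of z] that by (auto simp: abs_le_iff)
      finally show ?thesis .
    qed
    then have "cmod (coeff Q j) \<le> M" by (rule coeff_norm_le_circle_bound)
    then show ?thesis by (simp add: Q_def coeff_map_poly)
  qed
  have "norm (pact P U b) \<le> (\<Sum>i\<le>2 * d. \<bar>coeff P i\<bar> * norm b)"
    unfolding pact_atMost[OF degP] by (rule sum_norm_le) (simp add: nUk)
  also have "\<dots> \<le> (\<Sum>i\<le>2 * d. M * norm b)"
    by (intro sum_mono mult_right_mono coeffP) simp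
  also have "\<dots> = (2 * real d + 1) * (M * norm b)" by simp
  also have "\<dots> \<le> 2 * (real d + 1) * (M * norm b)"
    using M by (intro mult_right_mono) auto
  finally show ?thesis by (simp add: PU d_def ac_simps)
qed

text \<open>The dilation needs a bound strictly below 1, so the estimate is proved for
  \<open>s T\<close> with \<open>s < 1\<close> after rescaling by \<open>R\<close>; for a fixed
  polynomial, \<open>s\<close> then tends to 1 from the left.\<close>

lemma sa_spec_in_symmetric:
  assumes T: "sa T" and le: "\<And>b. norm (T b) \<le> R * norm b" and R: "0 \<le> R"
  shows "spec_in T (- R) R"
proof (cases "R = 0")
  case True
  then have T0: "T = (\<lambda>b. 0)" using le by auto
  have "pact q T b = poly q 0 *\<^sub>R b" for q b
    by (cases q) (simp add: pact_pCons[OF saD(2)[OF T]], simp add: T0)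
  then show ?thesis using True by (auto simp: spec_in_def mult_right_mono)
next
  case False
  with R have R: "R > 0" by simp
  have scaled: "spec_in (\<lambda>b. s *\<^sub>R T b) (- R) R" if s: "0 \<le> s" "s < 1" for s
  proof -
    define S where "S b = (s / R) *\<^sub>R T b" for b
    have S: "sa S" unfolding S_def[abs_def] by (rule sa_scaleR[OF T])
    have "norm (S b) \<le> s * norm b" for b
      using mult_left_mono[OF le[of b], of "s / R"] s R by (simp add: S_def)
    then have "spec_in S (-1) 1"
      by (intro power_trick[OF S, where C = 2] pact_crude_bound[OF S _ s]) auto
    then have "spec_in (pact [:0, R:] S) (- R) R"
    proof (rule spec_in_pact)
      show "poly [:0, R:] t \<in> {- R..R}" if "- 1 \<le> t" "t \<le> 1" for t
        using mult_right_mono[OF that(1), of R] mult_right_mono[OF that(2), of R] R by simp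
    qed (rule saD(2)[OF S])
    moreover have "pact [:0, R:] S = (\<lambda>b. s *\<^sub>R T b)"
      by (rule ext) (use R S in \<open>simp add: pact_pCons saD(2) linear_scale linear_0, simp add: S_def\<close>)
    ultimately show ?thesis by simp
  qed
  show ?thesis
    unfolding spec_in_def
  proof (intro allI impI)
    fix q M b assume M: "0 \<le> M" "\<forall>t\<in>{- R..R}. \<bar>poly q t\<bar> \<le> M"
    have pow: "((\<lambda>b. s *\<^sub>R T b) ^^ i) b = s ^ i *\<^sub>R (T ^^ i) b" for s i
      by (induction i) (simp_all add: linear_scale[OF saD(2)[OF T]])
    have "((\<lambda>s. norm (pact q (\<lambda>b. s *\<^sub>R T b) b)) \<longlongrightarrow> norm (\<Sum>i\<le>degree q. coeff q i *\<^sub>R (1 ^ i *\<^sub>R (T ^^ i) b))) (at_left 1)"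
      unfolding pact_def pow by (intro tendsto_intros)
    moreover have "eventually (\<lambda>s::real. norm (pact q (\<lambda>b. s *\<^sub>R T b) b) \<le> M * norm b) (at_left 1)"
      using eventually_at_left_real[of 0 "1::real", OF zero_less_one]
    proof eventually_elim
      case (elim s)
      then show ?case using scaled[of s] M by (auto simp: spec_in_def)
    qed
    ultimately show "norm (pact q T b) \<le> M * norm b"
      by (simp add: pact_def tendsto_upperbound)
  qed
qed

text \<open>A partition of unity: the ramp \<open>e\<close> is 1 left of \<gamma> and 0 right of
  \<beta>, so \<open>q * e\<close> is bounded by \<open>M\<close> on the right interval and
  \<open>q * (1 - e)\<close> on the left one. Adding the two estimates, with \<open>e\<close>
  replaced by a polynomial, costs a factor 2 that \<open>power_trick\<close> removes. The strict
  inequality \<open>\<gamma> < \<beta>\<close> gives the ramp room to be continuous.\<close>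

lemma spec_in_Int:
  assumes T: "sa T" and sp: "spec_in T \<alpha> \<beta>" "spec_in T \<gamma> \<delta>"
    and le: "\<alpha> \<le> \<gamma>" "\<gamma> < \<beta>" "\<beta> \<le> \<delta>"
  shows "spec_in T \<gamma> \<beta>"
proof (rule power_trick[OF T, where C = 2])
  fix q M b
  assume M: "0 \<le> M" "\<forall>t\<in>{\<gamma>..\<beta>}. \<bar>poly q t\<bar> \<le> M"
  have "norm (pact q T b) \<le> 2 * M * norm b + \<epsilon>" if \<epsilon>: "\<epsilon> > 0" for \<epsilon>
  proof -
    define \<eta> where "\<eta> = \<epsilon> / (2 * (norm b + 1))"
    have \<eta>: "\<eta> > 0" using \<epsilon> by (simp add: \<eta>_def add_nonneg_pos)
    have "bounded (poly q ` {\<alpha>..\<delta>})"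
      by (intro compact_imp_bounded compact_continuous_image continuous_intros compact_Icc)
    then obtain B where B: "B > 0" "\<And>t. t \<in> {\<alpha>..\<delta>} \<Longrightarrow> \<bar>poly q t\<bar> \<le> B"
      unfolding bounded_pos by auto
    define e where "e t = max 0 (min 1 ((\<beta> - t) / (\<beta> - \<gamma>)))" for t
    have "continuous_on {\<alpha>..\<delta>} e" unfolding e_def[abs_def]
      using le by (intro continuous_intros) auto
    then obtain e' where e': "\<And>t. t \<in> {\<alpha>..\<delta>} \<Longrightarrow> \<bar>e t - poly e' t\<bar> < \<eta> / B"
      using Weierstrass_poly_approx[of \<alpha> \<delta> e "\<eta> / B"] \<eta> B by auto
    have err: "\<bar>poly q t * (e t - poly e' t)\<bar> \<le> \<eta>" if "t \<in> {\<alpha>..\<delta>}" for t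
    proof -
      have "\<bar>poly q t * (e t - poly e' t)\<bar> \<le> B * (\<eta> / B)"
        unfolding abs_mult using B(2)[OF that] e'[OF that] by (intro mult_mono) auto
      then show ?thesis using B(1) by simp
    qed
    have e01: "0 \<le> e t" "e t \<le> 1" for t by (auto simp: e_def)
    have right: "\<bar>poly q t * e t\<bar> \<le> M" if "\<gamma> \<le> t" for t
    proof (cases "t \<le> \<beta>")
      case True
      then have "\<bar>poly q t\<bar> * \<bar>e t\<bar> \<le> M * 1" using M that e01[of t] by (intro mult_mono) auto
      then show ?thesis by (simp add: abs_mult)
    next
      case False
      then have "e t = 0" using le by (simp add: e_def divide_nonpos_pos)
      then show ?thesis using M by simp
    qed
    have left: "\<bar>poly q t * (1 - e t)\<bar> \<le> M" if "t \<le> \<beta>" for t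
    proof (cases "\<gamma> \<le> t")
      case True
      then have "\<bar>poly q t\<bar> * \<bar>1 - e t\<bar> \<le> M * 1" using M that e01[of t] by (intro mult_mono) auto
      then show ?thesis by (simp add: abs_mult)
    next
      case False
      then have "e t = 1" using le by (simp add: e_def field_simps)
      then show ?thesis using M by simp
    qed
    have "norm (pact (q * e') T b) \<le> (M + \<eta>) * norm b"
    proof (rule spec_inD[OF sp(2)])
      fix t assume t: "\<gamma> \<le> t" "t \<le> \<delta>"
      have "poly (q * e') t = poly q t * e t - poly q t * (e t - poly e' t)"
        by (simp add: algebra_simps)
      then show "\<bar>poly (q * e') t\<bar> \<le> M + \<eta>"
        using right[of t] err[of t] t le by auto
    qed (use M \<eta> in auto)
    moreover have "norm (pact (q * (1 - e')) T b) \<le> (M + \<eta>) * norm b"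
    proof (rule spec_inD[OF sp(1)])
      fix t assume t: "\<alpha> \<le> t" "t \<le> \<beta>"
      have "poly (q * (1 - e')) t = poly q t * (1 - e t) + poly q t * (e t - poly e' t)"
        by (simp add: algebra_simps)
      then show "\<bar>poly (q * (1 - e')) t\<bar> \<le> M + \<eta>"
        using left[of t] err[of t] t le by auto
    qed (use M \<eta> in auto)
    moreover have "pact q T b = pact (q * e') T b + pact (q * (1 - e')) T b"
      by (simp add: pact_add[symmetric] algebra_simps)
    ultimately have "norm (pact q T b) \<le> 2 * M * norm b + 2 * \<eta> * norm b"
      using norm_triangle_ineq[of "pact (q * e') T b" "pact (q * (1 - e')) T b"]
      by (simp add: algebra_simps)
    moreover have "2 * \<eta> * norm b \<le> \<epsilon>"
    proof -
      have "2 * \<eta> * norm b \<le> 2 * \<eta> * (norm b + 1)" using \<eta> by (intro mult_left_mono) auto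
      also have "\<dots> = \<epsilon>"
        unfolding \<eta>_def by (simp add: divide_simps) (use norm_ge_zero[of b] in argo)
      finally show ?thesis .
    qed
    ultimately show ?thesis by simp
  qed
  then have "norm (pact q T b) \<le> 2 * M * norm b"
    by (rule field_le_epsilon)
  also have "\<dots> \<le> 2 * (real (degree q) + 1) * M * norm b"
    using M by (intro mult_right_mono) (auto simp: algebra_simps)
  finally show "norm (pact q T b) \<le> 2 * (real (degree q) + 1) * M * norm b" .
qed simp

lemma spec_in_center:
  assumes "spec_in T \<alpha> \<beta>" "linear T" "\<alpha> \<le> \<beta>"
  shows "norm (T b - ((\<alpha> + \<beta>) / 2) *\<^sub>R b) \<le> (\<beta> - \<alpha>) / 2 * norm b"
proof -
  have "norm (pact [:- ((\<alpha> + \<beta>) / 2), 1:] T b) \<le> (\<beta> - \<alpha>) / 2 * norm b"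
    by (rule spec_inD[OF assms(1)]) (use assms(3) in \<open>auto simp: abs_le_iff field_simps\<close>)
  then show ?thesis using assms(2) by (simp add: pact_pCons linear_0)
qed

text \<open>Converse to \<open>spec_in_center\<close>: an interval containing the spectrum is the
  same as a norm bound on \<open>T - c\<close>. Norm bounds add, so the lemma on sums needs no
  commutation.\<close>

lemma spec_in_ball:
  assumes T: "sa T" and le: "\<And>b. norm (T b - c *\<^sub>R b) \<le> \<rho> * norm b" and "0 \<le> \<rho>"
  shows "spec_in T (c - \<rho>) (c + \<rho>)"
proof -
  define S where "S = pact [:- c, 1:] T"
  have S: "sa S" unfolding S_def by (rule sa_pact[OF T])
  have Sb: "S b = T b - c *\<^sub>R b" for b
    using saD(2)[OF T] by (simp add: S_def pact_pCons linear_0)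
  have "spec_in S (- \<rho>) \<rho>"
    by (rule sa_spec_in_symmetric[OF S]) (use le \<open>0 \<le> \<rho>\<close> in \<open>auto simp: Sb\<close>)
  then have "spec_in (pact [:c, 1:] S) (c - \<rho>) (c + \<rho>)"
    by (rule spec_in_pact) (use S in \<open>auto simp: saD(2)\<close>)
  moreover have "pact [:c, 1:] S = T"
    by (rule ext) (use saD(2)[OF S] in \<open>simp add: pact_pCons linear_0, simp add: Sb\<close>)
  ultimately show ?thesis by simp
qed

lemma spec_in_add:
  assumes "sa S" "sa T" "spec_in S \<alpha> \<beta>" "spec_in T \<gamma> \<delta>" "\<alpha> \<le> \<beta>" "\<gamma> \<le> \<delta>"
  shows "spec_in (\<lambda>b. S b + T b) (\<alpha> + \<gamma>) (\<beta> + \<delta>)"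
proof -
  have "spec_in (\<lambda>b. S b + T b) ((\<alpha> + \<gamma> + \<beta> + \<delta>) / 2 - (\<beta> + \<delta> - \<alpha> - \<gamma>) / 2)
      ((\<alpha> + \<gamma> + \<beta> + \<delta>) / 2 + (\<beta> + \<delta> - \<alpha> - \<gamma>) / 2)"
  proof (rule spec_in_ball)
    fix b
    have "S b + T b - ((\<alpha> + \<gamma> + \<beta> + \<delta>) / 2) *\<^sub>R b =
        (S b - ((\<alpha> + \<beta>) / 2) *\<^sub>R b) + (T b - ((\<gamma> + \<delta>) / 2) *\<^sub>R b)"
      by (simp add: algebra_simps add_divide_distrib)
    then show "norm (S b + T b - ((\<alpha> + \<gamma> + \<beta> + \<delta>) / 2) *\<^sub>R b) \<le> (\<beta> + \<delta> - \<alpha> - \<gamma>) / 2 * norm b"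
      using norm_triangle_ineq[of "S b - ((\<alpha> + \<beta>) / 2) *\<^sub>R b" "T b - ((\<gamma> + \<delta>) / 2) *\<^sub>R b"]
        spec_in_center[OF assms(3) saD(2)[OF assms(1)] assms(5), of b]
        spec_in_center[OF assms(4) saD(2)[OF assms(2)] assms(6), of b]
      by (simp add: algebra_simps add_divide_distrib diff_divide_distrib)
  qed (use assms in \<open>auto intro: sa_add\<close>)
  moreover have "(\<alpha> + \<gamma> + \<beta> + \<delta>) / 2 - (\<beta> + \<delta> - \<alpha> - \<gamma>) / 2 = \<alpha> + \<gamma>"
    "(\<alpha> + \<gamma> + \<beta> + \<delta>) / 2 + (\<beta> + \<delta> - \<alpha> - \<gamma>) / 2 = \<beta> + \<delta>"
    by (simp_all add: field_simps)
  ultimately show ?thesis by simp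
qed

end

subsection \<open>Functional calculus of positive elements\<close>

lemma npow_mult: "npow x (Suc n) * b = ((*) x ^^ Suc n) (b :: 'a::semigroup_mult)"
  by (induction n) (simp_all add: mult.assoc)

text \<open>\<open>polyev\<close> leaves out the constant coefficient, since the algebra may have no
  unit to carry it, while \<open>pact\<close> lets that coefficient act as a multiple of the
  identity operator.\<close>

lemma polyev_mult:
  fixes x b :: "'a::real_algebra"
  shows "polyev q x * b = pact q ((*) x) b - coeff q 0 *\<^sub>R b"
proof -
  have "pact q ((*) x) b = coeff q 0 *\<^sub>R b + (\<Sum>i\<in>{1..degree q}. coeff q i *\<^sub>R ((*) x ^^ i) b)"
    unfolding pact_def atMost_atLeast0 by (subst sum.atLeast_Suc_atMost) auto
  also have "(\<Sum>i\<in>{1..degree q}. coeff q i *\<^sub>R ((*) x ^^ i) b) = polyev q x * b"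
    unfolding polyev_def sum_distrib_right
  proof (rule sum.cong)
    fix i assume "i \<in> {1..degree q}"
    then obtain n where "i = Suc n" by (cases i) auto
    then show "coeff q i *\<^sub>R ((*) x ^^ i) b = coeff q i *\<^sub>R npow x i * b"
      by (simp only: npow_mult mult_scaleR_left)
  qed simp
  finally show ?thesis by simp
qed

lemma npow_in:
  assumes "x \<in> S" and "\<And>y. y \<in> S \<Longrightarrow> x * y \<in> S"
  shows "npow x n \<in> S"
  using assms by (induction x n rule: npow.induct) auto

lemma polyev_in:
  assumes "x \<in> S" and "\<And>y. y \<in> S \<Longrightarrow> x * y \<in> S"
    and S: "0 \<in> S" "\<And>y z. y \<in> S \<Longrightarrow> z \<in> S \<Longrightarrow> y + z \<in> S" "\<And>r y. y \<in> S \<Longrightarrow> r *\<^sub>R y \<in> S"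
  shows "polyev q x \<in> S"
proof -
  have "(\<Sum>i\<in>I. coeff q i *\<^sub>R npow x i) \<in> S" for I
    by (induction I rule: infinite_finite_induct) (use S npow_in[OF assms(1,2)] in auto)
  then show ?thesis by (simp add: polyev_def)
qed

lemma Weierstrass_poly_uniform_limit:
  fixes f :: "real \<Rightarrow> real"
  assumes "continuous_on {a..b} f"
  obtains q :: "nat \<Rightarrow> real poly" where "uniform_limit {a..b} (\<lambda>k. poly (q k)) f sequentially"
proof -
  have "\<exists>q. \<forall>t\<in>{a..b}. \<bar>f t - poly q t\<bar> < inverse (real (Suc k))" for k
    by (rule Weierstrass_poly_approx[OF assms, of "inverse (real (Suc k))"]) (simp, blast)
  then obtain q where q: "\<And>k t. t \<in> {a..b} \<Longrightarrow> \<bar>f t - poly (q k) t\<bar> < inverse (real (Suc k))"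
    by metis
  have "uniform_limit {a..b} (\<lambda>k. poly (q k)) f sequentially"
    unfolding uniform_limit_iff
  proof (intro allI impI)
    fix e :: real assume "e > 0"
    have "eventually (\<lambda>k. inverse (real (Suc k)) < e) sequentially"
      using LIMSEQ_inverse_real_of_nat order_tendstoD(2) \<open>e > 0\<close> by blast
    then show "eventually (\<lambda>k. \<forall>t\<in>{a..b}. dist (poly (q k) t) (f t) < e) sequentially"
      by eventually_elim (metis q dist_real_def abs_minus_commute order_less_trans)
  qed
  with that show ?thesis .
qed

context cstar_algebra
begin

definition pos :: "'a \<Rightarrow> bool" where
  "pos x \<longleftrightarrow> star x = x \<and> spec_in ((*) x) 0 (norm x)"

lemma posD: "pos x \<Longrightarrow> star x = x" "pos x \<Longrightarrow> spec_in ((*) x) 0 (norm x)"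
  by (auto simp: pos_def)

lemma linear_mult_left: "linear ((*) (x::'a))"
  by (rule bounded_linear.linear[OF bounded_linear_mult_right])

text \<open>A relation, because without a unit there may be no element representing \<open>f\<close>
  when \<open>f 0\<close> is not 0. Convergence is required only at each \<open>b\<close>; norm
  bounds are recovered from \<open>norm_le_of_mult_bound\<close>.\<close>

definition fcalc :: "'a \<Rightarrow> (real \<Rightarrow> real) \<Rightarrow> 'a \<Rightarrow> bool" where
  "fcalc x f z \<longleftrightarrow> (\<exists>q. uniform_limit {0..norm x} (\<lambda>k. poly (q k)) f sequentially \<and>
     (\<forall>b. (\<lambda>k. pact (q k) ((*) x) b) \<longlonglongrightarrow> z * b))"

lemma fcalc_norm_le:
  assumes x: "pos x" and z: "fcalc x f z"
    and M: "\<And>t. 0 \<le> t \<Longrightarrow> t \<le> norm x \<Longrightarrow> \<bar>f t\<bar> \<le> M" "0 \<le> M"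
  shows "norm z \<le> M"
proof (rule field_le_epsilon)
  fix e :: real assume e: "e > 0"
  obtain q where q: "uniform_limit {0..norm x} (\<lambda>k. poly (q k)) f sequentially"
    "\<And>b. (\<lambda>k. pact (q k) ((*) x) b) \<longlonglongrightarrow> z * b"
    using z by (auto simp: fcalc_def)
  show "norm z \<le> M + e"
  proof (rule norm_le_of_mult_bound)
    fix b
    have "eventually (\<lambda>k. \<forall>t\<in>{0..norm x}. dist (poly (q k) t) (f t) < e) sequentially"
      using uniform_limitD[OF q(1) e] .
    then have "eventually (\<lambda>k. norm (pact (q k) ((*) x) b) \<le> (M + e) * norm b) sequentially"
    proof eventually_elim
      case (elim k)
      show ?case
      proof (rule spec_inD[OF posD(2)[OF x]])
        fix t assume "0 \<le> t" "t \<le> norm x"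
        then show "\<bar>poly (q k) t\<bar> \<le> M + e"
          using elim[rule_format, of t] M(1)[of t] by (auto simp: dist_real_def)
      qed (use M e in auto)
    qed
    then show "norm (z * b) \<le> (M + e) * norm b"
      by (intro tendsto_upperbound[OF tendsto_norm[OF q(2)]]) auto
  qed (use M e in auto)
qed

lemma fcalc_diff:
  assumes "fcalc x f z" "fcalc x g w"
  shows "fcalc x (\<lambda>t. f t - g t) (z - w)"
proof -
  obtain p q where "uniform_limit {0..norm x} (\<lambda>k. poly (p k)) f sequentially"
    "\<And>b. (\<lambda>k. pact (p k) ((*) x) b) \<longlonglongrightarrow> z * b"
    "uniform_limit {0..norm x} (\<lambda>k. poly (q k)) g sequentially"
    "\<And>b. (\<lambda>k. pact (q k) ((*) x) b) \<longlonglongrightarrow> w * b"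
    using assms by (auto simp: fcalc_def)
  then show ?thesis
    unfolding fcalc_def
    by (intro exI[of _ "\<lambda>k. p k - q k"])
      (auto simp: pact_diff left_diff_distrib poly_diff[abs_def] intro!: tendsto_diff uniform_limit_minus)
qed

lemma fcalc_unique:
  assumes "pos x" "fcalc x f z" "fcalc x g w" "\<And>t. 0 \<le> t \<Longrightarrow> t \<le> norm x \<Longrightarrow> f t = g t"
  shows "z = w"
  using fcalc_norm_le[OF assms(1) fcalc_diff[OF assms(2,3)], of 0] assms(4) by simp

lemma fcalc_mult:
  assumes x: "pos x" and "fcalc x f z" "fcalc x g w"
    and cont: "continuous_on {0..norm x} f" "continuous_on {0..norm x} g"
  shows "fcalc x (\<lambda>t. f t * g t) (z * w)"
proof -
  obtain p q where pq: "uniform_limit {0..norm x} (\<lambda>k. poly (p k)) f sequentially"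
    "\<And>b. (\<lambda>k. pact (p k) ((*) x) b) \<longlonglongrightarrow> z * b"
    "uniform_limit {0..norm x} (\<lambda>k. poly (q k)) g sequentially"
    "\<And>b. (\<lambda>k. pact (q k) ((*) x) b) \<longlonglongrightarrow> w * b"
    using assms by (auto simp: fcalc_def)
  have bdd: "bounded (f ` {0..norm x})" "bounded (g ` {0..norm x})"
    by (intro compact_imp_bounded compact_continuous_image cont compact_Icc)+
  then obtain M where M: "M > 0" "\<And>t. t \<in> {0..norm x} \<Longrightarrow> \<bar>f t\<bar> \<le> M"
    unfolding bounded_pos by auto
  have A: "uniform_limit {0..norm x} (\<lambda>k t. poly (p k * q k) t) (\<lambda>t. f t * g t) sequentially"
    unfolding poly_mult by (intro uniform_lim_mult pq bdd)
  have B: "(\<lambda>k. pact (p k * q k) ((*) x) b) \<longlonglongrightarrow> z * w * b" for b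
  proof -
    \<comment> \<open>Pointwise limits of operators multiply once one factor is uniformly bounded;
      the spectral bound gives \<open>M + 1\<close> for the operators of \<open>p k\<close>.\<close>
    have "eventually (\<lambda>k. \<forall>t\<in>{0..norm x}. dist (poly (p k) t) (f t) < 1) sequentially"
      using uniform_limitD[OF pq(1)] by simp
    then have bd: "eventually (\<lambda>k. norm (pact (p k) ((*) x) (pact (q k) ((*) x) b - w * b)) \<le>
        norm (pact (q k) ((*) x) b - w * b) * (M + 1)) sequentially"
    proof eventually_elim
      case (elim k)
      have "norm (pact (p k) ((*) x) c) \<le> (M + 1) * norm c" for c
      proof (rule spec_inD[OF posD(2)[OF x]])
        fix t assume "0 \<le> t" "t \<le> norm x"
        then show "\<bar>poly (p k) t\<bar> \<le> M + 1"
          using elim[rule_format, of t] M(2)[of t] by (auto simp: dist_real_def)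
      qed (use M in auto)
      then show ?case by (subst mult.commute)
    qed
    have "(\<lambda>k. pact (p k) ((*) x) (pact (q k) ((*) x) b - w * b)) \<longlonglongrightarrow> 0"
      using tendsto_0_le[OF _ bd] LIM_zero[OF pq(4)[of b]] by blast
    then have "(\<lambda>k. pact (p k) ((*) x) (pact (q k) ((*) x) b - w * b) + pact (p k) ((*) x) (w * b)) \<longlonglongrightarrow> 0 + z * (w * b)"
      by (intro tendsto_add pq(2))
    then show ?thesis
      by (simp add: pact_mult[OF linear_mult_left] linear_diff[OF linear_pact[OF linear_mult_left]] mult.assoc)
  qed
  show ?thesis
    unfolding fcalc_def by (rule exI[of _ "\<lambda>k. p k * q k"], rule conjI[OF A], rule allI, rule B)
qed

lemma fcalc_ident: "fcalc x (\<lambda>t. t) x"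
  unfolding fcalc_def
  by (rule exI[of _ "\<lambda>k. [:0, 1:]"]) (auto simp: linear_mult_left uniform_limit_iff)

text \<open>The factor 2 pays for the missing constant coefficient, whose size is the value of the
  difference at 0.\<close>

lemma polyev_norm_diff_le:
  assumes x: "pos x" and e: "0 \<le> e"
    and "\<And>t. t \<in> {0..norm x} \<Longrightarrow> \<bar>poly p t - poly q t\<bar> \<le> e"
  shows "norm (polyev p x - polyev q x) \<le> 2 * e"
proof (rule norm_le_of_mult_bound)
  fix b
  have "(polyev p x - polyev q x) * b = pact (p - q) ((*) x) b - coeff (p - q) 0 *\<^sub>R b"
    by (simp add: left_diff_distrib polyev_mult pact_diff scaleR_left_diff_distrib)
  moreover have "norm (pact (p - q) ((*) x) b) \<le> e * norm b"
    by (rule spec_inD[OF posD(2)[OF x] e]) (use assms(3) in auto)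
  moreover have "\<bar>coeff (p - q) 0\<bar> \<le> e"
    using assms(3)[of 0] by (simp add: poly_0_coeff_0)
  then have "norm (coeff (p - q) 0 *\<^sub>R b) \<le> e * norm b"
    by (simp add: mult_right_mono)
  ultimately show "norm ((polyev p x - polyev q x) * b) \<le> 2 * e * norm b"
    using norm_triangle_ineq4[of "pact (p - q) ((*) x) b" "coeff (p - q) 0 *\<^sub>R b"] by simp
qed (use e in auto)

text \<open>With \<open>p = q\<close> this is the Cauchy property; with different sequences it is
  the independence of the approximation that the definite description in \<open>cfc_pow\<close>
  requires.\<close>

lemma polyev_same_limit:
  assumes x: "pos x"
    and p: "uniform_limit {0..norm x} (\<lambda>k. poly (p k)) f sequentially"
    and q: "uniform_limit {0..norm x} (\<lambda>k. poly (q k)) f sequentially"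
    and e: "e > 0"
  obtains N where "\<And>m n. m \<ge> N \<Longrightarrow> n \<ge> N \<Longrightarrow> norm (polyev (p m) x - polyev (q n) x) < e"
proof -
  have "eventually (\<lambda>k. (\<forall>t\<in>{0..norm x}. dist (poly (p k) t) (f t) < e / 6) \<and>
      (\<forall>t\<in>{0..norm x}. dist (poly (q k) t) (f t) < e / 6)) sequentially"
    using e by (intro eventually_conj uniform_limitD[OF p] uniform_limitD[OF q]) auto
  then obtain N where N: "\<And>k. k \<ge> N \<Longrightarrow> (\<forall>t\<in>{0..norm x}. dist (poly (p k) t) (f t) < e / 6) \<and>
      (\<forall>t\<in>{0..norm x}. dist (poly (q k) t) (f t) < e / 6)"
    unfolding eventually_sequentially by blast
  have "norm (polyev (p m) x - polyev (q n) x) < e" if "m \<ge> N" "n \<ge> N" for m n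
  proof -
    have "norm (polyev (p m) x - polyev (q n) x) \<le> 2 * (e / 3)"
    proof (rule polyev_norm_diff_le[OF x])
      fix t assume t: "t \<in> {0..norm x}"
      have "dist (poly (p m) t) (f t) < e / 6" "dist (poly (q n) t) (f t) < e / 6"
        using N[OF that(1)] N[OF that(2)] t by auto
      then show "\<bar>poly (p m) t - poly (q n) t\<bar> \<le> e / 3"
        unfolding dist_real_def by linarith
    qed (use e in simp)
    then show ?thesis using e by simp
  qed
  with that show ?thesis by blast
qed

lemma continuous_on_powr_const:
  assumes "p > 0"
  shows "continuous_on {0..R} (\<lambda>t::real. t powr p)"
  using assms by (intro continuous_on_powr' continuous_intros) auto

lemma cfc_pow_tendsto:
  assumes x: "pos x" and p: "p > 0"
    and q: "uniform_limit {0..norm x} (\<lambda>k. poly (q k)) (\<lambda>t. t powr p) sequentially"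
  shows "(\<lambda>k. polyev (q k) x) \<longlonglongrightarrow> cfc_pow x p"
proof -
  obtain q0 where q0: "uniform_limit {0..norm x} (\<lambda>k. poly (q0 k)) (\<lambda>t. t powr p) sequentially"
    using Weierstrass_poly_uniform_limit[OF continuous_on_powr_const[OF p]] .
  have "Cauchy (\<lambda>k. polyev (q0 k) x)"
    unfolding Cauchy_iff using polyev_same_limit[OF x q0 q0] by metis
  then obtain z where z: "(\<lambda>k. polyev (q0 k) x) \<longlonglongrightarrow> z"
    by (auto simp: Cauchy_convergent_iff convergent_def)
  have all: "(\<lambda>k. polyev (q k) x) \<longlonglongrightarrow> z"
    if q: "uniform_limit {0..norm x} (\<lambda>k. poly (q k)) (\<lambda>t. t powr p) sequentially" for q
  proof -
    have "(\<lambda>k. polyev (q0 k) x - polyev (q k) x) \<longlonglongrightarrow> 0"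
      unfolding LIMSEQ_iff using polyev_same_limit[OF x q0 q] by (metis diff_zero order_refl)
    from tendsto_diff[OF z this] show ?thesis by simp
  qed
  have "cfc_pow x p = z"
    unfolding cfc_pow_def
  proof (rule the_equality)
    show "w = z" if "\<forall>q. uniform_limit {0..norm x} (\<lambda>k. poly (q k)) (\<lambda>t. t powr p) sequentially \<longrightarrow>
        (\<lambda>k. polyev (q k) x) \<longlonglongrightarrow> w" for w
      using that q0 z LIMSEQ_unique by blast
  qed (use all in blast)
  then show ?thesis using all[OF q] by simp
qed

text \<open>Since \<open>p > 0\<close>, the power function vanishes at 0, so the constant
  coefficients tend to 0 and \<open>polyev\<close> and \<open>pact\<close> have the same
  limit.\<close>

lemma fcalc_cfc_pow:
  assumes x: "pos x" and p: "p > 0"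
  shows "fcalc x (\<lambda>t. t powr p) (cfc_pow x p)"
proof -
  obtain q where q: "uniform_limit {0..norm x} (\<lambda>k. poly (q k)) (\<lambda>t. t powr p) sequentially"
    using Weierstrass_poly_uniform_limit[OF continuous_on_powr_const[OF p]] .
  have "(\<lambda>k. coeff (q k) 0) \<longlonglongrightarrow> 0"
    using tendsto_uniform_limitI[OF q, of 0] by (simp add: poly_0_coeff_0)
  then have "(\<lambda>k. polyev (q k) x * b + coeff (q k) 0 *\<^sub>R b) \<longlonglongrightarrow> cfc_pow x p * b + 0 *\<^sub>R b" for b
    by (intro tendsto_intros cfc_pow_tendsto[OF x p q])
  then show ?thesis unfolding fcalc_def using q by (auto simp: polyev_mult)
qed

lemma cfc_pow_in_closed:
  assumes x: "pos x" and p: "p > 0" and "closed S" and "\<And>q. polyev q x \<in> S"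
  shows "cfc_pow x p \<in> S"
proof -
  obtain q where q: "uniform_limit {0..norm x} (\<lambda>k. poly (q k)) (\<lambda>t. t powr p) sequentially"
    using Weierstrass_poly_uniform_limit[OF continuous_on_powr_const[OF p]] .
  show ?thesis
    by (rule closed_sequentially[OF assms(3) _ cfc_pow_tendsto[OF x p q]]) (rule assms(4))
qed

lemma cfc_pow_commute:
  assumes x: "pos x" "p > 0" and w: "w * x = x * w"
  shows "w * cfc_pow x p = cfc_pow x p * w"
proof -
  have "cfc_pow x p \<in> {z. w * z = z * w}"
  proof (rule cfc_pow_in_closed[OF x])
    show "closed {z. w * z = z * w}" by (intro closed_Collect_eq continuous_intros)
    have "x * y \<in> {z. w * z = z * w}" if "y \<in> {z. w * z = z * w}" for y
      using that w by simp (metis mult.assoc)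
    then show "polyev q x \<in> {z. w * z = z * w}" for q
      using w by (intro polyev_in) (auto simp: algebra_simps)
  qed
  then show ?thesis by simp
qed

lemma star_cfc_pow:
  assumes x: "pos x" "p > 0"
  shows "star (cfc_pow x p) = cfc_pow x p"
proof -
  \<comment> \<open>Self-adjointness alone is not stable under multiplication by \<open>x\<close>;
    commutation with \<open>x\<close> is carried along to make it so.\<close>
  let ?S = "{z. star z = z \<and> x * z = z * x}"
  have "cfc_pow x p \<in> ?S"
  proof (rule cfc_pow_in_closed[OF x])
    show "closed ?S"
      by (intro closed_Collect_conj closed_Collect_eq continuous_intros
          linear_continuous_on bounded_linear_star)
    have "x * y \<in> ?S" if "y \<in> ?S" for y
      using that posD(1)[OF x(1)] by (simp add: star_mult) (metis mult.assoc)
    then show "polyev q x \<in> ?S" for q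
      using posD(1)[OF x(1)] by (intro polyev_in) (auto simp: algebra_simps star_add star_scaleR)
  qed
  then show ?thesis by simp
qed

lemma cfc_pow_add:
  assumes x: "pos x" "p > 0" "q > 0"
  shows "cfc_pow x p * cfc_pow x q = cfc_pow x (p + q)"
  by (rule fcalc_unique[OF x(1) fcalc_mult[OF x(1) fcalc_cfc_pow[OF x(1,2)] fcalc_cfc_pow[OF x(1,3)]]
        fcalc_cfc_pow[OF x(1), of "p + q"]])
    (use x in \<open>auto simp: continuous_on_powr_const powr_add\<close>)

lemma cfc_pow_1: "pos x \<Longrightarrow> cfc_pow x 1 = x"
  by (rule fcalc_unique[OF _ fcalc_cfc_pow fcalc_ident]) auto

lemma norm_cfc_pow_le:
  assumes "pos x" "p > 0"
  shows "norm (cfc_pow x p) \<le> norm x powr p"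
  by (rule fcalc_norm_le[OF assms(1) fcalc_cfc_pow[OF assms]])
    (use assms in \<open>auto intro: powr_mono2\<close>)

lemma norm_cfc_pow_diff_le:
  assumes "pos x" "p > 0" "q > 0" "0 \<le> M"
    and "\<And>t. 0 \<le> t \<Longrightarrow> t \<le> norm x \<Longrightarrow> \<bar>t powr p - t powr q\<bar> \<le> M"
  shows "norm (cfc_pow x p - cfc_pow x q) \<le> M"
  by (rule fcalc_norm_le[OF assms(1) fcalc_diff[OF fcalc_cfc_pow[OF assms(1,2)] fcalc_cfc_pow[OF assms(1,3)]]])
    (use assms in auto)

section \<open>The cone of positive elements\<close>

lemma spec_in_mult_symmetric: "star x = x \<Longrightarrow> spec_in ((*) x) (- norm x) (norm x)"
  by (rule sa_spec_in_symmetric) (auto intro: sa_mult norm_mult_ineq)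

text \<open>Any upper end can be lowered to \<open>norm x\<close> by intersecting with the symmetric
  interval. Norm 0 is separate because the intersection lemma wants an overlap of positive
  length.\<close>

lemma posI:
  assumes x: "star x = x" and sp: "spec_in ((*) x) 0 \<beta>"
  shows "pos x"
proof -
  have sym: "spec_in ((*) x) (- norm x) (norm x)" by (rule spec_in_mult_symmetric[OF x])
  have "spec_in ((*) x) 0 (norm x)"
  proof (cases "\<beta> \<le> norm x")
    case True
    then show ?thesis by (intro spec_in_mono[OF sp]) auto
  next
    case False
    show ?thesis
    proof (cases "norm x = 0")
      case True
      then show ?thesis using sym by simp
    next
      case nz: False
      show ?thesis
        by (rule spec_in_Int[OF sa_mult[OF x] sym sp]) (use False nz in auto)
    qed
  qed
  with x show ?thesis by (simp add: pos_def)
qed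

text \<open>Positivity as a norm condition: \<open>x\<close> lies within \<open>c\<close> of the
  scalar \<open>c\<close>. In this form it passes to scalings and, with one \<open>c\<close> for a
  bounded sequence, to limits.\<close>

lemma pos_ballI:
  assumes x: "star x = x" and "\<And>b. norm (x * b - c *\<^sub>R b) \<le> c * norm b" "0 \<le> c"
  shows "pos x"
  using spec_in_ball[OF sa_mult[OF x], of c c] assms by (intro posI[OF x, of "c + c"]) simp

lemma pos_center:
  assumes "pos x" "norm x \<le> 2 * c"
  shows "norm (x * b - c *\<^sub>R b) \<le> c * norm b"
proof -
  have "0 \<le> c" using assms(2) norm_ge_zero[of x] by linarith
  have "spec_in ((*) x) 0 (2 * c)"
    by (rule spec_in_mono[OF posD(2)[OF assms(1)]]) (use assms in auto)
  from spec_in_center[OF this linear_mult_left, of b] \<open>0 \<le> c\<close> show ?thesis by simp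
qed

lemma pos_square:
  assumes x: "star x = x"
  shows "pos (x * x)"
proof (rule posI)
  show "star (x * x) = x * x" by (simp add: star_mult x)
  have "spec_in (pact [:0, 0, 1:] ((*) x)) 0 (norm x * norm x)"
  proof (rule spec_in_pact[OF spec_in_mult_symmetric[OF x] linear_mult_left])
    fix t assume "- norm x \<le> t" "t \<le> norm x"
    then have "\<bar>t\<bar> * \<bar>t\<bar> \<le> norm x * norm x" by (intro mult_mono) auto
    then show "poly [:0, 0, 1:] t \<in> {0..norm x * norm x}" by simp
  qed
  moreover have "pact [:0, 0, 1:] ((*) x) = (*) (x * x)"
    by (rule ext) (simp add: pact_pCons[OF linear_mult_left] mult.assoc)
  ultimately show "spec_in ((*) (x * x)) 0 (norm x * norm x)" by simp
qed

lemma pos_add: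
  assumes "pos x" "pos y"
  shows "pos (x + y)"
proof (rule posI)
  show "star (x + y) = x + y" using assms by (simp add: star_add posD)
  have "spec_in (\<lambda>b. x * b + y * b) (0 + 0) (norm x + norm y)"
    by (rule spec_in_add) (use assms in \<open>auto simp: posD sa_mult\<close>)
  then show "spec_in ((*) (x + y)) 0 (norm x + norm y)"
    by (simp add: distrib_right[abs_def])
qed

lemma pos_scaleR:
  assumes x: "pos x" and r: "0 \<le> r"
  shows "pos (r *\<^sub>R x)"
proof (rule pos_ballI)
  show "star (r *\<^sub>R x) = r *\<^sub>R x" using x by (simp add: star_scaleR posD)
  fix b
  have "norm (r *\<^sub>R (x * b - norm x *\<^sub>R b)) \<le> r * (norm x * norm b)"
    using pos_center[OF x, of "norm x" b] r by (simp add: mult_left_mono)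
  then show "norm (r *\<^sub>R x * b - (r * norm x) *\<^sub>R b) \<le> r * norm x * norm b"
    by (simp add: scaleR_diff_right mult.assoc)
qed (use r in auto)

lemma pos_0 [simp]: "pos 0"
  using pos_square[of 0] by simp

lemma pos_sum: "(\<And>i. i \<in> I \<Longrightarrow> pos (f i)) \<Longrightarrow> pos (\<Sum>i\<in>I. f i)"
  by (induction I rule: infinite_finite_induct) (auto intro: pos_add)

lemma pos_limit:
  assumes "\<And>k. pos (f k)" "f \<longlonglongrightarrow> x"
  shows "pos x"
proof -
  have "Bseq f" using assms(2) convergentI convergent_imp_Bseq by blast
  then obtain K where K: "K > 0" "\<And>k. norm (f k) \<le> K" by (auto simp: Bseq_def)
  show ?thesis
  proof (rule pos_ballI)
    have "(\<lambda>k. star (f k)) \<longlonglongrightarrow> star x"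
      by (intro bounded_linear.tendsto[OF bounded_linear_star] assms)
    then show "star x = x"
      using assms LIMSEQ_unique by (simp add: posD(1)[OF assms(1)])
    show "norm (x * b - K *\<^sub>R b) \<le> K * norm b" for b
    proof (rule tendsto_upperbound)
      show "(\<lambda>k. norm (f k * b - K *\<^sub>R b)) \<longlonglongrightarrow> norm (x * b - K *\<^sub>R b)"
        by (intro tendsto_intros assms)
      show "eventually (\<lambda>k. norm (f k * b - K *\<^sub>R b) \<le> K * norm b) sequentially"
      proof (intro always_eventually allI pos_center assms)
        show "norm (f k) \<le> 2 * K" for k using K(1) K(2)[of k] by linarith
      qed
    qed simp
  qed (use K in auto)
qed

text \<open>Replaces the comparison of the spectra of \<open>c\<^sup>* c\<close> and \<open>c c\<^sup>*\<close>: \<open>q(c\<^sup>* c) c\<^sup>* = c\<^sup>* q(c c\<^sup>*)\<close>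
  for every polynomial \<open>q\<close>, and one takes \<open>q\<close> close to the indicator function of the negative axis.\<close>

lemma star_mult_neg_imp_zero:
  assumes neg: "spec_in ((*) (star c * c)) (- V) 0" and "0 \<le> V" and pos: "pos (c * star c)"
  shows "c = 0"
proof -
  define T where "T = (*) (star c * c)"
  define W where "W = norm (c * star c)"
  have linT: "linear T" unfolding T_def by (rule linear_mult_left)
  have "norm (star c * c) \<le> 0"
  proof (rule field_le_epsilon)
    fix \<epsilon> :: real assume \<epsilon>: "\<epsilon> > 0"
    define \<eta> where "\<eta> = \<epsilon> / 2"
    \<comment> \<open>The two parts of the estimate below contribute
      \<open>norm c * norm c * \<delta>\<close> and \<open>\<eta> + V * \<delta>\<close>; this
      choice keeps the total below \<open>2 * \<eta> = \<epsilon>\<close>. The summand 1 keeps the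
      denominator positive.\<close>
    define \<delta> where "\<delta> = \<eta> / (norm c * norm c + V + 1)"
    have D: "norm c * norm c + V + 1 > 0" using \<open>0 \<le> V\<close> by (simp add: add_nonneg_pos)
    have \<eta>: "\<eta> > 0" using \<epsilon> by (simp add: \<eta>_def)
    have \<delta>: "\<delta> > 0" "(norm c * norm c + V + 1) * \<delta> = \<eta>" using \<eta> D by (auto simp: \<delta>_def)
    \<comment> \<open>A ramp that is 1 below \<open>-\<eta>\<close> and 0 on the positive axis. In
      between, \<open>t\<close> itself is at most \<eta> in modulus, so multiplying by
      \<open>t\<close> hides the error there.\<close>
    define f where "f t = max 0 (min 1 (- t / \<eta>))" for t
    have "continuous_on {- V..W} f" unfolding f_def[abs_def] using \<eta> by (intro continuous_intros) auto
    then obtain q where q: "\<And>t. t \<in> {- V..W} \<Longrightarrow> \<bar>f t - poly q t\<bar> < \<delta>"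
      using Weierstrass_poly_approx[of "- V" W f \<delta>] \<delta> by auto
    show "norm (star c * c) \<le> 0 + \<epsilon>"
    proof (rule norm_le_of_mult_bound)
      fix b
      have "norm (pact q ((*) (c * star c)) (c * b)) \<le> \<delta> * norm (c * b)"
      proof (rule spec_inD[OF posD(2)[OF pos]])
        fix t assume t: "0 \<le> t" "t \<le> norm (c * star c)"
        then have "- t / \<eta> \<le> 0" using \<eta> by (intro divide_nonpos_pos) auto
        then have "f t = 0" unfolding f_def by linarith
        then show "\<bar>poly q t\<bar> \<le> \<delta>" using q[of t] t \<open>0 \<le> V\<close> by (simp add: W_def)
      qed (use \<delta> in auto)
      also have "\<dots> \<le> \<delta> * (norm c * norm b)"
        using \<delta> by (intro mult_left_mono norm_mult_ineq) auto
      finally have 1: "norm (star c * pact q ((*) (c * star c)) (c * b)) \<le> norm c * (\<delta> * (norm c * norm b))"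
        by (intro order_trans[OF norm_mult_ineq] mult_mono) auto
      have "pact q T (star c * (c * b)) = star c * pact q ((*) (c * star c)) (c * b)"
        by (rule pact_intertwine[OF linT linear_mult_left linear_mult_left]) (simp add: T_def mult.assoc)
      then have "pact (q * [:0, 1:]) T b = star c * pact q ((*) (c * star c)) (c * b)"
        by (simp only: pact_mult[OF linT] pact_X[OF linT]) (simp add: T_def mult.assoc)
      with 1 have 1: "norm (pact (q * [:0, 1:]) T b) \<le> norm c * (\<delta> * (norm c * norm b))" by simp
      have 2: "norm (pact ((1 - q) * [:0, 1:]) T b) \<le> (\<eta> + V * \<delta>) * norm b"
      proof (rule spec_inD[OF neg[folded T_def]])
        fix t assume t: "- V \<le> t" "t \<le> 0"
        have "\<bar>(1 - f t) * t\<bar> \<le> \<eta>"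
        proof (cases "t \<le> - \<eta>")
          case True
          then have "f t = 1" using \<eta> by (simp add: f_def field_simps)
          then show ?thesis using \<eta> by simp
        next
          case False
          then have "\<bar>1 - f t\<bar> * \<bar>t\<bar> \<le> 1 * \<eta>" using t by (intro mult_mono) (auto simp: f_def)
          then show ?thesis by (simp add: abs_mult)
        qed
        moreover have "\<bar>(f t - poly q t) * t\<bar> \<le> V * \<delta>"
        proof -
          have "\<bar>f t - poly q t\<bar> * \<bar>t\<bar> \<le> \<delta> * V"
            using q[of t] t \<delta> order_trans[OF t(2) norm_ge_zero[of "c * star c"]]
            by (intro mult_mono) (auto simp: W_def)
          then show ?thesis by (simp add: abs_mult mult.commute)
        qed
        moreover have "poly ((1 - q) * [:0, 1:]) t = (1 - f t) * t + (f t - poly q t) * t"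
          by (simp add: algebra_simps)
        ultimately show "\<bar>poly ((1 - q) * [:0, 1:]) t\<bar> \<le> \<eta> + V * \<delta>" by linarith
      qed (use \<eta> \<delta> \<open>0 \<le> V\<close> in auto)
      have "q * [:0, 1:] + (1 - q) * [:0, 1:] = [:0, 1:]"
        by (simp only: distrib_right[symmetric]) simp
      then have "T b = pact (q * [:0, 1:] + (1 - q) * [:0, 1:]) T b"
        using pact_X[OF linT, of b] by (simp only:)
      then have "T b = pact (q * [:0, 1:]) T b + pact ((1 - q) * [:0, 1:]) T b"
        by (simp only: pact_add)
      then have "norm (T b) \<le> norm c * (\<delta> * (norm c * norm b)) + (\<eta> + V * \<delta>) * norm b"
        using 1 2 norm_triangle_ineq[of "pact (q * [:0, 1:]) T b" "pact ((1 - q) * [:0, 1:]) T b"] by simp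
      also have "\<dots> = ((norm c * norm c + V + 1) * \<delta> + \<eta> - \<delta>) * norm b"
        by (simp add: algebra_simps)
      also have "\<dots> \<le> \<epsilon> * norm b"
        using \<delta> by (intro mult_right_mono) (auto simp: \<eta>_def)
      finally show "norm (star c * c * b) \<le> (0 + \<epsilon>) * norm b" by (simp add: T_def)
    qed (use \<epsilon> in auto)
  qed
  then show ?thesis using cstar_identity[of c] by simp
qed

section \<open>Positivity of \<open>star a * a\<close>\<close>

lemma square_eq_0_imp: "star v = v \<Longrightarrow> v * v = 0 \<Longrightarrow> v = 0"
  using cstar_identity[of v] by simp

definition modulus :: "'a \<Rightarrow> 'a" where
  "modulus x = cfc_pow (x * x) (1/2)"

text \<open>Splits the modulus into two equal commuting factors, so that a compression of the
  modulus by an element commuting with it becomes a square.\<close>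

definition root_modulus :: "'a \<Rightarrow> 'a" where
  "root_modulus x = cfc_pow (x * x) (1/4)"

lemma modulus_facts:
  assumes x: "star x = x"
  shows "modulus x * modulus x = x * x" "root_modulus x * root_modulus x = modulus x"
    "star (modulus x) = modulus x" "star (root_modulus x) = root_modulus x"
    "x * modulus x = modulus x * x" "x * root_modulus x = root_modulus x * x"
proof -
  have p: "pos (x * x)" by (rule pos_square[OF x])
  show "modulus x * modulus x = x * x"
    unfolding modulus_def by (subst cfc_pow_add[OF p]) (auto simp: cfc_pow_1[OF p])
  show "root_modulus x * root_modulus x = modulus x"
    unfolding modulus_def root_modulus_def by (subst cfc_pow_add[OF p]) auto
  show "star (modulus x) = modulus x" "star (root_modulus x) = root_modulus x"
    unfolding modulus_def root_modulus_def by (rule star_cfc_pow[OF p], simp)+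
  show "x * modulus x = modulus x * x" "x * root_modulus x = root_modulus x * x"
    unfolding modulus_def root_modulus_def by (rule cfc_pow_commute[OF p], simp, simp add: mult.assoc)+
qed

text \<open>Here \<open>s\<close> is twice the negative part of \<open>x = star a * a\<close>, so
  for \<open>c = a * s\<close> the element \<open>star c * c\<close> is minus a square. But
  \<open>c * star c + star c * c\<close> is a sum of squares of real and imaginary parts, which
  makes \<open>c * star c\<close> positive. Hence \<open>c = 0\<close> by the preceding comparison
  of the two products; then \<open>s = 0\<close>, and \<open>x\<close> equals its modulus.\<close>

theorem pos_star_mult: "pos (star a * a)"
proof -
  define x where "x = star a * a"
  have x: "star x = x" by (simp add: x_def star_mult star_star)
  define m where "m = modulus x"
  define g where "g = root_modulus x"
  note f = modulus_facts[OF x, folded m_def g_def]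
  define s where "s = m - x"
  have s: "star s = s" using f x by (simp add: s_def star_diff)
  have gm: "g * m = m * g" using f(2) by (metis mult.assoc)
  have gs: "g * s = s * g" using f(6) gm by (simp add: s_def algebra_simps)
  \<comment> \<open>Algebraic form of the statement that \<open>s\<close> lives where
    \<open>x = -m\<close>.\<close>
  have ms: "2 *\<^sub>R (m * s) = s * s" "2 *\<^sub>R (x * s) = - (s * s)"
    using f(1,5) by (simp_all add: s_def scaleR_2 algebra_simps)
  define v where "v = g * s"
  have v: "star v = v" using f(4) s gs by (simp add: v_def star_mult)
  have vv: "v * v = s * (m * s)"
    unfolding v_def by (metis f(2) gs mult.assoc)
  define c where "c = a * s"
  have cc: "star c * c = - (v * v)"
  proof -
    have "2 *\<^sub>R (star c * c) = 2 *\<^sub>R (s * (x * s))"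
      by (simp add: c_def star_mult s x_def mult.assoc)
    also have "\<dots> = s * (2 *\<^sub>R (x * s))" by simp
    also have "\<dots> = - (s * (2 *\<^sub>R (m * s)))" by (simp only: ms mult_minus_right)
    also have "\<dots> = 2 *\<^sub>R (- (v * v))" by (simp add: vv)
    finally show ?thesis by (rule scaleR_left_imp_eq[rotated]) simp
  qed
  have "spec_in ((*) (star c * c)) (- norm (v * v)) 0"
  proof -
    have "spec_in (pact [:0, -1:] ((*) (v * v))) (- norm (v * v)) 0"
      by (rule spec_in_pact[OF posD(2)[OF pos_square[OF v]] linear_mult_left]) auto
    moreover have "pact [:0, -1:] ((*) (v * v)) = (*) (star c * c)"
      by (rule ext) (simp add: pact_pCons[OF linear_mult_left] cc)
    ultimately show ?thesis by simp
  qed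
  moreover have "pos (c * star c)"
  proof -
    define e where "e = c + star c"
    define h where "h = scaleC \<i> (c - star c)"
    have "star e = e" "star h = h"
      by (simp_all add: e_def h_def star_add star_diff star_star star_scaleC scaleC_minus_left
          scaleC_diff_right)
    moreover have "c * star c = (1/2) *\<^sub>R (e * e + h * h) + v * v"
    proof -
      have "h * h = - ((c - star c) * (c - star c))"
        by (simp add: h_def mult_scaleC_left mult_scaleC_right scaleC_scaleC scaleC_minus_left scaleC_one)
      then have "e * e + h * h = 2 *\<^sub>R (c * star c + star c * c)"
        by (simp add: e_def scaleR_2 algebra_simps)
      then show ?thesis by (simp add: cc)
    qed
    ultimately show ?thesis
      using v by (auto intro!: pos_add pos_scaleR pos_square)
  qed
  ultimately have "c = 0" by (metis norm_ge_zero star_mult_neg_imp_zero)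
  then have "v = 0" using cc v square_eq_0_imp by simp
  then have "m * s = 0" unfolding v_def by (metis f(2) mult.assoc mult_zero_right)
  then have "s = 0" using ms(1) s square_eq_0_imp by simp
  then have "x = g * g" using f(2) by (simp add: s_def)
  then show ?thesis using pos_square[OF f(4)] by (simp add: x_def)
qed

lemma pos_iff_cpos: "pos x \<longleftrightarrow> cpos star x"
proof
  assume x: "pos x"
  have "x = star (cfc_pow x (1/2)) * cfc_pow x (1/2)"
    using x by (simp add: star_cfc_pow cfc_pow_add cfc_pow_1)
  then show "cpos star x" unfolding cpos_def by blast
qed (auto simp: cpos_def pos_star_mult)

lemma pos_cfc_pow:
  assumes x: "pos x" "p > 0"
  shows "pos (cfc_pow x p)"
proof -
  have "cfc_pow x p = cfc_pow x (p/2) * cfc_pow x (p/2)"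
    using x by (subst cfc_pow_add) auto
  then show ?thesis using pos_square star_cfc_pow[OF x(1), of "p/2"] x(2) by simp
qed

end

subsection \<open>Positive functionals and the centralizer\<close>

locale cstar_positive_functional = cstar_algebra scaleC star
  for scaleC :: "complex \<Rightarrow> 'a::{real_normed_algebra,banach} \<Rightarrow> 'a" and star :: "'a \<Rightarrow> 'a" +
  fixes \<phi> :: "'a \<Rightarrow> complex"
  assumes functional: "positive_functional scaleC star \<phi>"
begin

lemma phi_add: "\<phi> (x + y) = \<phi> x + \<phi> y"
  and phi_scaleC: "\<phi> (scaleC c x) = c * \<phi> x"
  and phi_star_mult: "0 \<le> \<phi> (star x * x)"
  using functional by (auto simp: positive_functional_def)

lemma phi_scaleR: "\<phi> (r *\<^sub>R x) = of_real r * \<phi> x"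
  using phi_scaleC[of "of_real r" x] by (simp add: scaleC_of_real)

lemma phi_0 [simp]: "\<phi> 0 = 0"
  using phi_scaleR[of 0 0] by simp

lemma phi_minus: "\<phi> (- x) = - \<phi> x"
  using phi_scaleR[of "-1" x] by simp

lemma phi_diff: "\<phi> (x - y) = \<phi> x - \<phi> y"
  using phi_add[of x "- y"] by (simp add: phi_minus)

lemma phi_pos: "pos x \<Longrightarrow> 0 \<le> \<phi> x"
  using phi_star_mult by (auto simp: pos_iff_cpos cpos_def)

text \<open>Automatic continuity. Otherwise there are \<open>a k\<close> in the unit ball with
  \<phi>-value of \<open>star (a k) * a k\<close> above \<open>4 ^ k\<close>. The series with
  weights \<open>(1/2) ^ k\<close> converges and dominates each of its terms, so \<phi> of its sum
  exceeds every \<open>2 ^ k\<close>.\<close>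

lemma phi_star_mult_bounded:
  obtains C where "0 \<le> C" "\<And>a. Re (\<phi> (star a * a)) \<le> C * (norm a)\<^sup>2"
proof (rule ccontr)
  assume "\<not> thesis"
  then have no: "\<exists>a. Re (\<phi> (star a * a)) > C * (norm a)\<^sup>2" if "0 \<le> C" for C
    using that \<open>\<And>C. 0 \<le> C \<Longrightarrow> (\<And>a. Re (\<phi> (star a * a)) \<le> C * (norm a)\<^sup>2) \<Longrightarrow> thesis\<close>
    by (meson not_le)
  have "\<exists>a. norm a \<le> 1 \<and> Re (\<phi> (star a * a)) > 4 ^ k" for k :: nat
  proof -
    obtain a where a: "Re (\<phi> (star a * a)) > 4 ^ k * (norm a)\<^sup>2" using no[of "4 ^ k"] by auto
    have "a \<noteq> 0" using a by auto
    define a' where "a' = inverse (norm a) *\<^sub>R a"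
    have "star a' * a' = (inverse (norm a))\<^sup>2 *\<^sub>R (star a * a)"
      by (simp add: a'_def star_scaleR power2_eq_square)
    then have "Re (\<phi> (star a' * a')) = Re (\<phi> (star a * a)) / (norm a)\<^sup>2"
      by (simp add: phi_scaleR power_inverse divide_inverse mult.commute del: of_real_inverse of_real_power)
    also have "\<dots> > 4 ^ k" using a \<open>a \<noteq> 0\<close> by (simp add: field_simps)
    finally show ?thesis using \<open>a \<noteq> 0\<close> by (intro exI[of _ a']) (simp add: a'_def)
  qed
  then obtain a where a: "\<And>k. norm (a k) \<le> 1" "\<And>k. Re (\<phi> (star (a k) * a k)) > 4 ^ k" by metis
  define f where "f k = (1/2) ^ k *\<^sub>R (star (a k) * a k)" for k
  have posf: "pos (f k)" for k unfolding f_def by (intro pos_scaleR pos_star_mult) simp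
  have "norm (f k) \<le> (1/2) ^ k" for k
    using a(1)[of k] by (simp add: f_def cstar_identity power_le_one)
  then have "summable f"
    by (intro summable_comparison_test'[OF summable_geometric[of "1/2::real"]]) auto
  then have lim: "(\<lambda>n. \<Sum>i<n. f i) \<longlonglongrightarrow> suminf f" by (rule summable_LIMSEQ)
  have "2 ^ k \<le> Re (\<phi> (suminf f))" for k
  proof -
    have "(\<lambda>n. (\<Sum>i<n + Suc k. f i) - f k) \<longlonglongrightarrow> suminf f - f k"
      by (intro tendsto_intros LIMSEQ_ignore_initial_segment lim)
    moreover have "pos ((\<Sum>i<n + Suc k. f i) - f k)" for n
    proof -
      have "(\<Sum>i<n + Suc k. f i) = f k + (\<Sum>i\<in>{..<n + Suc k} - {k}. f i)"
        by (rule sum.remove) auto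
      then show ?thesis by (simp add: pos_sum posf)
    qed
    ultimately have "pos (suminf f - f k)" by (metis (no_types, lifting) pos_limit)
    then have "Re (\<phi> (f k)) \<le> Re (\<phi> (suminf f))"
      using phi_pos[of "suminf f - f k"] by (simp add: phi_diff less_eq_complex_def)
    moreover have "2 ^ k \<le> Re (\<phi> (f k))"
    proof -
      have "(1/2) ^ k * (4::real) ^ k = 2 ^ k" by (simp add: power_mult_distrib[symmetric])
      then show ?thesis
        using mult_left_mono[OF less_imp_le[OF a(2)[of k]], of "(1/2) ^ k"]
        by (simp add: f_def phi_scaleR del: of_real_power of_real_divide)
    qed
    ultimately show ?thesis by linarith
  qed
  moreover obtain k where "Re (\<phi> (suminf f)) < 2 ^ k"
    using real_arch_pow[of 2] by auto
  ultimately show False by (meson not_le)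
qed

text \<open>Polarization: \<phi> is real on \<open>star x * x\<close> for \<open>x = a + b\<close>
  and for \<open>x = a + i b\<close>.\<close>

lemma phi_star_swap: "\<phi> (star b * a) = cnj (\<phi> (star a * b))"
proof -
  have "Im (\<phi> (star x * x)) = 0" for x using phi_star_mult[of x] by (simp add: less_eq_complex_def)
  from this[of "a + b"] this[of "a + scaleC \<i> b"] this[of a] this[of b] show ?thesis
    by (simp add: complex_eq_iff star_add star_scaleC algebra_simps phi_add phi_scaleC
        mult_scaleC_left mult_scaleC_right scaleC_minus_left phi_minus scaleC_scaleC scaleC_one
        scaleC_minus_right phi_diff)
qed

lemma phi_Cauchy_Schwarz:
  "(cmod (\<phi> (star a * b)))\<^sup>2 \<le> Re (\<phi> (star a * a)) * Re (\<phi> (star b * b))"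
proof -
  define A B z where "A = Re (\<phi> (star a * a))" and "B = Re (\<phi> (star b * b))" and "z = \<phi> (star a * b)"
  have "A \<ge> 0" "B \<ge> 0" using phi_star_mult by (auto simp: A_def B_def less_eq_complex_def)
  have q: "0 \<le> A - 2 * t * (cmod z)\<^sup>2 + t\<^sup>2 * (cmod z)\<^sup>2 * B" for t
  proof -
    \<comment> \<open>The phase of \<open>w\<close> makes both cross terms equal to the real number
      \<open>- t * (cmod z)^2\<close>, leaving a real polynomial in \<open>t\<close>.\<close>
    define w where "w = - (of_real t * cnj z)"
    have "\<phi> (star (a + scaleC w b) * (a + scaleC w b)) =
        \<phi> (star a * a) + w * z + cnj w * cnj z + cnj w * w * \<phi> (star b * b)"
      by (simp add: z_def star_add star_scaleC distrib_left distrib_right phi_add phi_scaleC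
          mult_scaleC_left mult_scaleC_right scaleC_scaleC phi_star_swap[of b a] scaleC_add_right algebra_simps)
    moreover have "w * z = - of_real (t * (cmod z)\<^sup>2)" "cnj w * cnj z = - of_real (t * (cmod z)\<^sup>2)"
      "cnj w * w = of_real (t\<^sup>2 * (cmod z)\<^sup>2)"
    proof -
      have "w * z = - (of_real t * (z * cnj z))" "cnj w * cnj z = - (of_real t * (z * cnj z))"
        "cnj w * w = of_real (t\<^sup>2) * (z * cnj z)"
        by (simp_all add: w_def power2_eq_square)
      then show "w * z = - of_real (t * (cmod z)\<^sup>2)" "cnj w * cnj z = - of_real (t * (cmod z)\<^sup>2)"
        "cnj w * w = of_real (t\<^sup>2 * (cmod z)\<^sup>2)"
        by (simp_all only: of_real_mult complex_norm_square)
    qed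
    ultimately have "Re (\<phi> (star (a + scaleC w b) * (a + scaleC w b))) =
        A - 2 * t * (cmod z)\<^sup>2 + t\<^sup>2 * (cmod z)\<^sup>2 * B"
      by (simp add: A_def B_def del: of_real_mult of_real_power)
    then show ?thesis using phi_star_mult[of "a + scaleC w b"] by (simp add: less_eq_complex_def)
  qed
  show ?thesis
  proof (cases "B = 0")
    case True
    have "(cmod z)\<^sup>2 \<le> 0"
    proof (rule ccontr)
      assume "\<not> (cmod z)\<^sup>2 \<le> 0"
      \<comment> \<open>For \<open>B = 0\<close> the polynomial is affine in \<open>t\<close>, and
        at this value it equals -1.\<close>
      then show False using q[of "(A + 1) / (2 * (cmod z)\<^sup>2)"] True by simp
    qed
    then show ?thesis using True by (simp add: z_def B_def)
  next
    case False
    then have "B > 0" using \<open>B \<ge> 0\<close> by simp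
    have "0 \<le> A - (cmod z)\<^sup>2 / B"
      using q[of "1 / B"] \<open>B > 0\<close> by (simp add: power2_eq_square field_simps)
    then show ?thesis using \<open>B > 0\<close> by (simp add: field_simps A_def B_def z_def)
  qed
qed

lemma phi_star_mult_eq_0:
  assumes "\<phi> (star a * a) = 0"
  shows "\<phi> (star a * b) = 0"
  using phi_Cauchy_Schwarz[of a b] assms by simp

text \<open>Cauchy-Schwarz turns the bound on \<open>star a * a\<close> into one on arbitrary
  products. This bilinear form of continuity is the one used in all later limits.\<close>

lemma phi_mult_bounded:
  obtains C where "0 \<le> C" "\<And>a b. cmod (\<phi> (a * b)) \<le> C * norm a * norm b"
proof -
  obtain C where C: "0 \<le> C" "\<And>a. Re (\<phi> (star a * a)) \<le> C * (norm a)\<^sup>2"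
    using phi_star_mult_bounded by blast
  have "cmod (\<phi> (a * b)) \<le> C * norm a * norm b" for a b
  proof (rule power2_le_imp_le)
    have "(cmod (\<phi> (a * b)))\<^sup>2 \<le> Re (\<phi> (star (star a) * star a)) * Re (\<phi> (star b * b))"
      using phi_Cauchy_Schwarz[of "star a" b] by (simp add: star_star)
    also have "\<dots> \<le> (C * (norm (star a))\<^sup>2) * (C * (norm b)\<^sup>2)"
      by (intro mult_mono C) (use C phi_star_mult in \<open>auto simp: less_eq_complex_def\<close>)
    finally show "(cmod (\<phi> (a * b)))\<^sup>2 \<le> (C * norm a * norm b)\<^sup>2"
      by (simp add: power_mult_distrib power2_eq_square ac_simps)
  qed (use C in auto)
  with C that show ?thesis by blast
qed

lemma bounded_linear_phi_mult:
  "bounded_linear (\<lambda>y. \<phi> (x * y))" "bounded_linear (\<lambda>y. \<phi> (y * x))"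
proof -
  obtain C where C: "0 \<le> C" "\<And>a b. cmod (\<phi> (a * b)) \<le> C * norm a * norm b"
    using phi_mult_bounded by blast
  show "bounded_linear (\<lambda>y. \<phi> (x * y))"
    by (rule bounded_linear_intro[where K = "C * norm x"])
      (use C(2)[of x] in \<open>auto simp: distrib_left phi_add phi_scaleR scaleR_conv_of_real mult.commute\<close>)
  show "bounded_linear (\<lambda>y. \<phi> (y * x))"
    by (rule bounded_linear_intro[where K = "C * norm x"])
      (use C(2)[of _ x] in \<open>auto simp: distrib_right phi_add phi_scaleR scaleR_conv_of_real ac_simps\<close>)
qed

section \<open>The centralizer and the order that \<phi> induces\<close>

abbreviation Z :: "'a set" where "Z \<equiv> centralizer \<phi>"

lemma ZD: "y \<in> Z \<Longrightarrow> \<phi> (x * y) = \<phi> (y * x)"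
  by (simp add: centralizer_def)

lemma Z_0 [simp]: "0 \<in> Z" by (simp add: centralizer_def)

lemma Z_add: "y \<in> Z \<Longrightarrow> z \<in> Z \<Longrightarrow> y + z \<in> Z"
  by (simp add: centralizer_def distrib_left distrib_right phi_add)

lemma Z_scaleR: "y \<in> Z \<Longrightarrow> r *\<^sub>R y \<in> Z"
  by (simp add: centralizer_def phi_scaleR)

lemma Z_diff: "y \<in> Z \<Longrightarrow> z \<in> Z \<Longrightarrow> y - z \<in> Z"
  using Z_add[of y "(-1) *\<^sub>R z"] Z_scaleR[of z "-1"] by simp

lemma Z_mult:
  assumes "y \<in> Z" "z \<in> Z"
  shows "y * z \<in> Z"
  unfolding centralizer_def
proof (intro CollectI allI)
  fix x
  have "\<phi> (x * (y * z)) = \<phi> (z * x * y)" using ZD[OF assms(2), of "x * y"] by (simp add: mult.assoc)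
  also have "\<dots> = \<phi> (y * z * x)" using ZD[OF assms(1), of "z * x"] by (simp add: mult.assoc)
  finally show "\<phi> (x * (y * z)) = \<phi> (y * z * x)" .
qed

lemma closed_Z: "closed Z"
  unfolding centralizer_def
  by (intro closed_Collect_all closed_Collect_eq linear_continuous_on bounded_linear_phi_mult)

lemma Z_cfc_pow: "pos x \<Longrightarrow> p > 0 \<Longrightarrow> x \<in> Z \<Longrightarrow> cfc_pow x p \<in> Z"
  by (intro cfc_pow_in_closed closed_Z polyev_in Z_mult Z_add Z_scaleR) auto

lemma phi_conj_pos:
  assumes "pos a" "star k = k"
  shows "0 \<le> \<phi> (k * a * k)"
proof -
  obtain r where "a = star r * r" using assms(1) by (auto simp: pos_iff_cpos cpos_def)
  then show ?thesis
    using phi_star_mult[of "r * k"] assms(2) by (simp add: star_mult mult.assoc)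
qed

text \<open>The trace of an operator inequality that \<phi> can detect: compressions are by
  self-adjoint elements of the centralizer only, so null directions of \<phi> are ignored.\<close>

definition zpos :: "'a \<Rightarrow> bool" where
  "zpos d \<longleftrightarrow> (\<forall>c\<in>Z. star c = c \<longrightarrow> 0 \<le> \<phi> (c * d * c))"

lemma zposD: "zpos d \<Longrightarrow> c \<in> Z \<Longrightarrow> star c = c \<Longrightarrow> 0 \<le> \<phi> (c * d * c)"
  by (simp add: zpos_def)

lemma zpos_pos: "pos d \<Longrightarrow> zpos d"
  by (simp add: zpos_def phi_conj_pos)

lemma zpos_add: "zpos d \<Longrightarrow> zpos e \<Longrightarrow> zpos (d + e)"
  by (simp add: zpos_def distrib_left distrib_right phi_add)

lemma zpos_scaleR: "zpos d \<Longrightarrow> 0 \<le> r \<Longrightarrow> zpos (r *\<^sub>R d)"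
  by (simp add: zpos_def phi_scaleR less_eq_complex_def)

text \<open>Operator monotonicity of the square root. With \<open>d = a - b\<close> and \<open>D = |d| + d\<close> twice its
  positive part, the hypothesis tested against \<open>D\<close> forces \<open>\<phi> (D\<^sup>4) = 0\<close>.\<close>

lemma zpos_sqrt_mono:
  assumes a: "pos a" "a \<in> Z" and b: "pos b" "b \<in> Z" and le: "zpos (b * b - a * a)"
  shows "zpos (b - a)"
proof -
  define d where "d = a - b"
  have d: "star d = d" "d \<in> Z" using a b by (auto simp: d_def star_diff posD Z_diff)
  define m where "m = modulus d"
  define g where "g = root_modulus d"
  note f = modulus_facts[OF d(1), folded m_def g_def]
  have pdd: "pos (d * d)" by (rule pos_square[OF d(1)])
  have mgZ: "m \<in> Z" "g \<in> Z"
    unfolding m_def g_def modulus_def root_modulus_def by (intro Z_cfc_pow pdd Z_mult d; simp)+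
  define D where "D = m + d"
  have D: "star D = D" "D \<in> Z" using f d mgZ by (auto simp: D_def star_add Z_add)
  have dD: "d * D = D * d" using f(5) by (simp add: D_def algebra_simps)
  have mD: "m * D = d * D" "2 *\<^sub>R (d * D) = D * D"
    using f(1,5) by (simp_all add: D_def scaleR_2 algebra_simps)
  have gm: "g * m = m * g" using f(2) by (metis mult.assoc)
  have gD: "g * D = D * g" using f(6) gm by (simp add: D_def algebra_simps)
  \<comment> \<open>Since \<open>m\<close> and \<open>d\<close> agree on \<open>D\<close>,
    \<open>k * k = d * D * D\<close>: an indefinite expression in \<open>d\<close> becomes a square
    whose halves can be placed on both sides of \<open>a\<close> or \<open>b\<close>.\<close>
  define k where "k = g * D"
  have k: "star k = k" "k \<in> Z" using f(4) D gD mgZ by (auto simp: k_def star_mult Z_mult)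
  have kk: "k * k = d * D * D" "k * k = D * D * d"
  proof -
    have "k * k = D * (m * D)" unfolding k_def by (metis f(2) gD mult.assoc)
    then show "k * k = d * D * D" "k * k = D * D * d" by (metis mD(1) dD mult.assoc)+
  qed
  \<comment> \<open>\<open>b * b - a * a = - (a * d + d * b)\<close>, with \<open>a\<close> on the
    left of \<open>d\<close> and \<open>b\<close> on the right. Rotating under \<phi> turns the two
    terms into compressions of \<open>a\<close> and \<open>b\<close> by \<open>k\<close>.\<close>
  have "\<phi> (D * (b * b - a * a) * D) = - (\<phi> (D * (a * d * D)) + \<phi> ((D * d * b) * D))"
    by (simp add: d_def algebra_simps phi_add phi_diff)
  also have "\<phi> (D * (a * d * D)) = \<phi> (k * a * k)"
  proof -
    have "\<phi> (D * (a * d * D)) = \<phi> (a * d * D * D)" using ZD[OF D(2)] by simp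
    also have "\<dots> = \<phi> (a * k * k)" using kk(1) by (simp add: mult.assoc)
    also have "\<dots> = \<phi> (k * a * k)" using ZD[OF k(2), of "a * k"] by (simp add: mult.assoc)
    finally show ?thesis .
  qed
  also have "\<phi> ((D * d * b) * D) = \<phi> (k * b * k)"
  proof -
    have "\<phi> ((D * d * b) * D) = \<phi> (D * (D * d * b))" using ZD[OF D(2)] by simp
    also have "\<dots> = \<phi> (k * (k * b))" using kk(2) by (simp add: mult.assoc[symmetric])
    also have "\<dots> = \<phi> (k * b * k)" using ZD[OF k(2), of "k * b"] by simp
    finally show ?thesis .
  qed
  finally have "0 \<le> - (\<phi> (k * a * k) + \<phi> (k * b * k))" using zposD[OF le D(2,1)] by simp
  moreover have "0 \<le> \<phi> (k * a * k)" "0 \<le> \<phi> (k * b * k)"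
    using phi_conj_pos k a b by auto
  ultimately have "\<phi> (k * a * k) = 0" "\<phi> (k * b * k) = 0"
    by (auto simp: less_eq_complex_def complex_eq_iff)
  \<comment> \<open>By \<open>k * k = D * D * d\<close> and commutation this is \<phi> of the square
    of \<open>d * D\<close>, a quarter of \<phi> of the fourth power of \<open>D\<close>.\<close>
  then have "\<phi> (k * d * k) = 0" by (simp add: d_def algebra_simps phi_diff)
  then have "\<phi> (k * k * d) = 0" using ZD[OF k(2), of "k * d"] by (simp add: mult.assoc)
  then have "\<phi> ((d * D) * (d * D)) = 0" using kk(1) dD by (metis mult.assoc)
  moreover have "(D * D) * (D * D) = (2 *\<^sub>R (d * D)) * (2 *\<^sub>R (d * D))"
    by (simp only: mD(2))
  then have "(D * D) * (D * D) = 4 *\<^sub>R ((d * D) * (d * D))" by simp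
  ultimately have "\<phi> ((D * D) * (D * D)) = 0" by (simp add: phi_scaleR)
  then have DD: "\<phi> (D * D * x) = 0" for x
    using phi_star_mult_eq_0[of "D * D" x] D by (simp add: star_mult)
  show ?thesis
    unfolding zpos_def
  proof (intro ballI impI)
    fix c assume c: "c \<in> Z" "star c = c"
    have "\<phi> (star (D * c) * (D * c)) = \<phi> (c * (D * D * c))"
      using c D by (simp add: star_mult mult.assoc)
    also have "\<dots> = \<phi> (D * D * (c * c))"
      using ZD[OF c(1), of "D * D * c"] by (simp add: mult.assoc)
    finally have "\<phi> (star (D * c) * c) = 0" using DD phi_star_mult_eq_0 by simp
    then have "\<phi> (c * D * c) = 0" using c D by (simp add: star_mult)
    \<comment> \<open>\<phi> does not see the compressions of \<open>D\<close>, so under \<phi>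
      those of \<open>b - a\<close> coincide with those of the modulus, which is positive.\<close>
    moreover have "b - a = m - D" by (simp add: D_def d_def)
    ultimately have "\<phi> (c * (b - a) * c) = \<phi> (c * m * c)"
      by (simp only: right_diff_distrib left_diff_distrib phi_diff diff_zero)
    then show "0 \<le> \<phi> (c * (b - a) * c)"
      using phi_conj_pos[OF pos_square[OF f(4)] c(2)] f(2) by simp
  qed
qed

lemma zpos_dyadic_root_mono:
  assumes x: "pos x" "x \<in> Z" and y: "pos y" "y \<in> Z" and le: "zpos (y - x)"
  shows "zpos (cfc_pow y ((1/2) ^ k) - cfc_pow x ((1/2) ^ k))"
proof (induction k)
  case 0
  then show ?case using x y le by (simp add: cfc_pow_1)
next
  case (Suc k)
  have sq: "cfc_pow z ((1/2) ^ Suc k) * cfc_pow z ((1/2) ^ Suc k) = cfc_pow z ((1/2) ^ k)" if "pos z" for z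
    using cfc_pow_add[OF that, of "(1/2) ^ Suc k" "(1/2) ^ Suc k"] by simp
  have p: "(1/2 :: real) ^ Suc k > 0" by simp
  show ?case
    by (rule zpos_sqrt_mono) (simp_all only: sq x y Suc pos_cfc_pow Z_cfc_pow p)
qed

end

subsection \<open>Monotonicity of traces of powers\<close>

lemma lprod_Cons: "ys \<noteq> [] \<Longrightarrow> lprod (a # ys) = a * lprod ys"
  by (cases ys) auto

lemma lprod_append:
  fixes xs ys :: "'a::semigroup_mult list"
  shows "xs \<noteq> [] \<Longrightarrow> ys \<noteq> [] \<Longrightarrow> lprod (xs @ ys) = lprod xs * lprod ys"
proof (induction xs)
  case (Cons a xs)
  then show ?case by (cases "xs = []") (simp_all add: lprod_Cons mult.assoc)
qed simp

lemma lprod_merge: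
  fixes a b :: "'a::semigroup_mult"
  shows "lprod (xs @ a # b # ys) = lprod (xs @ (a * b) # ys)"
proof -
  have "lprod (a # b # ys) = lprod ((a * b) # ys)"
    by (cases "ys = []") (simp_all add: lprod_Cons mult.assoc)
  then show ?thesis by (cases "xs = []") (simp_all add: lprod_append)
qed

lemma lprod_diff:
  fixes a b :: "'a::ring"
  shows "lprod (xs @ (a - b) # ys) = lprod (xs @ a # ys) - lprod (xs @ b # ys)"
proof -
  have "lprod ((a - b) # ys) = lprod (a # ys) - lprod (b # ys)"
    by (cases "ys = []") (simp_all add: lprod_Cons left_diff_distrib)
  then show ?thesis by (cases "xs = []") (simp_all add: lprod_append right_diff_distrib)
qed

lemma lprod_replicate_square:
  fixes a :: "'a::semigroup_mult"
  shows "lprod (replicate (2 * Suc n) a) = lprod (replicate (Suc n) (a * a))"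
proof (induction n)
  case (Suc n)
  have "lprod (replicate (2 * Suc (Suc n)) a) = a * (a * lprod (replicate (2 * Suc n) a))"
    by (simp add: lprod_Cons)
  then show ?case by (simp only: Suc) (simp add: lprod_Cons mult.assoc)
qed (simp add: numeral_2_eq_2)

text \<open>Increments of a convex sequence do not decrease, so a non-positive last increment forces
  all of them to be non-positive.\<close>

lemma convex_seq_le:
  fixes a :: "nat \<Rightarrow> real"
  assumes convex: "\<And>j. j + 2 \<le> N \<Longrightarrow> 0 \<le> a (j + 2) - 2 * a (j + 1) + a j"
    and last: "a N \<le> a (N - 1)"
  shows "a N \<le> a 0"
proof -
  have step: "a (N - i) \<le> a (N - Suc i)" if "i < N" for i
    using that
  proof (induction i)
    case (Suc i)
    define j where "j = N - Suc (Suc i)"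
    have j: "N - i = j + 2" "N - Suc i = j + 1" using Suc.prems by (auto simp: j_def)
    have "a (j + 2) \<le> a (j + 1)" using Suc unfolding j by simp
    moreover have "j + 2 \<le> N" unfolding j(1)[symmetric] by simp
    ultimately have "a (j + 1) \<le> a j" using convex[of j] by linarith
    then show ?case by (simp add: j) (simp add: j_def)
  qed (use last in simp)
  have "a N \<le> a (N - i)" if "i \<le> N" for i
    using that
  proof (induction i)
    case (Suc i)
    then show ?case using step[of i] by simp
  qed simp
  from this[of N] show ?thesis by simp
qed

context cstar_positive_functional
begin

lemma star_lprod: "xs \<noteq> [] \<Longrightarrow> star (lprod xs) = lprod (rev (map star xs))"
proof (induction xs)
  case (Cons a xs)
  then show ?case by (cases "xs = []") (simp_all add: lprod_Cons lprod_append star_mult)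
qed simp

lemma Z_lprod: "xs \<noteq> [] \<Longrightarrow> set xs \<subseteq> Z \<Longrightarrow> lprod xs \<in> Z"
proof (induction xs)
  case (Cons a xs)
  then show ?case by (cases "xs = []") (simp_all add: lprod_Cons Z_mult)
qed simp

lemma phi_lprod_rotate: "set ys \<subseteq> Z \<Longrightarrow> \<phi> (lprod (xs @ ys)) = \<phi> (lprod (ys @ xs))"
  using ZD[OF Z_lprod, of ys "lprod xs"]
  by (cases "xs = []"; cases "ys = []") (simp_all add: lprod_append)

lemma phi_lprod_palindrome:
  assumes "xs \<noteq> []" "\<And>x. x \<in> set xs \<Longrightarrow> star x = x"
  shows "0 \<le> \<phi> (lprod (rev xs @ xs))"
proof -
  have "map star xs = xs" using assms(2) by (simp add: map_idI)
  then have "lprod (rev xs @ xs) = star (lprod xs) * lprod xs"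
    using assms(1) by (simp add: lprod_append star_lprod)
  then show ?thesis using phi_star_mult by simp
qed

text \<open>The numbers \<open>\<phi> (A\<^sup>j B\<^sup>N\<^sup>-\<^sup>j)\<close> form a convex sequence in \<open>j\<close>: its second
  difference is \<open>\<phi> (A\<^sup>j (B - A) B\<^sup>l (B - A))\<close> with \<open>l = N - j - 2\<close>.\<close>

lemma phi_power_mono:
  assumes \<alpha>: "\<alpha> \<in> Z" "star \<alpha> = \<alpha>" and \<beta>: "\<beta> \<in> Z" "star \<beta> = \<beta>"
    and le: "zpos (\<beta> * \<beta> - \<alpha> * \<alpha>)" and N: "2 \<le> N"
  shows "Re (\<phi> (lprod (replicate N (\<alpha> * \<alpha>)))) \<le> Re (\<phi> (lprod (replicate N (\<beta> * \<beta>))))"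
proof -
  define D where "D = \<beta> * \<beta> - \<alpha> * \<alpha>"
  have D: "D \<in> Z" "star D = D"
    using \<alpha> \<beta> by (simp_all add: D_def Z_diff Z_mult star_diff star_mult)
  \<comment> \<open>Words in the square roots \<alpha> and \<beta>, not in \<open>A\<close> and
    \<open>B\<close>: even powers can then be cut in the middle to form palindromes.\<close>
  define w where "w i j = \<phi> (lprod (replicate i \<alpha> @ replicate j \<beta>))" for i j
  have lD: "lprod (xs @ D # ys) = lprod (xs @ \<beta> # \<beta> # ys) - lprod (xs @ \<alpha> # \<alpha> # ys)" for xs ys
    by (simp add: D_def lprod_diff lprod_merge)
  have \<beta>\<beta>: "\<phi> (lprod (\<beta> # \<beta> # replicate i \<alpha> @ replicate j \<beta>)) = w i (j + 2)" for i j
  proof -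
    have "replicate (j + 2) \<beta> = replicate j \<beta> @ [\<beta>, \<beta>]"
      by (simp only: replicate_add) (simp add: numeral_eq_Suc)
    then have "w i (j + 2) = \<phi> (lprod ((replicate i \<alpha> @ replicate j \<beta>) @ [\<beta>, \<beta>]))"
      by (simp only: w_def append_assoc)
    also have "\<dots> = \<phi> (lprod ([\<beta>, \<beta>] @ replicate i \<alpha> @ replicate j \<beta>))"
      using \<beta> by (intro phi_lprod_rotate) auto
    finally show ?thesis by (simp only: append.simps)
  qed
  define a where "a j = Re (w (2 * j) (2 * (N - j)))" for j
  have "a N \<le> a 0"
  proof (rule convex_seq_le)
    fix j assume j: "j + 2 \<le> N"
    define l where "l = N - j - 2"
    have jl: "N - j = l + 2" "N - (j + 1) = l + 1" "N - (j + 2) = l" using j by (auto simp: l_def)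
    \<comment> \<open>\<open>rev ?xs @ ?xs\<close> reads
      \<open>\<beta>^l D \<alpha>^(2j) D \<beta>^l\<close>; rotating one block
      \<open>\<beta>^l\<close> under \<phi> gives the second difference.\<close>
    let ?xs = "replicate j \<alpha> @ D # replicate l \<beta>"
    have "0 \<le> \<phi> (lprod (rev ?xs @ ?xs))"
      using \<alpha> \<beta> D by (intro phi_lprod_palindrome) auto
    also have "\<phi> (lprod (rev ?xs @ ?xs)) =
        \<phi> (lprod (replicate l \<beta> @ (D # replicate (2 * j) \<alpha> @ D # replicate l \<beta>)))"
      by (simp add: mult_2 replicate_add)
    also have "\<dots> = \<phi> (lprod ((D # replicate (2 * j) \<alpha> @ D # replicate l \<beta>) @ replicate l \<beta>))"
      using \<alpha> \<beta> D by (intro phi_lprod_rotate) auto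
    also have "\<dots> = \<phi> (lprod ([] @ D # replicate (2 * j) \<alpha> @ D # replicate (2 * l) \<beta>))"
      by (simp add: mult_2 replicate_add)
    also have "\<dots> = \<phi> (lprod ((\<beta> # \<beta> # replicate (2 * j) \<alpha>) @ D # replicate (2 * l) \<beta>))
        - \<phi> (lprod ((\<alpha> # \<alpha> # replicate (2 * j) \<alpha>) @ D # replicate (2 * l) \<beta>))"
      unfolding lD[of "[]"] phi_diff by simp
    also have "\<dots> = w (2 * j) (2 * l + 4) - w (2 * j + 2) (2 * l + 2) - (w (2 * j + 2) (2 * l + 2) - w (2 * j + 4) (2 * l))"
    proof -
      have e1: "(\<beta> # \<beta> # replicate (2 * j) \<alpha>) @ \<beta> # \<beta> # replicate (2 * l) \<beta> =
          \<beta> # \<beta> # replicate (2 * j) \<alpha> @ replicate (2 * l + 2) \<beta>" by simp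
      have e2: "(\<beta> # \<beta> # replicate (2 * j) \<alpha>) @ \<alpha> # \<alpha> # replicate (2 * l) \<beta> =
          \<beta> # \<beta> # replicate (2 * j + 2) \<alpha> @ replicate (2 * l) \<beta>"
        by (simp add: replicate_app_Cons_same)
      have e3: "(\<alpha> # \<alpha> # replicate (2 * j) \<alpha>) @ \<beta> # \<beta> # replicate (2 * l) \<beta> =
          replicate (2 * j + 2) \<alpha> @ replicate (2 * l + 2) \<beta>" by simp
      have e4: "(\<alpha> # \<alpha> # replicate (2 * j) \<alpha>) @ \<alpha> # \<alpha> # replicate (2 * l) \<beta> =
          replicate (2 * j + 4) \<alpha> @ replicate (2 * l) \<beta>"
        by (simp add: replicate_app_Cons_same numeral_eq_Suc)
      show ?thesis unfolding lD phi_diff e1 e2 e3 e4 \<beta>\<beta> w_def[symmetric] by (simp add: numeral_eq_Suc)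
    qed
    finally have "0 \<le> w (2 * j) (2 * l + 4) - w (2 * j + 2) (2 * l + 2) - (w (2 * j + 2) (2 * l + 2) - w (2 * j + 4) (2 * l))" .
    moreover have "a (j + 2) = Re (w (2 * j + 4) (2 * l))" "a (j + 1) = Re (w (2 * j + 2) (2 * l + 2))"
      "a j = Re (w (2 * j) (2 * l + 4))"
      unfolding a_def jl distrib_left by simp_all
    ultimately show "0 \<le> a (j + 2) - 2 * a (j + 1) + a j"
      by (simp only: less_eq_complex_def minus_complex.sel zero_complex.sel) linarith
  next
    obtain n where n: "N = Suc (Suc n)" using N by (metis add_2_eq_Suc le_Suc_ex)
    \<comment> \<open>Here \<open>c = \<alpha>^(N - 1)\<close>, and
      \<open>\<phi> (c * D * c)\<close> is the difference \<open>a (N - 1) - a N\<close>. This end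
      point is where the hypothesis on the order enters.\<close>
    define c where "c = lprod (replicate (Suc n) \<alpha>)"
    have c: "c \<in> Z" "star c = c"
      unfolding c_def using \<alpha> by (auto intro!: Z_lprod simp: star_lprod simp del: replicate_Suc)
    have "0 \<le> \<phi> (c * D * c)" using zposD[OF le[folded D_def] c] .
    also have "c * D * c = lprod (replicate (Suc n) \<alpha> @ (D # replicate (Suc n) \<alpha>))"
      unfolding c_def by (subst lprod_append) (simp_all add: lprod_Cons mult.assoc)
    also have "\<phi> \<dots> = \<phi> (lprod ((replicate (Suc n) \<alpha> @ [D]) @ replicate (Suc n) \<alpha>))" by simp
    also have "\<dots> = \<phi> (lprod (replicate (Suc n) \<alpha> @ replicate (Suc n) \<alpha> @ [D]))"
      using \<alpha> by (intro phi_lprod_rotate) auto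
    also have "\<dots> = \<phi> (lprod (replicate (2 * Suc n) \<alpha> @ [D]))"
      by (simp only: mult_2 replicate_add append_assoc)
    also have "\<dots> = w (2 * Suc n) 2 - w (2 * Suc n + 2) 0"
    proof -
      have e1: "replicate (2 * Suc n) \<alpha> @ [\<beta>, \<beta>] = replicate (2 * Suc n) \<alpha> @ replicate 2 \<beta>"
        by (simp add: numeral_eq_Suc)
      have e2: "replicate (2 * Suc n) \<alpha> @ [\<alpha>, \<alpha>] = replicate (2 * Suc n + 2) \<alpha> @ replicate 0 \<beta>"
        by (simp only: replicate_add) (simp add: numeral_eq_Suc)
      show ?thesis unfolding lD phi_diff e1 e2 w_def ..
    qed
    finally show "a N \<le> a (N - 1)" by (simp add: a_def n less_eq_complex_def)
  qed
  moreover have "a 0 = Re (\<phi> (lprod (replicate N (\<beta> * \<beta>))))" "a N = Re (\<phi> (lprod (replicate N (\<alpha> * \<alpha>))))"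
    using N lprod_replicate_square[of "N - 1" \<alpha>] lprod_replicate_square[of "N - 1" \<beta>]
    by (simp_all add: a_def w_def)
  ultimately show ?thesis by simp
qed

end

subsection \<open>Power means converge to geometric means\<close>

text \<open>The variance of the relative frequency in \<open>n\<close> trials, the input for
  Chebyshev's inequality.\<close>

lemma sum_Bernstein_variance:
  assumes "n > 0"
  shows "(\<Sum>k\<le>n. (x - real k / real n)\<^sup>2 * Bernstein n k x) = x * (1 - x) / real n"
proof -
  have "(x - real k / real n)\<^sup>2 * Bernstein n k x = x\<^sup>2 * Bernstein n k x
      + (1 / real n ^ 2 - 2 * x / real n) * (real k * Bernstein n k x)
      + 1 / real n ^ 2 * (real k * (real k - 1) * Bernstein n k x)" for k
    using assms by (simp add: power2_eq_square field_simps)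
  then have "(\<Sum>k\<le>n. (x - real k / real n)\<^sup>2 * Bernstein n k x) =
      x\<^sup>2 * 1 + (1 / real n ^ 2 - 2 * x / real n) * (real n * x)
      + 1 / real n ^ 2 * (real n * (real n - 1) * x\<^sup>2)"
    by (simp only: sum.distrib sum_distrib_left[symmetric] sum_Bernstein sum_k_Bernstein sum_kk_Bernstein)
  also have "\<dots> = x * (1 - x) / real n"
    using assms by (simp add: power2_eq_square field_simps)
  finally show ?thesis .
qed

lemma operator_binomial:
  fixes u v :: "'a::real_vector \<Rightarrow> 'a"
  assumes u: "linear u" and v: "linear v" and uv: "\<And>b. u (v b) = v (u b)"
  shows "((\<lambda>b. u b + v b) ^^ n) c = (\<Sum>k\<le>n. real (n choose k) *\<^sub>R (u ^^ k) ((v ^^ (n - k)) c))"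
proof (induction n)
  case (Suc n)
  define t where "t k = (u ^^ k) ((v ^^ (Suc n - k)) c)" for k
  have vu: "v ((u ^^ k) b) = (u ^^ k) (v b)" for k b
    by (induction k) (simp_all add: uv[symmetric])
  have S: "((\<lambda>b. u b + v b) ^^ Suc n) c =
      (\<Sum>k\<le>n. real (n choose k) *\<^sub>R t (Suc k)) + (\<Sum>k\<le>n. real (n choose k) *\<^sub>R t k)"
    by (simp add: Suc linear_sum[OF u] linear_sum[OF v] linear_scale[OF u] linear_scale[OF v] vu t_def Suc_diff_le)
  have "(\<Sum>k\<le>n. real (n choose k) *\<^sub>R t k) = (\<Sum>k\<le>Suc n. real (n choose k) *\<^sub>R t k)" by simp
  also have "\<dots> = t 0 + (\<Sum>k\<le>n. real (n choose Suc k) *\<^sub>R t (Suc k))"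
    by (subst sum.atMost_Suc_shift) simp
  finally have "((\<lambda>b. u b + v b) ^^ Suc n) c = t 0 + (\<Sum>k\<le>n. real (Suc n choose Suc k) *\<^sub>R t (Suc k))"
    unfolding S by (simp add: sum.distrib scaleR_add_left)
  also have "\<dots> = (\<Sum>k\<le>Suc n. real (Suc n choose k) *\<^sub>R t k)"
    by (subst sum.atMost_Suc_shift) simp
  finally show ?case by (simp only: t_def)
qed simp

lemma operator_binomial_Bernstein:
  fixes f g :: "'a::real_vector \<Rightarrow> 'a"
  assumes f: "linear f" and g: "linear g" and fg: "\<And>b. f (g b) = g (f b)"
  shows "((\<lambda>b. \<theta> *\<^sub>R f b + (1 - \<theta>) *\<^sub>R g b) ^^ n) c =
    (\<Sum>k\<le>n. Bernstein n k \<theta> *\<^sub>R (f ^^ k) ((g ^^ (n - k)) c))"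
proof -
  have pow: "((\<lambda>b. s *\<^sub>R h b) ^^ k) b = s ^ k *\<^sub>R (h ^^ k) b" if "linear h" for s k b and h :: "'a \<Rightarrow> 'a"
    by (induction k) (simp_all add: linear_scale[OF that])
  have "((\<lambda>b. \<theta> *\<^sub>R f b + (1 - \<theta>) *\<^sub>R g b) ^^ n) c =
      (\<Sum>k\<le>n. real (n choose k) *\<^sub>R ((\<lambda>b. \<theta> *\<^sub>R f b) ^^ k) (((\<lambda>b. (1 - \<theta>) *\<^sub>R g b) ^^ (n - k)) c))"
    by (rule operator_binomial[OF linear_compose_scale_right[OF f] linear_compose_scale_right[OF g]])
      (simp add: linear_scale[OF f] linear_scale[OF g] fg)
  also have "\<dots> = (\<Sum>k\<le>n. Bernstein n k \<theta> *\<^sub>R (f ^^ k) ((g ^^ (n - k)) c))"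
    by (simp add: pow[OF f] pow[OF g] linear_scale[OF linear_funpow[OF f]] Bernstein_def mult.assoc)
  finally show ?thesis .
qed

text \<open>\<open>pconv F P G\<close>: the powers \<open>F\<^sub>r\<^sup>N\<close> converge to \<open>G\<close> in operator norm as \<open>r \<rightarrow> 0\<close>
  and \<open>r N \<rightarrow> P\<close>.\<close>

definition pconv :: "(real \<Rightarrow> 'a \<Rightarrow> 'a::real_normed_vector) \<Rightarrow> real \<Rightarrow> ('a \<Rightarrow> 'a) \<Rightarrow> bool" where
  "pconv F P G \<longleftrightarrow> (\<forall>\<epsilon>>0. \<exists>\<delta>>0. \<forall>r N. 0 < r \<longrightarrow> r < \<delta> \<longrightarrow> \<bar>r * real N - P\<bar> < \<delta> \<longrightarrow>
     (\<forall>c. norm ((F r ^^ N) c - G c) \<le> \<epsilon> * norm c))"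

lemma pconvE:
  assumes "pconv F P G" "0 < \<epsilon>"
  obtains \<delta> where "0 < \<delta>" "\<forall>r N c. 0 < r \<longrightarrow> r < \<delta> \<longrightarrow> \<bar>r * real N - P\<bar> < \<delta> \<longrightarrow>
    norm ((F r ^^ N) c - G c) \<le> \<epsilon> * norm c"
proof -
  from assms have "\<exists>\<delta>>0. \<forall>r N. 0 < r \<longrightarrow> r < \<delta> \<longrightarrow> \<bar>r * real N - P\<bar> < \<delta> \<longrightarrow>
     (\<forall>c. norm ((F r ^^ N) c - G c) \<le> \<epsilon> * norm c)"
    unfolding pconv_def by (elim allE impE)
  then show ?thesis using that by (elim exE conjE) simp
qed

lemma norm_funpow_le:
  fixes f :: "'a::real_normed_vector \<Rightarrow> 'a"
  assumes "\<And>b. norm (f b) \<le> M * norm b" "0 \<le> M"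
  shows "norm ((f ^^ k) b) \<le> M ^ k * norm b"
proof (induction k)
  case (Suc k)
  have "norm ((f ^^ Suc k) b) \<le> M * norm ((f ^^ k) b)" using assms(1) by simp
  also have "\<dots> \<le> M * (M ^ k * norm b)" by (intro mult_left_mono Suc assms)
  finally show ?case by (simp add: mult.assoc)
qed simp

text \<open>A power of a convex combination is an average of products \<open>F\<^sub>r\<^sup>k F'\<^sub>r\<^sup>N\<^sup>-\<^sup>k\<close> against the
  binomial distribution, which concentrates at \<open>k = \<theta> N\<close>.\<close>

lemma pconv_convex_combination:
  fixes F F' :: "real \<Rightarrow> 'a \<Rightarrow> 'a::real_normed_vector"
  assumes conv: "pconv F P1 G1" "pconv F' P2 G2" and P: "0 < P1" "0 < P2"
    and lin: "\<And>r. 0 < r \<Longrightarrow> linear (F r)" "\<And>r. 0 < r \<Longrightarrow> linear (F' r)"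
    and comm: "\<And>r b. 0 < r \<Longrightarrow> F r (F' r b) = F' r (F r b)"
    and K: "1 \<le> K" "\<And>r b. 0 < r \<Longrightarrow> norm (F r b) \<le> K powr r * norm b"
      "\<And>r b. 0 < r \<Longrightarrow> norm (F' r b) \<le> K powr r * norm b"
    and G: "\<And>c. norm (G1 c) \<le> C1 * norm c" "0 \<le> C1" "\<And>c. norm (G2 c) \<le> C2 * norm c" "0 \<le> C2"
    and \<theta>: "\<theta> = P1 / (P1 + P2)"
  shows "pconv (\<lambda>r b. \<theta> *\<^sub>R F r b + (1 - \<theta>) *\<^sub>R F' r b) (P1 + P2) (\<lambda>c. G1 (G2 c))"
  unfolding pconv_def
proof (intro allI impI)
  fix \<epsilon> :: real assume \<epsilon>: "\<epsilon> > 0"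
  define P where "P = P1 + P2"
  have P0: "P > 0" using P by (simp add: P_def)
  have \<theta>01: "0 < \<theta>" "\<theta> < 1" using P by (auto simp: \<theta>)
  have \<theta>P: "\<theta> * P = P1" "(1 - \<theta>) * P = P2" using P by (simp_all add: \<theta> P_def field_simps)
  \<comment> \<open>Bounds every product of \<open>k\<close> factors \<open>F r\<close> and
    \<open>N - k\<close> factors \<open>F' r\<close>, since
    \<open>r * N \<le> P + 1\<close>.\<close>
  define C where "C = K powr (P + 1)"
  have C0: "C > 0" using K by (simp add: C_def)
  define e where "e = \<epsilon> / (2 * (C + C2 + 1))"
  have CC: "C + C2 + 1 > 0" using C0 G by simp
  have e: "e > 0" using \<epsilon> CC by (simp add: e_def)
  obtain \<delta>1 where \<delta>1: "\<delta>1 > 0" "\<forall>r N c. 0 < r \<longrightarrow> r < \<delta>1 \<longrightarrow> \<bar>r * real N - P1\<bar> < \<delta>1 \<longrightarrow>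
      norm ((F r ^^ N) c - G1 c) \<le> e * norm c"
    using pconvE[OF conv(1) e] .
  obtain \<delta>2 where \<delta>2: "\<delta>2 > 0" "\<forall>r N c. 0 < r \<longrightarrow> r < \<delta>2 \<longrightarrow> \<bar>r * real N - P2\<bar> < \<delta>2 \<longrightarrow>
      norm ((F' r ^^ N) c - G2 c) \<le> e * norm c"
    using pconvE[OF conv(2) e] .
  define \<delta>0 where "\<delta>0 = min \<delta>1 \<delta>2"
  have \<delta>0: "\<delta>0 > 0" "\<delta>0 \<le> \<delta>1" "\<delta>0 \<le> \<delta>2" using \<delta>1(1) \<delta>2(1) by (auto simp: \<delta>0_def)
  define \<eta> where "\<eta> = \<delta>0 / (2 * (P + 1))"
  have \<eta>: "\<eta> > 0" "(P + 1) * \<eta> = \<delta>0 / 2" using \<delta>0 P0 by (auto simp: \<eta>_def field_simps)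
  define C' where "C' = C + C1 * C2"
  have C'0: "C' > 0" using C0 G by (simp add: C'_def add_pos_nonneg)
  \<comment> \<open>The entry \<open>P / 2\<close> keeps \<open>r * N\<close> above
    \<open>P / 2\<close>; with the last entry this makes \<open>N\<close> so large that the
    Chebyshev term is at most \<open>\<epsilon> / 2\<close>.\<close>
  define \<delta> where "\<delta> = Min {1, \<delta>0 / 2, P / 2, P * \<eta>\<^sup>2 * \<epsilon> / (4 * C')}"
  have \<delta>: "\<delta> > 0" "\<delta> \<le> 1" "\<delta> \<le> \<delta>0 / 2" "\<delta> \<le> P / 2" "\<delta> \<le> P * \<eta>\<^sup>2 * \<epsilon> / (4 * C')"
    using \<delta>0 P0 \<eta> \<epsilon> C'0 by (auto simp: \<delta>_def)
  have main: "norm (((\<lambda>b. \<theta> *\<^sub>R F r b + (1 - \<theta>) *\<^sub>R F' r b) ^^ N) c - G1 (G2 c)) \<le> \<epsilon> * norm c"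
    if r: "0 < r" "r < \<delta>" and rN: "\<bar>r * real N - P\<bar> < \<delta>" for r N c
  proof -
    have rN': "P / 2 < r * real N" "r * real N \<le> P + 1" using rN \<delta> by linarith+
    have N0: "N > 0" using rN' P0 by (cases N) auto
    have Nbig: "C' / (\<eta>\<^sup>2 * real N) \<le> \<epsilon> / 2"
    proof -
      have "r * (2 * C') \<le> \<delta> * (2 * C')" using r C'0 by (intro mult_right_mono) auto
      also have "\<dots> \<le> P * \<eta>\<^sup>2 * \<epsilon> / (4 * C') * (2 * C')" using \<delta> C'0 by (intro mult_right_mono) auto
      also have "\<dots> = P / 2 * (\<eta>\<^sup>2 * \<epsilon>)" using C'0 by (simp add: field_simps)
      also have "\<dots> \<le> r * real N * (\<eta>\<^sup>2 * \<epsilon>)" using rN' \<epsilon> by (intro mult_right_mono) auto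
      finally have "2 * C' \<le> real N * (\<eta>\<^sup>2 * \<epsilon>)" using r by (simp add: mult.assoc)
      then show ?thesis using \<eta> N0 by (simp add: field_simps)
    qed
    have pw: "(K powr r) ^ k = K powr (r * real k)" for k
      using K(1) by (simp add: powr_powr[symmetric] powr_realpow)
    have powF: "norm ((F r ^^ k) b) \<le> K powr (r * real k) * norm b" for k b
      using norm_funpow_le[OF K(2)[OF r(1)], of k b] by (simp only: pw powr_ge_zero)
    have powF': "norm ((F' r ^^ k) b) \<le> K powr (r * real k) * norm b" for k b
      using norm_funpow_le[OF K(3)[OF r(1)], of k b] by (simp only: pw powr_ge_zero)
    have KC: "K powr (r * real k) \<le> C" if "k \<le> N" for k
    proof -
      have "r * real k \<le> r * real N" using r that by simp
      then show ?thesis unfolding C_def using rN' K(1) by (intro powr_mono) auto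
    qed
    \<comment> \<open>Chebyshev's argument: for \<open>k / N\<close> within \<eta> of \<theta> both
      factors are close to their limits, and otherwise the crude bound \<open>C'\<close> is below
      the quadratic term, whose average is a variance.\<close>
    have each: "norm ((F r ^^ k) ((F' r ^^ (N - k)) c) - G1 (G2 c)) \<le>
        (\<epsilon> / 2 + C' / \<eta>\<^sup>2 * (\<theta> - real k / real N)\<^sup>2) * norm c" if k: "k \<le> N" for k
    proof (cases "\<bar>\<theta> - real k / real N\<bar> < \<eta>")
      case True
      have small: "\<bar>r * real N * (\<theta> - real k / real N)\<bar> \<le> \<delta>0 / 2"
      proof -
        have "\<bar>r * real N * (\<theta> - real k / real N)\<bar> \<le> (P + 1) * \<eta>"
          unfolding abs_mult[of "r * real N"] using True rN' r P0 by (intro mult_mono) auto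
        then show ?thesis using \<eta> by simp
      qed
      have small\<theta>: "\<bar>\<theta> * (r * real N - P)\<bar> < \<delta>" "\<bar>(1 - \<theta>) * (r * real N - P)\<bar> < \<delta>"
        using \<theta>01 rN mult_left_le_one_le[of "\<bar>r * real N - P\<bar>" \<theta>]
          mult_left_le_one_le[of "\<bar>r * real N - P\<bar>" "1 - \<theta>"]
        by (auto simp: abs_mult)
      have "r * real k - P1 = \<theta> * (r * real N - P) - r * real N * (\<theta> - real k / real N)"
        using N0 by (simp add: \<theta>P(1)[symmetric] field_simps)
      then have "\<bar>r * real k - P1\<bar> < \<delta>1" using small small\<theta> \<delta> \<delta>0 by linarith
      moreover have "r * real (N - k) - P2 = (1 - \<theta>) * (r * real N - P) + r * real N * (\<theta> - real k / real N)"
        using N0 k by (simp add: \<theta>P(2)[symmetric] of_nat_diff field_simps)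
      then have "\<bar>r * real (N - k) - P2\<bar> < \<delta>2" using small small\<theta> \<delta> \<delta>0 by linarith
      ultimately have "norm ((F r ^^ k) (G2 c) - G1 (G2 c)) \<le> e * norm (G2 c)"
        "norm ((F' r ^^ (N - k)) c - G2 c) \<le> e * norm c"
        using \<delta>1(2)[rule_format, of r k "G2 c"] \<delta>2(2)[rule_format, of r "N - k" c] r \<delta> \<delta>0 by auto
      note 1 = this
      have "norm ((F r ^^ k) ((F' r ^^ (N - k)) c - G2 c)) \<le> C * (e * norm c)"
        by (rule order_trans[OF powF]) (use KC[OF k] 1(2) C0 e in \<open>intro mult_mono\<close>, auto)
      moreover have "norm ((F r ^^ k) (G2 c) - G1 (G2 c)) \<le> e * (C2 * norm c)"
        by (rule order_trans[OF 1(1)]) (use G(3)[of c] e in auto)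
      moreover have "(F r ^^ k) ((F' r ^^ (N - k)) c) - G1 (G2 c) =
          (F r ^^ k) ((F' r ^^ (N - k)) c - G2 c) + ((F r ^^ k) (G2 c) - G1 (G2 c))"
        by (simp add: linear_diff[OF linear_funpow[OF lin(1)[OF r(1)]]])
      ultimately have "norm ((F r ^^ k) ((F' r ^^ (N - k)) c) - G1 (G2 c)) \<le> C * (e * norm c) + e * (C2 * norm c)"
        by (metis norm_triangle_mono)
      also have "\<dots> = (C + C2) * e * norm c" by (simp add: algebra_simps)
      also have "\<dots> \<le> \<epsilon> / 2 * norm c"
      proof (rule mult_right_mono)
        have "(C + C2) * e \<le> (C + C2 + 1) * e" using e by (intro mult_right_mono) auto
        also have "\<dots> = \<epsilon> / 2" using CC by (simp add: e_def field_simps)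
        finally show "(C + C2) * e \<le> \<epsilon> / 2" .
      qed simp
      also have "\<dots> \<le> (\<epsilon> / 2 + C' / \<eta>\<^sup>2 * (\<theta> - real k / real N)\<^sup>2) * norm c"
        using C'0 by (intro mult_right_mono) auto
      finally show ?thesis .
    next
      case False
      have "norm ((F r ^^ k) ((F' r ^^ (N - k)) c)) \<le> K powr (r * real k) * (K powr (r * real (N - k)) * norm c)"
        by (rule order_trans[OF powF]) (intro mult_left_mono powF', simp)
      also have "\<dots> = K powr (r * real N) * norm c"
        using k by (simp add: powr_add[symmetric] distrib_left[symmetric] of_nat_diff mult.assoc[symmetric])
      also have "\<dots> \<le> C * norm c" using KC[of N] by (intro mult_right_mono) auto
      finally have 1: "norm ((F r ^^ k) ((F' r ^^ (N - k)) c)) \<le> C * norm c" .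
      have 2: "norm (G1 (G2 c)) \<le> C1 * (C2 * norm c)"
        by (rule order_trans[OF G(1)]) (intro mult_left_mono G)
      have "norm ((F r ^^ k) ((F' r ^^ (N - k)) c) - G1 (G2 c)) \<le> C' * norm c"
        using norm_triangle_ineq4[of "(F r ^^ k) ((F' r ^^ (N - k)) c)" "G1 (G2 c)"] 1 2
        by (simp add: C'_def algebra_simps)
      also have "C' \<le> \<epsilon> / 2 + C' / \<eta>\<^sup>2 * (\<theta> - real k / real N)\<^sup>2"
      proof -
        have "\<eta>\<^sup>2 \<le> (\<theta> - real k / real N)\<^sup>2"
          using False \<eta> by (simp add: abs_le_square_iff[symmetric])
        then have "C' / \<eta>\<^sup>2 * \<eta>\<^sup>2 \<le> C' / \<eta>\<^sup>2 * (\<theta> - real k / real N)\<^sup>2"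
          using C'0 by (intro mult_left_mono) auto
        then show ?thesis using \<eta> \<epsilon> by simp
      qed
      finally show ?thesis by (simp add: mult_right_mono)
    qed
    have "((\<lambda>b. \<theta> *\<^sub>R F r b + (1 - \<theta>) *\<^sub>R F' r b) ^^ N) c - G1 (G2 c) =
        (\<Sum>k\<le>N. Bernstein N k \<theta> *\<^sub>R ((F r ^^ k) ((F' r ^^ (N - k)) c) - G1 (G2 c)))"
      by (simp add: operator_binomial_Bernstein[OF lin(1)[OF r(1)] lin(2)[OF r(1)] comm[OF r(1)]]
          scaleR_diff_right sum_subtractf scaleR_sum_left[symmetric])
    also have "norm \<dots> \<le> (\<Sum>k\<le>N. Bernstein N k \<theta> * ((\<epsilon> / 2 + C' / \<eta>\<^sup>2 * (\<theta> - real k / real N)\<^sup>2) * norm c))"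
      by (rule sum_norm_le) (use \<theta>01 each in \<open>auto simp: Bernstein_nonneg intro!: mult_left_mono\<close>)
    also have "\<dots> = (\<Sum>k\<le>N. \<epsilon> / 2 * norm c * Bernstein N k \<theta> +
        C' / \<eta>\<^sup>2 * norm c * ((\<theta> - real k / real N)\<^sup>2 * Bernstein N k \<theta>))"
      by (rule sum.cong) (simp_all only: algebra_simps)
    also have "\<dots> = \<epsilon> / 2 * norm c + C' / \<eta>\<^sup>2 * norm c * (\<theta> * (1 - \<theta>) / real N)"
      by (simp only: sum.distrib sum_distrib_left[symmetric] sum_Bernstein sum_Bernstein_variance[OF N0] mult_1_right)
    also have "C' / \<eta>\<^sup>2 * norm c * (\<theta> * (1 - \<theta>) / real N) \<le> C' / \<eta>\<^sup>2 * norm c * (1 / real N)"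
      using \<theta>01 C'0 mult_mono[of \<theta> 1 "1 - \<theta>" 1] by (intro mult_left_mono divide_right_mono) auto
    also have "\<dots> = C' / (\<eta>\<^sup>2 * real N) * norm c" by simp
    also have "\<dots> \<le> \<epsilon> / 2 * norm c" using Nbig by (rule mult_right_mono) simp
    finally show ?thesis by simp
  qed
  show "\<exists>\<delta>>0. \<forall>r N. 0 < r \<longrightarrow> r < \<delta> \<longrightarrow> \<bar>r * real N - (P1 + P2)\<bar> < \<delta> \<longrightarrow>
      (\<forall>c. norm (((\<lambda>b. \<theta> *\<^sub>R F r b + (1 - \<theta>) *\<^sub>R F' r b) ^^ N) c - G1 (G2 c)) \<le> \<epsilon> * norm c)"
    by (intro exI[of _ \<delta>] conjI allI impI main \<delta>(1)) (simp_all add: P_def)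
qed

lemma funpow_mult_lprod:
  fixes s :: "'a::semigroup_mult"
  shows "((*) s ^^ Suc n) c = lprod (replicate (Suc n) s) * c"
proof (induction n)
  case (Suc n)
  have "((*) s ^^ Suc (Suc n)) c = s * ((*) s ^^ Suc n) c" by simp
  then show ?case by (simp only: Suc) (simp add: lprod_Cons mult.assoc)
qed simp

lemma lprod_commute:
  fixes w :: "'a::semigroup_mult"
  shows "xs \<noteq> [] \<Longrightarrow> (\<And>x. x \<in> set xs \<Longrightarrow> w * x = x * w) \<Longrightarrow> w * lprod xs = lprod xs * w"
proof (induction xs)
  case (Cons a xs)
  show ?case
  proof (cases "xs = []")
    case False
    then have "w * lprod xs = lprod xs * w" using Cons by simp
    moreover have "w * a = a * w" using Cons.prems by simp
    ultimately show ?thesis using False by (simp add: lprod_Cons) (metis mult.assoc)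
  qed (use Cons in simp)
qed simp

lemma (in cstar_algebra) star_lprod_commuting:
  assumes "xs \<noteq> []" "\<And>x. x \<in> set xs \<Longrightarrow> star x = x"
    and "\<And>x y. x \<in> set xs \<Longrightarrow> y \<in> set xs \<Longrightarrow> x * y = y * x"
  shows "star (lprod xs) = lprod xs"
  using assms
proof (induction xs)
  case (Cons a xs)
  show ?case
  proof (cases "xs = []")
    case False
    have "a * lprod xs = lprod xs * a"
      by (rule lprod_commute) (use False Cons.prems in auto)
    then show ?thesis using False Cons by (simp add: lprod_Cons star_mult)
  qed (use Cons in simp)
qed simp

lemma lprod_map_mult:
  fixes f :: "'b \<Rightarrow> 'a::semigroup_mult"
  assumes "xs \<noteq> []" "\<And>i j. i \<in> set xs \<Longrightarrow> j \<in> set xs \<Longrightarrow> f i * f j = f j * f i"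
  shows "lprod (map f xs) * lprod (map f xs) = lprod (map (\<lambda>i. f i * f i) xs)"
  using assms
proof (induction xs)
  case (Cons a xs)
  show ?case
  proof (cases "xs = []")
    case False
    then have IH: "lprod (map f xs) * lprod (map f xs) = lprod (map (\<lambda>i. f i * f i) xs)"
      using Cons by simp
    have "f a * lprod (map f xs) = lprod (map f xs) * f a"
      by (rule lprod_commute) (use False Cons.prems in auto)
    then have "f a * lprod (map f xs) * (f a * lprod (map f xs)) =
        f a * f a * (lprod (map f xs) * lprod (map f xs))"
      by (metis mult.assoc)
    with IH show ?thesis using False by (simp add: lprod_Cons)
  qed simp
qed simp

text \<open>Uniform continuity on a compact rectangle. Exponents stay above \<open>q / 2\<close>,
  away from exponent 0, where continuity at base 0 fails.\<close>

lemma powr_uniformly_continuous_exponent: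
  fixes q R \<epsilon> :: real
  assumes "q > 0" "\<epsilon> > 0"
  obtains \<delta> where "\<delta> > 0" "\<delta> \<le> q / 2"
    "\<And>s t. \<bar>s - q\<bar> < \<delta> \<Longrightarrow> 0 \<le> t \<Longrightarrow> t \<le> R \<Longrightarrow> \<bar>t powr s - t powr q\<bar> \<le> \<epsilon>"
proof -
  let ?S = "{q / 2..2 * q} \<times> {0..R}"
  have "continuous_on ?S (\<lambda>z. snd z powr fst z)"
    using assms by (intro continuous_on_powr' continuous_intros) auto
  then have "uniformly_continuous_on ?S (\<lambda>z. snd z powr fst z)"
    by (intro compact_uniformly_continuous compact_Times compact_Icc)
  then obtain d where d: "d > 0" "\<And>z z'. z \<in> ?S \<Longrightarrow> z' \<in> ?S \<Longrightarrow> dist z' z < d \<Longrightarrow>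
      dist (snd z' powr fst z') (snd z powr fst z) < \<epsilon>"
    unfolding uniformly_continuous_on_def using assms by metis
  have "\<bar>t powr s - t powr q\<bar> \<le> \<epsilon>" if s: "\<bar>s - q\<bar> < min d (q / 2)" and t: "0 \<le> t" "t \<le> R" for s t
  proof -
    have "dist (s, t) (q, t) < d" using s by (simp add: dist_Pair_Pair dist_real_def)
    moreover have "\<bar>s - q\<bar> < q / 2" using s by simp
    then have "q / 2 \<le> s" "s \<le> 2 * q" using assms(1) by linarith+
    then have "(s, t) \<in> ?S" "(q, t) \<in> ?S" using t assms by auto
    ultimately show ?thesis using d(2)[of "(q, t)" "(s, t)"] by (simp add: dist_real_def)
  qed
  then show ?thesis using that[of "min d (q / 2)"] d(1) assms by auto
qed

context cstar_algebra
begin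

section \<open>Weighted power means of commuting positive elements\<close>

lemma cfc_pow_funpow:
  assumes "pos x" "r > 0"
  shows "((*) (cfc_pow x r) ^^ Suc n) c = cfc_pow x (r * real (Suc n)) * c"
proof (induction n)
  case (Suc n)
  have "((*) (cfc_pow x r) ^^ Suc (Suc n)) c = cfc_pow x r * ((*) (cfc_pow x r) ^^ Suc n) c" by simp
  also have "\<dots> = (cfc_pow x r * cfc_pow x (r * real (Suc n))) * c" by (simp only: Suc mult.assoc)
  also have "cfc_pow x r * cfc_pow x (r * real (Suc n)) = cfc_pow x (r + r * real (Suc n))"
    using assms by (intro cfc_pow_add mult_pos_pos) auto
  also have "r + r * real (Suc n) = r * real (Suc (Suc n))" by (simp add: algebra_simps)
  finally show ?case .
qed simp

lemma pconv_cfc_pow: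
  assumes x: "pos x" and q: "q > 0"
  shows "pconv (\<lambda>r. (*) (cfc_pow x r)) q ((*) (cfc_pow x q))"
  unfolding pconv_def
proof (intro allI impI)
  fix \<epsilon> :: real assume \<epsilon>: "\<epsilon> > 0"
  obtain \<delta> where \<delta>: "\<delta> > 0" "\<delta> \<le> q / 2"
    "\<And>s t. \<bar>s - q\<bar> < \<delta> \<Longrightarrow> 0 \<le> t \<Longrightarrow> t \<le> norm x \<Longrightarrow> \<bar>t powr s - t powr q\<bar> \<le> \<epsilon>"
    using powr_uniformly_continuous_exponent[OF q \<epsilon>, where R = "norm x"] by metis
  have "norm (((*) (cfc_pow x r) ^^ N) c - cfc_pow x q * c) \<le> \<epsilon> * norm c"
    if r: "0 < r" and rN: "\<bar>r * real N - q\<bar> < \<delta>" for r N c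
  proof -
    have pos': "r * real N > 0" using rN \<delta>(2) q by linarith
    then obtain n where n: "N = Suc n" by (cases N) auto
    have "norm (cfc_pow x (r * real N) - cfc_pow x q) \<le> \<epsilon>"
      by (rule norm_cfc_pow_diff_le[OF x pos' q]) (use \<epsilon> \<delta>(3)[OF rN] in auto)
    then have "norm ((cfc_pow x (r * real N) - cfc_pow x q) * c) \<le> \<epsilon> * norm c"
      by (intro order_trans[OF norm_mult_ineq] mult_right_mono) auto
    then show ?thesis
      unfolding n cfc_pow_funpow[OF x r] left_diff_distrib .
  qed
  then show "\<exists>\<delta>>0. \<forall>r N. 0 < r \<longrightarrow> r < \<delta> \<longrightarrow> \<bar>r * real N - q\<bar> < \<delta> \<longrightarrow>
      (\<forall>c. norm (((*) (cfc_pow x r) ^^ N) c - cfc_pow x q * c) \<le> \<epsilon> * norm c)"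
    using \<delta>(1) by (intro exI[of _ \<delta>]) auto
qed

text \<open>The outer root \<open>1 / r\<close> of the usual power mean is left out; raising to the
  \<open>N\<close>-th power with \<open>r * N\<close> close to the total weight takes its
  place.\<close>

definition pmean :: "('b \<Rightarrow> 'a) \<Rightarrow> ('b \<Rightarrow> real) \<Rightarrow> 'b list \<Rightarrow> real \<Rightarrow> 'a" where
  "pmean x q L r = (\<Sum>i\<leftarrow>L. (q i / (\<Sum>j\<leftarrow>L. q j)) *\<^sub>R cfc_pow (x i) r)"

lemma sum_list_pos: "L \<noteq> [] \<Longrightarrow> (\<And>i. i \<in> set L \<Longrightarrow> q i > 0) \<Longrightarrow> (\<Sum>j\<leftarrow>L. q j) > (0::real)"
proof (induction L)
  case (Cons a L)
  then show ?case by (cases "L = []") (auto simp: add_pos_pos)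
qed simp

lemma scaleR_sum_list: "c *\<^sub>R (\<Sum>i\<leftarrow>L. f i) = (\<Sum>i\<leftarrow>L. c *\<^sub>R f i)" for f :: "'b \<Rightarrow> 'a"
  by (induction L) (simp_all add: scaleR_add_right)

lemma pmean_Cons:
  assumes "L \<noteq> []" "\<And>i. i \<in> set (a # L) \<Longrightarrow> q i > 0"
    and \<theta>: "\<theta> = q a / (q a + (\<Sum>j\<leftarrow>L. q j))"
  shows "pmean x q (a # L) r = \<theta> *\<^sub>R cfc_pow (x a) r + (1 - \<theta>) *\<^sub>R pmean x q L r"
proof -
  define Q where "Q = (\<Sum>j\<leftarrow>L. q j)"
  have Q: "Q > 0" unfolding Q_def by (rule sum_list_pos) (use assms in auto)
  have qa: "q a > 0" using assms by simp
  have "(1 - \<theta>) * (q i / Q) = q i / (q a + Q)" for i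
  proof -
    have "1 - \<theta> = Q / (q a + Q)" using Q qa by (simp add: \<theta> Q_def[symmetric] field_simps)
    then show ?thesis using Q by simp
  qed
  then show ?thesis
    by (simp add: pmean_def Q_def[symmetric] \<theta> scaleR_sum_list)
qed

lemma pmean_pos:
  assumes "\<And>i. i \<in> set L \<Longrightarrow> pos (x i) \<and> q i > 0" "r > 0"
  shows "pos (pmean x q L r)"
proof -
  have Q: "(\<Sum>j\<leftarrow>L. q j) \<ge> 0" by (rule sum_list_nonneg) (use assms in \<open>auto intro: less_imp_le\<close>)
  have "pos (\<Sum>i\<leftarrow>M. (q i / (\<Sum>j\<leftarrow>L. q j)) *\<^sub>R cfc_pow (x i) r)" if "set M \<subseteq> set L" for M
    using that
  proof (induction M)
    case (Cons a M)
    then have "pos (x a)" "q a > 0" using assms by auto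
    then have "pos ((q a / (\<Sum>j\<leftarrow>L. q j)) *\<^sub>R cfc_pow (x a) r)"
      using Q assms(2) by (intro pos_scaleR pos_cfc_pow) auto
    with Cons show ?case by (simp add: pos_add)
  qed simp
  then show ?thesis by (simp add: pmean_def)
qed

lemma pmean_commute:
  assumes "\<And>i. i \<in> set L \<Longrightarrow> pos (x i) \<and> w * x i = x i * w" "r > 0"
  shows "w * pmean x q L r = pmean x q L r * w"
proof -
  have "w * (\<Sum>i\<leftarrow>M. k i *\<^sub>R cfc_pow (x i) r) = (\<Sum>i\<leftarrow>M. k i *\<^sub>R cfc_pow (x i) r) * w"
    if "set M \<subseteq> set L" for M k
    using that
  proof (induction M)
    case (Cons a M)
    then have "w * cfc_pow (x a) r = cfc_pow (x a) r * w"
      using assms by (intro cfc_pow_commute) auto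
    with Cons show ?case by (simp add: distrib_left distrib_right)
  qed simp
  then show ?thesis by (simp add: pmean_def)
qed

lemma norm_pmean_le:
  assumes "L \<noteq> []" "\<And>i. i \<in> set L \<Longrightarrow> pos (x i) \<and> q i > 0 \<and> norm (x i) \<le> K" "r > 0"
  shows "norm (pmean x q L r) \<le> K powr r"
  using assms(1,2)
proof (induction L rule: list_nonempty_induct)
  case (single a)
  then have "norm (cfc_pow (x a) r) \<le> norm (x a) powr r" using assms(3) by (intro norm_cfc_pow_le) auto
  also have "\<dots> \<le> K powr r" using single assms(3) by (intro powr_mono2) auto
  finally show ?case using single by (simp add: pmean_def)
next
  case (cons a L)
  define \<theta> where "\<theta> = q a / (q a + (\<Sum>j\<leftarrow>L. q j))"
  have Q: "(\<Sum>j\<leftarrow>L. q j) > 0" by (rule sum_list_pos) (use cons in auto)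
  have qa: "q a > 0" using cons by simp
  have \<theta>: "0 \<le> \<theta>" "\<theta> \<le> 1" using Q qa by (auto simp: \<theta>_def)
  have "norm (cfc_pow (x a) r) \<le> norm (x a) powr r" using assms(3) cons by (intro norm_cfc_pow_le) auto
  also have "\<dots> \<le> K powr r" using cons assms(3) by (intro powr_mono2) auto
  finally have 1: "norm (cfc_pow (x a) r) \<le> K powr r" .
  have 2: "norm (pmean x q L r) \<le> K powr r" using cons by simp
  have "norm (pmean x q (a # L) r) \<le> \<theta> * norm (cfc_pow (x a) r) + (1 - \<theta>) * norm (pmean x q L r)"
  proof -
    have "pmean x q (a # L) r = \<theta> *\<^sub>R cfc_pow (x a) r + (1 - \<theta>) *\<^sub>R pmean x q L r"
      by (rule pmean_Cons[OF cons(1) _ \<theta>_def]) (use cons in auto)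
    then show ?thesis
      using norm_triangle_ineq[of "\<theta> *\<^sub>R cfc_pow (x a) r" "(1 - \<theta>) *\<^sub>R pmean x q L r"] \<theta> by simp
  qed
  also have "\<dots> \<le> \<theta> * K powr r + (1 - \<theta>) * K powr r"
    using 1 2 \<theta> by (intro add_mono mult_left_mono) auto
  finally show ?case by (simp add: algebra_simps)
qed

text \<open>By \<open>pmean_Cons\<close> the mean is a convex combination of one power and the mean
  of the remaining entries, with exactly the weights that \<open>pconv_convex_combination\<close>
  asks for, so two factors suffice for the induction.\<close>

lemma pconv_pmean:
  assumes "L \<noteq> []" and "\<And>i. i \<in> set L \<Longrightarrow> pos (x i) \<and> q i > 0"
    and "\<And>i j. i \<in> set L \<Longrightarrow> j \<in> set L \<Longrightarrow> x i * x j = x j * x i"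
  shows "pconv (\<lambda>r. (*) (pmean x q L r)) (\<Sum>j\<leftarrow>L. q j) ((*) (lprod (map (\<lambda>i. cfc_pow (x i) (q i)) L)))"
  using assms
proof (induction L rule: list_nonempty_induct)
  case (single a)
  then have "pmean x q [a] r = cfc_pow (x a) r" for r by (simp add: pmean_def)
  then show ?case using pconv_cfc_pow[of "x a" "q a"] single by simp
next
  case (cons a L)
  define \<theta> where "\<theta> = q a / (q a + (\<Sum>j\<leftarrow>L. q j))"
  define G where "G = lprod (map (\<lambda>i. cfc_pow (x i) (q i)) L)"
  define K where "K = 1 + norm (x a) + (\<Sum>i\<leftarrow>L. norm (x i))"
  have nn: "0 \<le> (\<Sum>i\<leftarrow>L. norm (x i))" by (rule sum_list_nonneg) auto
  have K: "1 \<le> K" "norm (x a) \<le> K" "\<And>i. i \<in> set L \<Longrightarrow> norm (x i) \<le> K"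
  proof -
    show "1 \<le> K" "norm (x a) \<le> K" using nn norm_ge_zero[of "x a"] by (auto simp: K_def)
    show "norm (x i) \<le> K" if "i \<in> set L" for i
    proof -
      have "norm (x i) \<le> (\<Sum>i\<leftarrow>L. norm (x i))"
        by (rule member_le_sum_list) (use that in auto)
      then show ?thesis using norm_ge_zero[of "x a"] unfolding K_def by linarith
    qed
  qed
  have a: "pos (x a)" "q a > 0" using cons.prems by auto
  have L: "pos (x i) \<and> q i > 0 \<and> norm (x i) \<le> K" if "i \<in> set L" for i using cons.prems K that by auto
  have "pconv (\<lambda>r b. \<theta> *\<^sub>R (cfc_pow (x a) r * b) + (1 - \<theta>) *\<^sub>R (pmean x q L r * b))
      (q a + (\<Sum>j\<leftarrow>L. q j)) (\<lambda>c. cfc_pow (x a) (q a) * (G * c))"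
  proof (rule pconv_convex_combination[where K = K and ?G1.0 = "(*) (cfc_pow (x a) (q a))" and ?G2.0 = "(*) G"
        and ?C1.0 = "norm (cfc_pow (x a) (q a))" and ?C2.0 = "norm G"])
    show "pconv (\<lambda>r. (*) (cfc_pow (x a) r)) (q a) ((*) (cfc_pow (x a) (q a)))"
      by (rule pconv_cfc_pow[OF a])
    show "pconv (\<lambda>r. (*) (pmean x q L r)) (\<Sum>j\<leftarrow>L. q j) ((*) G)"
      unfolding G_def using cons by simp
    show "(\<Sum>j\<leftarrow>L. q j) > 0" by (rule sum_list_pos) (use cons L in auto)
    show "cfc_pow (x a) r * (pmean x q L r * b) = pmean x q L r * (cfc_pow (x a) r * b)" if "0 < r" for r b
    proof -
      have "cfc_pow (x a) r * pmean x q L r = pmean x q L r * cfc_pow (x a) r"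
      proof (rule pmean_commute)
        fix i assume "i \<in> set L"
        then show "pos (x i) \<and> cfc_pow (x a) r * x i = x i * cfc_pow (x a) r"
          using cfc_pow_commute[OF a(1) that, of "x i"] cons.prems by simp
      qed (rule that)
      then show ?thesis by (metis mult.assoc)
    qed
    show "norm (cfc_pow (x a) r * b) \<le> K powr r * norm b" if "0 < r" for r b
    proof -
      have "norm (cfc_pow (x a) r) \<le> norm (x a) powr r" by (rule norm_cfc_pow_le[OF a(1) that])
      also have "\<dots> \<le> K powr r" using K that by (intro powr_mono2) auto
      finally show ?thesis by (intro order_trans[OF norm_mult_ineq] mult_right_mono) auto
    qed
    show "norm (pmean x q L r * b) \<le> K powr r * norm b" if "0 < r" for r b
      using norm_pmean_le[OF cons(1) L that] by (intro order_trans[OF norm_mult_ineq] mult_right_mono) auto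
  qed (use a K \<theta>_def in \<open>auto intro: linear_mult_left norm_mult_ineq\<close>)
  moreover have "\<theta> *\<^sub>R (cfc_pow (x a) r * b) + (1 - \<theta>) *\<^sub>R (pmean x q L r * b) = pmean x q (a # L) r * b" for r b
    using pmean_Cons[OF cons(1) _ \<theta>_def, of x r] cons.prems by (simp add: distrib_right)
  moreover have "cfc_pow (x a) (q a) * (G * c) = lprod (map (\<lambda>i. cfc_pow (x i) (q i)) (a # L)) * c" for c
    using cons(1) by (simp add: lprod_Cons G_def mult.assoc)
  ultimately show ?case by simp
qed

lemma pmean_power_tendsto:
  fixes x :: "'b \<Rightarrow> 'a"
  assumes "L \<noteq> []" and L: "\<And>i. i \<in> set L \<Longrightarrow> pos (x i) \<and> q i > 0"
    and "\<And>i j. i \<in> set L \<Longrightarrow> j \<in> set L \<Longrightarrow> x i * x j = x j * x i"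
  defines "N \<equiv> \<lambda>k. nat \<lceil>(\<Sum>j\<leftarrow>L. q j) * 2 ^ k\<rceil>"
  shows "(\<lambda>k. lprod (replicate (N k) (pmean x q L ((1/2) ^ k)))) \<longlonglongrightarrow> lprod (map (\<lambda>i. cfc_pow (x i) (q i)) L)"
proof (rule LIMSEQ_I)
  fix \<epsilon> :: real assume \<epsilon>: "\<epsilon> > 0"
  define Q where "Q = (\<Sum>j\<leftarrow>L. q j)"
  have Q: "Q > 0" unfolding Q_def by (rule sum_list_pos) (use assms in auto)
  have \<epsilon>2: "\<epsilon> / 2 > 0" using \<epsilon> by simp
  have pc: "pconv (\<lambda>r. (*) (pmean x q L r)) Q ((*) (lprod (map (\<lambda>i. cfc_pow (x i) (q i)) L)))"
    unfolding Q_def by (rule pconv_pmean[OF assms(1-3)])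
  obtain \<delta> where \<delta>: "\<delta> > 0" "\<forall>r N c. 0 < r \<longrightarrow> r < \<delta> \<longrightarrow> \<bar>r * real N - Q\<bar> < \<delta> \<longrightarrow>
      norm (((*) (pmean x q L r) ^^ N) c - lprod (map (\<lambda>i. cfc_pow (x i) (q i)) L) * c) \<le> \<epsilon> / 2 * norm c"
    using pconvE[OF pc \<epsilon>2] .
  obtain k0 where k0: "(1/2) ^ k0 < \<delta>" using real_arch_pow_inv[OF \<delta>(1), of "1/2"] by auto
  have "norm (lprod (replicate (N k) (pmean x q L ((1/2) ^ k))) - lprod (map (\<lambda>i. cfc_pow (x i) (q i)) L)) < \<epsilon>"
    if "k \<ge> k0" for k
  proof -
    define r where "r = (1/2 :: real) ^ k"
    have "r \<le> (1/2) ^ k0" unfolding r_def using that by (intro power_decreasing) auto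
    then have "r < \<delta>" using k0 by linarith
    moreover have "0 < r" by (simp add: r_def)
    ultimately have r: "0 < r" "r < \<delta>" by auto
    have r2: "r * 2 ^ k = 1" by (simp add: r_def power_mult_distrib[symmetric])
    have Nk: "real (N k) = of_int \<lceil>Q * 2 ^ k\<rceil>"
      using Q by (simp add: N_def Q_def[symmetric])
    \<comment> \<open>Rounding up costs less than one step: \<open>Q \<le> r * N k < Q + r\<close>,
      and \<open>r < \<delta>\<close>.\<close>
    have "Q * 2 ^ k \<le> real (N k)" "real (N k) < Q * 2 ^ k + 1" unfolding Nk by linarith+
    then have "r * (Q * 2 ^ k) \<le> r * real (N k)" "r * real (N k) < r * (Q * 2 ^ k + 1)"
      using r by auto
    moreover have "r * (Q * 2 ^ k) = Q" using r2 by (simp add: ac_simps)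
    ultimately have "\<bar>r * real (N k) - Q\<bar> < \<delta>" using r by (simp add: distrib_left)
    have "N k > 0" using Q by (simp add: N_def Q_def[symmetric])
    then obtain n where n: "N k = Suc n" by (cases "N k") auto
    have "norm (lprod (replicate (N k) (pmean x q L r)) - lprod (map (\<lambda>i. cfc_pow (x i) (q i)) L)) \<le> \<epsilon> / 2"
    proof (rule norm_le_of_mult_bound)
      fix c
      have "((*) (pmean x q L r) ^^ N k) c = lprod (replicate (N k) (pmean x q L r)) * c"
        unfolding n by (rule funpow_mult_lprod)
      then show "norm ((lprod (replicate (N k) (pmean x q L r)) - lprod (map (\<lambda>i. cfc_pow (x i) (q i)) L)) * c)
          \<le> \<epsilon> / 2 * norm c"
        using \<delta>(2)[rule_format, OF r \<open>\<bar>r * real (N k) - Q\<bar> < \<delta>\<close>, of c] by (simp only: left_diff_distrib)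
    qed (use \<epsilon> in simp)
    then show ?thesis using \<epsilon> by (simp add: r_def)
  qed
  then show "\<exists>k0. \<forall>k\<ge>k0. norm (lprod (replicate (N k) (pmean x q L ((1/2) ^ k))) -
      lprod (map (\<lambda>i. cfc_pow (x i) (q i)) L)) < \<epsilon>" by blast
qed

end

context cstar_positive_functional
begin

section \<open>Passage to the limit under \<phi>\<close>

lemma tendsto_phi_mult:
  assumes "f \<longlonglongrightarrow> a" "g \<longlonglongrightarrow> b"
  shows "(\<lambda>k. \<phi> (f k * g k)) \<longlonglongrightarrow> \<phi> (a * b)"
proof -
  obtain C where C: "0 \<le> C" "\<And>a b. cmod (\<phi> (a * b)) \<le> C * norm a * norm b"
    using phi_mult_bounded by blast
  have "bounded_bilinear (\<lambda>a b. \<phi> (a * b))"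
    by (rule bounded_bilinear.intro)
      (use C(2) in \<open>auto simp: distrib_left distrib_right phi_add phi_scaleR scaleR_conv_of_real
        intro!: exI[of _ C] simp: ac_simps\<close>)
  then show ?thesis by (rule bounded_bilinear.tendsto) (rule assms)+
qed

lemma Z_pmean:
  assumes "\<And>i. i \<in> set L \<Longrightarrow> pos (x i) \<and> x i \<in> Z" "r > 0"
  shows "pmean x q L r \<in> Z"
proof -
  have "(\<Sum>i\<leftarrow>M. k i *\<^sub>R cfc_pow (x i) r) \<in> Z" if "set M \<subseteq> set L" for M k
    using that by (induction M) (use assms in \<open>auto intro!: Z_add Z_scaleR Z_cfc_pow\<close>)
  then show ?thesis by (simp add: pmean_def)
qed

lemma zpos_pmean_mono:
  assumes "\<And>i. i \<in> set L \<Longrightarrow> pos (x i) \<and> x i \<in> Z \<and> pos (y i) \<and> y i \<in> Z \<and> zpos (y i - x i) \<and> q i > 0"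
  shows "zpos (pmean y q L ((1/2) ^ k) - pmean x q L ((1/2) ^ k))"
proof -
  define Q where "Q = (\<Sum>j\<leftarrow>L. q j)"
  have Q: "Q \<ge> 0" unfolding Q_def by (rule sum_list_nonneg) (use assms in \<open>auto intro: less_imp_le\<close>)
  have "zpos ((\<Sum>i\<leftarrow>M. (q i / Q) *\<^sub>R cfc_pow (y i) ((1/2) ^ k)) - (\<Sum>i\<leftarrow>M. (q i / Q) *\<^sub>R cfc_pow (x i) ((1/2) ^ k)))"
    if "set M \<subseteq> set L" for M
    using that
  proof (induction M)
    case (Cons a M)
    have a: "pos (x a)" "x a \<in> Z" "pos (y a)" "y a \<in> Z" "zpos (y a - x a)" "q a > 0"
      using assms Cons.prems by auto
    have "zpos ((q a / Q) *\<^sub>R (cfc_pow (y a) ((1/2) ^ k) - cfc_pow (x a) ((1/2) ^ k)))"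
      using Q a by (intro zpos_scaleR zpos_dyadic_root_mono) auto
    then have "zpos ((q a / Q) *\<^sub>R (cfc_pow (y a) ((1/2) ^ k) - cfc_pow (x a) ((1/2) ^ k)) +
       ((\<Sum>i\<leftarrow>M. (q i / Q) *\<^sub>R cfc_pow (y i) ((1/2) ^ k)) - (\<Sum>i\<leftarrow>M. (q i / Q) *\<^sub>R cfc_pow (x i) ((1/2) ^ k))))"
      using Cons by (intro zpos_add) auto
    then show ?case by (simp add: scaleR_diff_right algebra_simps)
  qed (simp add: zpos_pos)
  then show ?thesis by (simp add: pmean_def Q_def[symmetric])
qed

theorem phi_lprod_cfc_pow_mono:
  assumes "L \<noteq> []"
    and xy: "\<And>i. i \<in> set L \<Longrightarrow> pos (x i) \<and> x i \<in> Z \<and> pos (y i) \<and> y i \<in> Z \<and> zpos (y i - x i) \<and> p i > 0"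
    and xx: "\<And>i j. i \<in> set L \<Longrightarrow> j \<in> set L \<Longrightarrow> x i * x j = x j * x i"
    and yy: "\<And>i j. i \<in> set L \<Longrightarrow> j \<in> set L \<Longrightarrow> y i * y j = y j * y i"
  shows "\<phi> (lprod (map (\<lambda>i. cfc_pow (x i) (p i)) L)) \<le> \<phi> (lprod (map (\<lambda>i. cfc_pow (y i) (p i)) L))"
proof -
  \<comment> \<open>Halved exponents make the target \<open>H * H\<close>, a product to which the
    bilinear continuity of \<phi> applies. As \<open>H\<close> is self-adjoint, \<phi> is also real
    there, and comparing real parts is enough.\<close>
  define q where "q i = p i / 2" for i
  define N where "N k = nat \<lceil>(\<Sum>j\<leftarrow>L. q j) * 2 ^ k\<rceil>" for k
  define H where "H z = lprod (map (\<lambda>i. cfc_pow (z i) (q i)) L)" for z :: "'b \<Rightarrow> 'a"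
  define S where "S z k = pmean z q L ((1/2) ^ k)" for z k
  have "(\<Sum>j\<leftarrow>L. q j) > 0" by (rule sum_list_pos) (use assms in \<open>auto simp: q_def\<close>)
  then have N: "N k > 0" for k by (simp add: N_def)
  have facts: "\<phi> (lprod (map (\<lambda>i. cfc_pow (z i) (p i)) L)) = \<phi> (H z * H z)"
      "0 \<le> \<phi> (H z * H z)"
      "(\<lambda>k. Re (\<phi> (lprod (replicate (2 * N k) (S z k))))) \<longlonglongrightarrow> Re (\<phi> (H z * H z))"
    if z: "\<And>i. i \<in> set L \<Longrightarrow> pos (z i)" and zz: "\<And>i j. i \<in> set L \<Longrightarrow> j \<in> set L \<Longrightarrow> z i * z j = z j * z i" for z
  proof -
    have q: "q i > 0" if "i \<in> set L" for i using xy[OF that] by (simp add: q_def)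
    have comm: "cfc_pow (z i) (q i) * cfc_pow (z j) (q j) = cfc_pow (z j) (q j) * cfc_pow (z i) (q i)"
      if "i \<in> set L" "j \<in> set L" for i j
      using that z zz q by (intro cfc_pow_commute) (auto intro: cfc_pow_commute[symmetric])
    have "H z * H z = lprod (map (\<lambda>i. cfc_pow (z i) (q i) * cfc_pow (z i) (q i)) L)"
      unfolding H_def by (rule lprod_map_mult[OF assms(1)]) (rule comm)
    also have "map (\<lambda>i. cfc_pow (z i) (q i) * cfc_pow (z i) (q i)) L = map (\<lambda>i. cfc_pow (z i) (p i)) L"
    proof (rule map_cong)
      fix i assume "i \<in> set L"
      then show "cfc_pow (z i) (q i) * cfc_pow (z i) (q i) = cfc_pow (z i) (p i)"
        using cfc_pow_add[OF z q q, of i i i] by (simp add: q_def)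
    qed simp
    finally show "\<phi> (lprod (map (\<lambda>i. cfc_pow (z i) (p i)) L)) = \<phi> (H z * H z)" by simp
    have "star (H z) = H z"
      unfolding H_def using assms(1) comm z q
      by (intro star_lprod_commuting) (auto simp: star_cfc_pow)
    then show "0 \<le> \<phi> (H z * H z)" using phi_star_mult[of "H z"] by simp
    have "(\<lambda>k. lprod (replicate (N k) (S z k))) \<longlonglongrightarrow> H z"
      unfolding H_def S_def N_def
      by (rule pmean_power_tendsto) (use assms(1) z q zz in auto)
    then have "(\<lambda>k. \<phi> (lprod (replicate (N k) (S z k)) * lprod (replicate (N k) (S z k)))) \<longlonglongrightarrow> \<phi> (H z * H z)"
      by (intro tendsto_phi_mult)
    moreover have "lprod (replicate (N k) (S z k)) * lprod (replicate (N k) (S z k)) =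
        lprod (replicate (2 * N k) (S z k))" for k
      using N[of k] by (simp add: mult_2 replicate_add lprod_append)
    ultimately show "(\<lambda>k. Re (\<phi> (lprod (replicate (2 * N k) (S z k))))) \<longlonglongrightarrow> Re (\<phi> (H z * H z))"
      by (simp add: tendsto_Re)
  qed
  have step: "Re (\<phi> (lprod (replicate (2 * N k) (S x k)))) \<le> Re (\<phi> (lprod (replicate (2 * N k) (S y k))))" for k
  proof -
    have r: "(1/2 :: real) ^ k > 0" by simp
    have q: "q i > 0" if "i \<in> set L" for i using xy[OF that] by (simp add: q_def)
    have S: "pos (S x k)" "S x k \<in> Z" "pos (S y k)" "S y k \<in> Z" "zpos (S y k - S x k)"
      unfolding S_def using xy q r by (auto intro!: pmean_pos Z_pmean zpos_pmean_mono)
    \<comment> \<open>\<open>phi_power_mono\<close> takes its two elements as squares of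
      self-adjoint elements of the centralizer; positivity of the means supplies the roots.\<close>
    define \<alpha> \<beta> where "\<alpha> = cfc_pow (S x k) (1/2)" and "\<beta> = cfc_pow (S y k) (1/2)"
    have sq: "\<alpha> * \<alpha> = S x k" "\<beta> * \<beta> = S y k"
      using S by (simp_all add: \<alpha>_def \<beta>_def cfc_pow_add cfc_pow_1)
    have "Re (\<phi> (lprod (replicate (2 * N k) (\<alpha> * \<alpha>)))) \<le> Re (\<phi> (lprod (replicate (2 * N k) (\<beta> * \<beta>))))"
    proof (rule phi_power_mono)
      show "zpos (\<beta> * \<beta> - \<alpha> * \<alpha>)" using S sq by simp
      show "2 \<le> 2 * N k" using N[of k] by simp
    qed (use S in \<open>simp_all add: \<alpha>_def \<beta>_def Z_cfc_pow star_cfc_pow\<close>)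
    then show ?thesis by (simp add: sq)
  qed
  have x: "\<And>i. i \<in> set L \<Longrightarrow> pos (x i)" and y: "\<And>i. i \<in> set L \<Longrightarrow> pos (y i)" using xy by auto
  have "Re (\<phi> (H x * H x)) \<le> Re (\<phi> (H y * H y))"
    by (rule LIMSEQ_le[OF facts(3)[OF x xx] facts(3)[OF y yy]]) (use step in auto)
  moreover have "Im (\<phi> (H x * H x)) = 0" "Im (\<phi> (H y * H y)) = 0"
    using facts(2)[OF x xx] facts(2)[OF y yy] by (auto simp: less_eq_complex_def)
  moreover have "\<phi> (lprod (map (\<lambda>i. cfc_pow (x i) (p i)) L)) = \<phi> (H x * H x)"
    by (rule facts(1)[OF x xx])
  moreover have "\<phi> (lprod (map (\<lambda>i. cfc_pow (y i) (p i)) L)) = \<phi> (H y * H y)"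
    by (rule facts(1)[OF y yy])
  ultimately show ?thesis by (simp add: less_eq_complex_def)
qed

end

theorem mainTheorem3:
  fixes scaleC :: "complex \<Rightarrow> 'a::{real_normed_algebra,banach} \<Rightarrow> 'a"
    and star :: "'a \<Rightarrow> 'a"
    and \<phi> :: "'a \<Rightarrow> complex"
    and n :: nat
    and x y :: "nat \<Rightarrow> 'a"
    and p :: "nat \<Rightarrow> real"
  assumes "cstar_algebra scaleC star"
    and "positive_functional scaleC star \<phi>"
    and "\<forall>i<n. x i \<in> centralizer \<phi> \<and> y i \<in> centralizer \<phi>"
    and "\<forall>i<n. \<forall>j<n. x i * x j = x j * x i"
    and "\<forall>i<n. \<forall>j<n. y i * y j = y j * y i"
    and "\<forall>i<n. cpos star (x i) \<and> cle star (x i) (y i)"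
    and "\<forall>i<n. 0 \<le> p i"
  shows "\<phi> (pow_prod n x p) \<le> \<phi> (pow_prod n y p)"
proof -
  interpret cstar_algebra scaleC star by fact
  interpret cstar_positive_functional scaleC star \<phi>
    by unfold_locales fact
  define L where "L = filter (\<lambda>i. p i \<noteq> 0) [0..<n]"
  show ?thesis
  proof (cases "L = []")
    \<comment> \<open>All exponents vanish: both products are the same \<open>undefined\<close>, so
      the claim is reflexivity.\<close>
    case True
    then show ?thesis by (simp add: pow_prod_def L_def)
  next
    case False
    have "\<phi> (lprod (map (\<lambda>i. cfc_pow (x i) (p i)) L)) \<le> \<phi> (lprod (map (\<lambda>i. cfc_pow (y i) (p i)) L))"
    proof (rule phi_lprod_cfc_pow_mono[OF False])
      fix i assume "i \<in> set L"
      then have i: "i < n" "p i \<noteq> 0" by (auto simp: L_def)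
      have "0 \<le> p i" using assms(7) i by blast
      with i have "0 < p i" by simp
      moreover have px: "pos (x i)" and pd: "pos (y i - x i)"
        using assms(6) i by (auto simp: pos_iff_cpos cle_def)
      moreover have "pos (y i)" using pos_add[OF px pd] by simp
      ultimately show "pos (x i) \<and> x i \<in> Z \<and> pos (y i) \<and> y i \<in> Z \<and> zpos (y i - x i) \<and> p i > 0"
        using assms(3) i zpos_pos by blast
    qed (use assms(4,5) in \<open>auto simp: L_def\<close>)
    then show ?thesis by (simp add: pow_prod_def L_def)
  qed
qed

end
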